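(* Let $T>0$ and $c\in\mathbb{R}$. Let $g\colon [0,+\infty)\to[0,+\infty)$ be a continuous function such that $g(0)=0$ and $g(s)>0$ for all $s>0$. Suppose also that $g$ is regularly oscillating at zero and at infinity, and that $$\lim_{s\to 0^{+}}\frac{g(s)}{s}=0 \qquad\text{and}\qquad \lim_{s\to+\infty}\frac{g(s)}{s}=0.$$ Let $a\colon\mathbb{R}\to\mathbb{R}$ be a locally integrable $T$-periodic function satisfying $\int_{0}^{T}a(t)\,dt<0$. Furthermore, suppose that there exists an interval $I\subseteq[0,T]$ such that $a(t)\geq 0$ for a.e. $t\in I$ and $\int_{I}a(t)\,dt>0$. Then there exists $\lambda^{*}>0$ such that for each $\lambda>\lambda^{*}$ the equation $$u''+cu'+\lambda a(t)g(u)=0$$ has at least two positive $T$-periodic solutions.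
   Context: A continuous function $h\colon(0,+\infty)\to(0,+\infty)$ is called regularly oscillating at zero if $\lim_{s\to0^{+},\,\omega\to1} h(\omega s)/h(s)=1$, and regularly oscillating at infinity if $\lim_{s\to+\infty,\,\omega\to1} h(\omega s)/h(s)=1$ (joint limits in $(s,\omega)$); for $g$ this is applied to the restriction of $g$ to $(0,+\infty)$. Solutions are meant in the Carathéodory sense: $u$ is continuously differentiable with $u'$ locally absolutely continuous, and the equation holds for almost every $t$. A positive $T$-periodic solution is a solution $u\colon\mathbb{R}\to\mathbb{R}$ with $u(t+T)=u(t)>0$ for all $t\in\mathbb{R}$. *)

theory Defs
  imports "HOL-Analysis.Analysis"
begin

text \<open>
  The filter \<open>F\<close> is \<^term>\<open>at_right (0::real)\<close> (oscillation at zero) or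
  \<^term>\<open>at_top :: real filter\<close> (at infinity); the product filter expresses the joint limit
  in \<open>(s, \<omega>)\<close>. Only the values of \<open>h\<close> on \<open>(0, \<infinity>)\<close> matter.
\<close>

definition regularly_oscillating :: "real filter \<Rightarrow> (real \<Rightarrow> real) \<Rightarrow> bool" where
  "regularly_oscillating F h \<longleftrightarrow>
     continuous_on {0<..} h \<and> (\<forall>s>0. h s > 0) \<and>
     ((\<lambda>(s, \<omega>). h (\<omega> * s) / h s) \<longlongrightarrow> 1) (F \<times>\<^sub>F at 1)"

definition locally_integrable :: "(real \<Rightarrow> real) \<Rightarrow> bool" where
  "locally_integrable f \<longleftrightarrow> (\<forall>K. compact K \<longrightarrow> set_integrable lebesgue K f)"

definition periodic :: "real \<Rightarrow> (real \<Rightarrow> real) \<Rightarrow> bool" where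
  "periodic T f \<longleftrightarrow> (\<forall>t. f (t + T) = f t)"

text \<open>
  The usual \<open>\<epsilon>\<close>-\<open>\<delta>\<close> definition of absolute continuity: \<open>\<D>\<close> ranges over the finite families
  of non-overlapping compact intervals \<open>[Inf K, Sup K]\<close> contained in \<open>[x, y]\<close>.
  (The constant \<^const>\<open>absolutely_continuous\<close> of the library is a relation between measures.)
\<close>

definition abs_continuous_between :: "real \<Rightarrow> real \<Rightarrow> (real \<Rightarrow> real) \<Rightarrow> bool" where
  "abs_continuous_between x y f \<longleftrightarrow>
     (\<forall>\<epsilon>>0. \<exists>\<delta>>0. \<forall>\<D>.
        \<D> division_of \<Union>\<D> \<and> \<Union>\<D> \<subseteq> {x..y} \<and> (\<Sum>K\<in>\<D>. Sup K - Inf K) < \<delta> \<longrightarrow>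
        (\<Sum>K\<in>\<D>. \<bar>f (Sup K) - f (Inf K)\<bar>) < \<epsilon>)"

definition locally_abs_continuous :: "(real \<Rightarrow> real) \<Rightarrow> bool" where
  "locally_abs_continuous f \<longleftrightarrow> (\<forall>x y. abs_continuous_between x y f)"

text \<open>Caratheodory solutions of \<open>u'' + c u' + lam a(t) g(u) = 0\<close> on the real line.\<close>

definition caratheodory_solution ::
  "real \<Rightarrow> real \<Rightarrow> (real \<Rightarrow> real) \<Rightarrow> (real \<Rightarrow> real) \<Rightarrow> (real \<Rightarrow> real) \<Rightarrow> bool" where
  "caratheodory_solution c lam a g u \<longleftrightarrow>
     u C1_differentiable_on UNIV \<and>
     locally_abs_continuous (deriv u) \<and>
     (AE t in lebesgue. deriv u differentiable (at t) \<and>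
        deriv (deriv u) t + c * deriv u t + lam * a t * g (u t) = 0)"

definition positive_periodic_solution ::
  "real \<Rightarrow> real \<Rightarrow> real \<Rightarrow> (real \<Rightarrow> real) \<Rightarrow> (real \<Rightarrow> real) \<Rightarrow> (real \<Rightarrow> real) \<Rightarrow> bool" where
  "positive_periodic_solution T c lam a g u \<longleftrightarrow>
     caratheodory_solution c lam a g u \<and> periodic T u \<and> (\<forall>t. u t > 0)"

end

theory Submission
  imports Defs "HOL-Complex_Analysis.Great_Picard"
begin

text \<open>
  With \<open>\<kappa> = p q > 0\<close> and \<open>c = q - p\<close>, the operator \<open>- u'' - c u' + \<kappa> u\<close> with periodic boundary
  conditions has a compact inverse \<open>\<Phi>\<close>, and the solutions are the fixed points of
  \<open>u \<mapsto> \<Phi> (\<kappa> u\<^sup>+ + \<lambda> a g(u\<^sup>+))\<close>. Morally, the fixed point index of this map is 1 on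
  small balls and on large balls (regular oscillation and \<open>\<integral> a < 0\<close> exclude fixed points of
  the scaled maps on the spheres), and 0 on \<open>{u. u(t\<^sub>0) < 1}\<close> for a point \<open>t\<^sub>0\<close> in the
  interior of \<open>I\<close> and \<open>\<lambda>\<close> large, because the equation with an added constant \<open>\<alpha> \<ge> 0\<close> has no
  nonnegative solution with \<open>1 \<le> u(t\<^sub>0) \<le> 2\<close>, and none at all with \<open>u(t\<^sub>0) \<le> 2\<close> if \<open>\<alpha>\<close> is large.

  Degree theory is avoided. For the large solution, \<open>\<alpha> = M (2 - u(t\<^sub>0))\<^sup>+\<close> with \<open>M\<close> large is
  added, Schauder's theorem is applied in a large ball, and then \<open>u(t\<^sub>0) > 2\<close>, so that \<open>\<alpha> = 0\<close>.
  For the small solution, the inversion \<open>y = u / \<parallel>u\<parallel>\<^sup>2\<close> turns the complement of a small ball into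
  a large ball; now \<open>\<alpha> = M (u(t\<^sub>0) - 1)\<^sup>+ + ((\<parallel>u\<parallel> - D)\<^sup>+)\<^sup>2\<close> is added, and \<open>u(t\<^sub>0) < 1\<close> together
  with an a priori bound gives \<open>\<alpha> = 0\<close>.
\<close>

section \<open>Schauder's fixed point theorem\<close>

text \<open>The obstacle is that Schauder's theorem only detects index 1, whereas the small solution
  lies in a region between a small sphere and the set u(t0) = 1, where the index is morally -1. The
  inversion exchanges inner and outer boundary, at the price of placing infinity at y = 0, where a
  spurious fixed point has to be ruled out. This is the origin of the square in the forcing:
  multiplied by (norm y)^2, the term becomes the squared positive part of 1 - D norm y, which is
  continuous and equals 1 at y = 0, and a constant source 1 admits no periodic solution. Without the
  square the product would vanish there. Both balls rest on one estimate. As g(s)/s tends to 0 at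
  both ends, a solution with maximum R, for R very small or very large, is nearly constant relative
  to R. Regular oscillation then makes g(u) nearly equal to g(R), so a g(u) has negative mean, while
  integrating the unforced equation over a period gives a nonnegative one.\<close>

lemma brouwer_cube_approx:
  fixes f :: "(nat \<Rightarrow> real) \<Rightarrow> nat \<Rightarrow> real" and n :: nat
  defines "Q \<equiv> {x. \<forall>i<n. 0 \<le> x i \<and> x i \<le> 1}"
  assumes range: "\<And>x. x \<in> Q \<Longrightarrow> f x \<in> Q"
    and unif: "\<And>e. e > 0 \<Longrightarrow> \<exists>d>0. \<forall>x\<in>Q. \<forall>y\<in>Q. (\<forall>i<n. \<bar>x i - y i\<bar> < d) \<longrightarrow> (\<forall>i<n. \<bar>f x i - f y i\<bar> < e)"
    and e: "e > 0"
  shows "\<exists>x\<in>Q. \<forall>i<n. \<bar>f x i - x i\<bar> < e"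
proof -
  \<comment> \<open>Kuhn labels: in coordinate i the label is 0 where f does not decrease x i and 1
    otherwise, with the faces x i = 0 and x i = 1 forced. A small grid cell on which every
    coordinate shows both labels is nearly fixed. The dimension n is a number and not a type because
    it depends on the accuracy in Schauder's approximation.\<close>
  define l :: "(nat \<Rightarrow> real) \<Rightarrow> nat \<Rightarrow> nat"
    where "l = (\<lambda>x i. if x i = 0 then 0 else if x i = 1 then 1 else if x i \<le> f x i then 0 else 1)"
  have l1: "\<And>x i. l x i \<le> 1"
    and l2: "\<And>x i. x i = 0 \<Longrightarrow> l x i = 0"
    and l3: "\<And>x i. x i = 1 \<Longrightarrow> l x i = 1"
    by (simp_all add: l_def)
  have fQ: "0 \<le> f x i \<and> f x i \<le> 1" if "x \<in> Q" "i < n" for x i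
    using range[OF that(1)] that(2) by (simp add: Q_def)
  have l4: "x i \<le> f x i" if "x \<in> Q" "i < n" "l x i = 0" for x i
    using that fQ[OF that(1,2)] by (simp add: l_def split: if_splits)
  have l5: "f x i \<le> x i" if "x \<in> Q" "i < n" "l x i = 1" for x i
    using that fQ[OF that(1,2)] by (simp add: l_def split: if_splits)
  obtain d where d: "d > 0"
    "\<And>x y i. x \<in> Q \<Longrightarrow> y \<in> Q \<Longrightarrow> (\<And>i. i < n \<Longrightarrow> \<bar>x i - y i\<bar> < d) \<Longrightarrow> i < n \<Longrightarrow> \<bar>f x i - f y i\<bar> < e/3"
    using unif[of "e/3"] e by auto
  \<comment> \<open>The mesh 1/p lies below d', so moving within a cell changes both the coordinates
    and the values of f by less than e/3; one error of each kind enters, which stays below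
    e.\<close>
  define d' where "d' = min d (e/3)"
  have "d' > 0" using d e by (simp add: d'_def)
  then obtain p :: nat where p: "1 / d' < real p"
    using reals_Archimedean2 by blast
  with \<open>d' > 0\<close> have p0: "0 < p"
    by (metis divide_pos_pos gr0I of_nat_0 less_asym zero_less_one)
  have pd: "1 / real p < d'"
    using p \<open>d' > 0\<close> p0 by (simp add: field_simps)
  define sc where "sc = (\<lambda>(x::nat\<Rightarrow>nat) j. real (x j) / real p)"
  have scQ: "sc x \<in> Q" if "\<forall>i<n. x i \<le> p" for x
    using that p0 by (auto simp: sc_def Q_def)
  obtain q where q: "\<forall>i<n. q i < p"
    and qrs: "\<forall>i<n. \<exists>r s. (\<forall>j<n. q j \<le> r j \<and> r j \<le> q j + 1) \<and> (\<forall>j<n. q j \<le> s j \<and> s j \<le> q j + 1) \<and> l (sc r) i \<noteq> l (sc s) i"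
  proof (rule kuhn_lemma[of p n "\<lambda>x. l (sc x)"])
    show "\<forall>x. (\<forall>i<n. x i \<le> p) \<longrightarrow> (\<forall>i<n. l (sc x) i = 0 \<or> l (sc x) i = 1)"
      using l1 by (metis less_one nat_less_le)
    show "\<forall>x. (\<forall>i<n. x i \<le> p) \<longrightarrow> (\<forall>i<n. x i = 0 \<longrightarrow> l (sc x) i = 0)"
      using l2 scQ by (simp add: sc_def)
    show "\<forall>x. (\<forall>i<n. x i \<le> p) \<longrightarrow> (\<forall>i<n. x i = p \<longrightarrow> l (sc x) i = 1)"
      using l3 scQ p0 by (simp add: sc_def)
  qed (use p0 in auto)
  have qQ: "sc q \<in> Q" using q by (intro scQ) (auto intro: less_imp_le)
  have "\<bar>f (sc q) i - sc q i\<bar> < e" if i: "i < n" for i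
  proof -
    obtain r s where r: "\<forall>j<n. q j \<le> r j \<and> r j \<le> q j + 1"
      and s: "\<forall>j<n. q j \<le> s j \<and> s j \<le> q j + 1" and ne: "l (sc r) i \<noteq> l (sc s) i"
      using qrs i by blast
    have near: "\<bar>sc r j - sc q j\<bar> < d' \<and> sc r \<in> Q" if "j < n" "\<forall>j<n. q j \<le> r j \<and> r j \<le> q j + 1" for r j
    proof
      have "\<bar>sc r j - sc q j\<bar> = \<bar>real (r j) - real (q j)\<bar> / real p"
        by (simp add: sc_def diff_divide_distrib[symmetric])
      also have "\<dots> \<le> 1 / real p"
        using that by (intro divide_right_mono) auto
      finally show "\<bar>sc r j - sc q j\<bar> < d'" using pd by simp
      show "sc r \<in> Q"
        using that(2) q by (intro scQ) fastforce
    qed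
    have key: "\<bar>f (sc q) i - sc q i\<bar> < e"
      if r: "\<forall>j<n. q j \<le> r j \<and> r j \<le> q j + 1"
      and s: "\<forall>j<n. q j \<le> s j \<and> s j \<le> q j + 1" and "l (sc r) i = 0" "l (sc s) i = 1" for r s
    proof -
      have "sc r i \<le> f (sc r) i" "f (sc s) i \<le> sc s i"
        using l4 l5 that near i by blast+
      moreover have "\<bar>f (sc r) i - f (sc q) i\<bar> < e/3"
        using near[OF _ r] i qQ by (intro d(2)) (auto simp: d'_def)
      moreover have "\<bar>f (sc s) i - f (sc q) i\<bar> < e/3"
        using near[OF _ s] i qQ by (intro d(2)) (auto simp: d'_def)
      moreover have "\<bar>sc r i - sc q i\<bar> < e/3" "\<bar>sc s i - sc q i\<bar> < e/3"
        using near[OF i r] near[OF i s] by (auto simp: d'_def)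
      ultimately show ?thesis by linarith
    qed
    have "l (sc r) i = 0 \<and> l (sc s) i = 1 \<or> l (sc r) i = 1 \<and> l (sc s) i = 0"
      using ne l1[of "sc r" i] l1[of "sc s" i] by linarith
    then show ?thesis using key r s by blast
  qed
  then show ?thesis using qQ by blast
qed

text \<open>Gives uniform continuity of the coefficient map on the cube without a topology on the
  coefficient sequences: the combinations lie in a compact set of the normed space, built by adding
  one segment at a time.\<close>

lemma compact_cube_combinations:
  fixes p :: "nat \<Rightarrow> 'a::real_normed_vector"
  shows "\<exists>K. compact K \<and> (\<forall>l. (\<forall>i<n. 0 \<le> l i \<and> l i \<le> 1) \<longrightarrow> (\<Sum>i<n. l i *\<^sub>R p i) \<in> K)"
proof (induction n)
  case 0
  then show ?case by (intro exI[of _ "{0}"]) auto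
next
  case (Suc n)
  then obtain K where K: "compact K" "\<And>l. (\<forall>i<n. 0 \<le> l i \<and> l i \<le> 1) \<Longrightarrow> (\<Sum>i<n. l i *\<^sub>R p i) \<in> K"
    by blast
  have "compact ((\<lambda>t. t *\<^sub>R p n) ` {0..1::real})"
    by (intro compact_continuous_image continuous_intros) auto
  then have "compact {x + y |x y. x \<in> K \<and> y \<in> (\<lambda>t. t *\<^sub>R p n) ` {0..1::real}}"
    using K(1) compact_sums by blast
  moreover have "(\<Sum>i<Suc n. l i *\<^sub>R p i) \<in> {x + y |x y. x \<in> K \<and> y \<in> (\<lambda>t. t *\<^sub>R p n) ` {0..1::real}}"
    if "\<forall>i<Suc n. 0 \<le> l i \<and> l i \<le> 1" for l
  proof -
    have "(\<Sum>i<n. l i *\<^sub>R p i) \<in> K" using that by (intro K(2)) auto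
    moreover have "l n *\<^sub>R p n \<in> (\<lambda>t. t *\<^sub>R p n) ` {0..1::real}" using that by (intro imageI) auto
    ultimately show ?thesis by (simp del: atLeastAtMost_iff) blast
  qed
  ultimately show ?case by blast
qed

text \<open>Schauder projection: a partition of unity subordinate to a finite net of K replaces each
  value of f by a convex combination of net points at distance at most d. Passing to the
  coefficients yields an approximate fixed point problem on a cube.\<close>

lemma Schauder_approx:
  fixes f :: "'a::real_normed_vector \<Rightarrow> 'a"
  assumes cont: "continuous_on UNIV f" and K: "compact K" "range f \<subseteq> K" and e: "e > 0"
  shows "\<exists>x. norm (f x - x) < e"
proof -
  define d where "d = e / 2"
  have d: "d > 0" using e by (simp add: d_def)
  obtain k where k: "finite k" "k \<subseteq> K" "K \<subseteq> (\<Union>x\<in>k. ball x d)"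
    using seq_compact_imp_totally_bounded[OF compact_imp_seq_compact[OF K(1)]] d by metis
  obtain p where p: "bij_betw p {0..<card k} k"
    using k(1) ex_bij_betw_nat_finite by blast
  define n where "n = card k"
  define \<phi> where "\<phi> = (\<lambda>i y. max 0 (d - norm (y - p i)))"
  define S where "S = (\<lambda>y. \<Sum>i<n. \<phi> i y)"
  have \<phi>0: "\<phi> i y \<ge> 0" for i y by (simp add: \<phi>_def)
  have Spos: "S y > 0" if y: "y \<in> K" for y
  proof -
    obtain x where x: "x \<in> k" "y \<in> ball x d" using k(3) y by blast
    then obtain i where "i < n" "x = p i"
      using bij_betw_imp_surj_on[OF p] unfolding n_def by (metis atLeastLessThan_iff imageE)
    then have "i < n" "y \<in> ball (p i) d" using x by auto
    then have "\<phi> i y > 0" by (simp add: \<phi>_def dist_norm norm_minus_commute)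
    then show ?thesis unfolding S_def using \<open>i < n\<close> \<phi>0
      by (intro sum_pos2[of _ i]) auto
  qed
  define E where "E = (\<lambda>l::nat\<Rightarrow>real. \<Sum>i<n. l i *\<^sub>R p i)"
  define c where "c = (\<lambda>x i. \<phi> i (f x) / S (f x))"
  define Q where "Q = {x::nat\<Rightarrow>real. \<forall>i<n. 0 \<le> x i \<and> x i \<le> 1}"
  \<comment> \<open>Lipschitz constant of \<open>E\<close> for the maximum norm of the coefficients;
    the summand 1 keeps it positive and the estimates strict even if all net points are 0.\<close>
  define N where "N = 1 + (\<Sum>i<n. norm (p i))"
  have N: "N > 0" unfolding N_def by (smt (verit) norm_ge_zero sum_nonneg)
  have N': "(\<Sum>i<n. norm (p i)) < N" by (simp add: N_def)
  have fS: "S (f x) > 0" for x using K(2) Spos by blast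
  have Elip: "norm (E l - E l') < t" if "\<And>i. i < n \<Longrightarrow> \<bar>l i - l' i\<bar> < t / N" "t > 0" for l l' t
  proof -
    have "norm (E l - E l') = norm (\<Sum>i<n. (l i - l' i) *\<^sub>R p i)"
      by (simp add: E_def sum_subtractf scaleR_diff_left)
    also have "\<dots> \<le> (\<Sum>i<n. t / N * norm (p i))"
      using that(1) by (intro sum_norm_le) (simp del: times_divide_eq_left add: mult_right_mono less_imp_le)
    also have "\<dots> = t / N * (\<Sum>i<n. norm (p i))" by (simp add: sum_distrib_left)
    also have "\<dots> < t / N * N" using N N' \<open>t > 0\<close> by (intro mult_strict_left_mono) auto
    finally show ?thesis using N by simp
  qed
  have ccont: "continuous_on A (\<lambda>x. c x i)" for i A
  proof -
    have "continuous_on A f" using cont continuous_on_subset by blast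
    then show ?thesis unfolding c_def \<phi>_def S_def
      using fS unfolding S_def \<phi>_def by (intro continuous_intros) (auto simp: less_imp_neq[symmetric])
  qed
  obtain KQ where KQ: "compact KQ" "\<And>l. l \<in> Q \<Longrightarrow> E l \<in> KQ"
    using compact_cube_combinations[of n p] unfolding E_def Q_def by blast
  \<comment> \<open>The map from l to \<open>c (E l)\<close> acts on coefficients and preserves the
    cube. The point l itself need not have coordinate sum 1; only the values of \<open>c\<close>
    do.\<close>
  have "\<exists>x\<in>Q. \<forall>i<n. \<bar>c (E x) i - x i\<bar> < d / N"
    unfolding Q_def
  proof (rule brouwer_cube_approx)
    fix x :: "nat \<Rightarrow> real" assume "x \<in> {x. \<forall>i<n. 0 \<le> x i \<and> x i \<le> 1}"
    have "\<phi> i y \<le> S y" if "i < n" for i y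
      unfolding S_def using that \<phi>0 by (intro member_le_sum) auto
    then show "c (E x) \<in> {x. \<forall>i<n. 0 \<le> x i \<and> x i \<le> 1}"
      using \<phi>0 fS by (auto simp: c_def less_imp_le)
  next
    fix t :: real assume t: "t > 0"
    have "\<exists>d>0. \<forall>x\<in>KQ. \<forall>y\<in>KQ. dist y x < d \<longrightarrow> dist (c y i) (c x i) < t" for i
      using compact_uniformly_continuous[OF ccont[of KQ i] KQ(1)] t
      unfolding uniformly_continuous_on_def by blast
    then obtain dd where dd: "\<And>i. dd i > 0"
      "\<And>i. \<forall>x\<in>KQ. \<forall>y\<in>KQ. dist y x < dd i \<longrightarrow> dist (c y i) (c x i) < t" by metis
    define m where "m = Min (insert 1 (dd ` {..<n}))"
    have m: "m > 0" "\<And>i. i < n \<Longrightarrow> m \<le> dd i"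
      using dd(1) by (auto simp: m_def)
    show "\<exists>d>0. \<forall>x\<in>{x::nat\<Rightarrow>real. \<forall>i<n. 0 \<le> x i \<and> x i \<le> 1}. \<forall>y\<in>{x. \<forall>i<n. 0 \<le> x i \<and> x i \<le> 1}.
              (\<forall>i<n. \<bar>x i - y i\<bar> < d) \<longrightarrow> (\<forall>i<n. \<bar>c (E x) i - c (E y) i\<bar> < t)"
    proof (intro exI[of _ "m / N"] conjI ballI impI allI)
      show "m / N > 0" using m N by simp
      fix x y :: "nat \<Rightarrow> real" and i assume "x \<in> {x. \<forall>i<n. 0 \<le> x i \<and> x i \<le> 1}" "y \<in> {x. \<forall>i<n. 0 \<le> x i \<and> x i \<le> 1}"
        and *: "\<forall>i<n. \<bar>x i - y i\<bar> < m / N" "i < n"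
      then have "E x \<in> KQ" "E y \<in> KQ" using KQ by (auto simp: Q_def)
      moreover have "norm (E x - E y) < m" using * m by (intro Elip) auto
      then have "dist (E x) (E y) < dd i" using m(2)[OF *(2)] by (simp add: dist_norm)
      ultimately have "dist (c (E x) i) (c (E y) i) < t" using dd(2) by blast
      then show "\<bar>c (E x) i - c (E y) i\<bar> < t" by (simp add: dist_norm)
    qed
  qed (use d N in auto)
  then obtain l where l: "\<And>i. i < n \<Longrightarrow> \<bar>c (E l) i - l i\<bar> < d / N" by blast
  define y where "y = f (E l)"
  have csum: "(\<Sum>i<n. c (E l) i) = 1"
    using fS[of "E l"] by (simp add: c_def S_def sum_divide_distrib[symmetric])
  have "y - E (c (E l)) = (\<Sum>i<n. c (E l) i *\<^sub>R (y - p i))"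
    using csum by (simp add: E_def scaleR_diff_right sum_subtractf scaleR_sum_left[symmetric])
  also have "norm \<dots> \<le> (\<Sum>i<n. c (E l) i * d)"
  proof (intro sum_norm_le)
    fix i
    have "\<phi> i y * norm (y - p i) \<le> \<phi> i y * d"
      by (cases "norm (y - p i) < d") (auto simp: \<phi>_def)
    then show "norm (c (E l) i *\<^sub>R (y - p i)) \<le> c (E l) i * d"
      using fS[of "E l"] \<phi>0[of i y] by (simp add: c_def y_def divide_right_mono)
  qed
  also have "\<dots> = d" by (simp add: sum_distrib_right[symmetric] csum)
  finally have "norm (y - E (c (E l))) \<le> d" .
  moreover have "norm (E (c (E l)) - E l) < d"
    using l d by (intro Elip) auto
  ultimately have "norm (y - E l) < e"
    using norm_triangle_ineq[of "y - E (c (E l))" "E (c (E l)) - E l"] by (simp add: d_def)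
  then show ?thesis unfolding y_def by blast
qed

theorem Schauder_fixpoint:
  fixes f :: "'a::real_normed_vector \<Rightarrow> 'a"
  assumes cont: "continuous_on UNIV f" and K: "compact K" "range f \<subseteq> K"
  shows "\<exists>x. f x = x"
proof -
  have "\<forall>n. \<exists>x. norm (f x - x) < 1 / Suc n"
    using Schauder_approx[OF assms] by simp
  then obtain x where x: "\<And>n. norm (f (x n) - x n) < 1 / Suc n" by metis
  have "seq_compact K" using K(1) by (rule compact_imp_seq_compact)
  moreover have "\<forall>n. f (x n) \<in> K" using K(2) by blast
  ultimately obtain y r where r: "strict_mono (r::nat\<Rightarrow>nat)" "((\<lambda>n. f (x n)) \<circ> r) \<longlonglongrightarrow> y"
    by (rule seq_compactE) 
  have "(\<lambda>n. f (x n) - x n) \<longlonglongrightarrow> 0"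
    by (rule tendsto_norm_zero_cancel, rule tendsto_sandwich[of "\<lambda>_. 0" _ _ "\<lambda>n. 1 / Suc n"])
      (use x LIMSEQ_inverse_real_of_nat in \<open>auto intro!: always_eventually less_imp_le simp: inverse_eq_divide\<close>)
  then have "((\<lambda>n. f (x n) - x n) \<circ> r) \<longlonglongrightarrow> 0" using r(1) by (rule LIMSEQ_subseq_LIMSEQ)
  then have "(\<lambda>n. f (x (r n)) - (f (x (r n)) - x (r n))) \<longlonglongrightarrow> y - 0"
    using r(2) by (intro tendsto_diff) (auto simp: o_def)
  then have xr: "(\<lambda>n. x (r n)) \<longlonglongrightarrow> y" by simp
  have "(\<lambda>n. f (x (r n))) \<longlonglongrightarrow> f y"
    using continuous_on_tendsto_compose[OF cont xr] by simp
  then show ?thesis using r(2) LIMSEQ_unique unfolding o_def by blast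
qed

text \<open>With the radial retraction \<rho> onto the ball, the map \<rho> after f after \<rho> has
  a fixed point by Schauder; the inner \<rho> is there because f is assumed compact only on the
  ball. If f x lies outside the ball, then x is on the sphere and f x = (norm (f x) / R) x, which
  \<open>bd\<close> forbids.\<close>

corollary Leray_Schauder_ball:
  fixes f :: "'a::real_normed_vector \<Rightarrow> 'a"
  assumes cont: "continuous_on UNIV f" and K: "compact K" "f ` cball 0 R \<subseteq> K" and R: "R > 0"
    and bd: "\<And>x \<mu>. norm x = R \<Longrightarrow> \<mu> > 1 \<Longrightarrow> f x \<noteq> \<mu> *\<^sub>R x"
  shows "\<exists>x. norm x \<le> R \<and> f x = x"
proof -
  define \<rho> where "\<rho> = (\<lambda>x::'a. (R / max R (norm x)) *\<^sub>R x)"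
  have c: "continuous_on A \<rho>" for A
    unfolding \<rho>_def using R by (intro continuous_intros) auto
  have \<rho>R: "norm (\<rho> x) \<le> R" for x
    using R by (auto simp: \<rho>_def max_def field_simps)
  have \<rho>id: "\<rho> x = x" if "norm x \<le> R" for x
    using that R by (auto simp: \<rho>_def max_def)
  have "\<exists>x. \<rho> (f (\<rho> x)) = x"
  proof (rule Schauder_fixpoint)
    show "continuous_on UNIV (\<lambda>x. \<rho> (f (\<rho> x)))"
      by (rule continuous_on_compose2[OF c[of UNIV]], rule continuous_on_compose2[OF cont c]) auto
    show "compact (\<rho> ` K)" using K(1) c by (rule compact_continuous_image[rotated])
    show "range (\<lambda>x. \<rho> (f (\<rho> x))) \<subseteq> \<rho> ` K"
      using \<rho>R K(2) by (force simp: image_subset_iff)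
  qed
  then obtain x where x: "\<rho> (f (\<rho> x)) = x" by blast
  then have xR: "norm x \<le> R" using \<rho>R by metis
  then have x': "\<rho> (f x) = x" using x \<rho>id by simp
  show ?thesis
  proof (cases "norm (f x) \<le> R")
    case True
    then show ?thesis using x' xR \<rho>id by auto
  next
    case False
    then have "norm (f x) > R" by simp
    then have xe: "x = (R / norm (f x)) *\<^sub>R f x" using x' unfolding \<rho>_def by simp
    have "norm x = \<bar>R / norm (f x)\<bar> * norm (f x)" by (subst xe) simp
    then have "norm x = R" using \<open>norm (f x) > R\<close> R by auto
    moreover have "(norm (f x) / R) *\<^sub>R x = f x"
      using \<open>norm (f x) > R\<close> R arg_cong[OF xe, of "\<lambda>v. (norm (f x) / R) *\<^sub>R v"] by simp
    moreover have "norm (f x) / R > 1" using \<open>norm (f x) > R\<close> R by simp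
    ultimately show ?thesis using bd by metis
  qed
qed

section \<open>Periodic solutions in integrated form\<close>

lemma locally_integrable_Icc:
  "locally_integrable f \<Longrightarrow> f absolutely_integrable_on {x..y}"
  by (simp add: locally_integrable_def)

lemma periodic_mult:
  assumes "periodic T f"
  shows "f (t + of_int k * T) = f t"
proof (induction k rule: int_induct[where k = 0])
  case base
  then show ?case by simp
next
  case (step1 i)
  have "t + of_int (i + 1) * T = (t + of_int i * T) + T" by (simp add: algebra_simps)
  then show ?case using assms step1 unfolding periodic_def by metis
next
  case (step2 i)
  have "(t + of_int (i - 1) * T) + T = t + of_int i * T" by (simp add: algebra_simps)
  then show ?case using assms step2 unfolding periodic_def by metis
qed

lemma period_window:
  fixes T t x :: real
  assumes "T > 0"
  obtains k :: int where "x \<le> t + of_int k * T" "t + of_int k * T < x + T"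
proof
  define k where "k = - \<lfloor>(t - x) / T\<rfloor>"
  have "of_int \<lfloor>(t - x) / T\<rfloor> \<le> (t - x) / T" "(t - x) / T < of_int \<lfloor>(t - x) / T\<rfloor> + 1"
    by linarith+
  then have "of_int \<lfloor>(t - x) / T\<rfloor> * T \<le> t - x" "t - x < (of_int \<lfloor>(t - x) / T\<rfloor> + 1) * T"
    using assms by (simp_all only: pos_le_divide_eq pos_divide_less_eq)
  then show "x \<le> t + of_int k * T" "t + of_int k * T < x + T"
    by (simp_all add: k_def algebra_simps)
qed

lemma periodic_attains_max:
  fixes f :: "real \<Rightarrow> real"
  assumes "T > 0" "periodic T f" "continuous_on UNIV f"
  obtains t where "t \<in> {0..T}" "\<And>s. f s \<le> f t"
proof -
  have "continuous_on {0..T} f" using assms(3) continuous_on_subset by blast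
  then obtain t where t: "t \<in> {0..T}" "\<And>s. s \<in> {0..T} \<Longrightarrow> f s \<le> f t"
    using continuous_attains_sup[of "{0..T}" f] \<open>T > 0\<close> by auto
  have "f s \<le> f t" for s
  proof -
    obtain k where "0 \<le> s + of_int k * T" "s + of_int k * T < 0 + T"
      using period_window[OF \<open>T > 0\<close>] .
    then show ?thesis using t(2)[of "s + of_int k * T"] periodic_mult[OF assms(2)] by simp
  qed
  then show ?thesis using t that by blast
qed

lemma periodic_attains_min:
  fixes f :: "real \<Rightarrow> real"
  assumes "T > 0" "periodic T f" "continuous_on UNIV f"
  obtains t where "t \<in> {0..T}" "\<And>s. f t \<le> f s"
proof -
  have "periodic T (\<lambda>t. - f t)" "continuous_on UNIV (\<lambda>t. - f t)"
    using assms by (auto simp: periodic_def intro: continuous_intros)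
  then show ?thesis using periodic_attains_max[OF \<open>T > 0\<close>, of "\<lambda>t. - f t"] that by auto
qed

lemma has_integral_periodic_shift:
  fixes f :: "real \<Rightarrow> real"
  assumes "periodic T f" "(f has_integral i) {x..y}"
  shows "(f has_integral i) {x + of_int k * T..y + of_int k * T}"
proof -
  have "((\<lambda>t. f (1 *\<^sub>R t + - (of_int k * T))) has_integral i)
      ((\<lambda>t. (1/1) *\<^sub>R t + - ((1/1) *\<^sub>R (- (of_int k * T)))) ` {x..y})"
    using has_integral_affinity[of f i x y 1 "- (of_int k * T)"] assms(2) by simp
  moreover have "f (t - of_int k * T) = f t" for t
    using periodic_mult[OF assms(1), of t "-k"] by simp
  moreover have "(\<lambda>t. t + of_int k * T) ` {x..y} = {x + of_int k * T..y + of_int k * T}"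
    by simp
  ultimately show ?thesis by simp
qed

lemma integral_periodic_window:
  fixes f :: "real \<Rightarrow> real"
  assumes T: "T > 0" and per: "periodic T f" and int: "\<And>x y. f integrable_on {x..y}"
  shows "integral {x..x+T} f = integral {0..T} f"
proof -
  obtain k :: int where k: "x \<le> 0 + of_int k * T" "0 + of_int k * T < x + T"
    using period_window[OF T] .
  \<comment> \<open>The window is cut at the multiple m of T that it contains: the right piece is
    moved back to \<open>{0..x+T-m}\<close>, the left piece to \<open>{x+T-m..T}\<close>.\<close>
  define m where "m = of_int k * T"
  have m: "x \<le> m" "m \<le> x + T" using k by (auto simp: m_def)
  have sh: "integral {u + of_int j * T..v + of_int j * T} f = integral {u..v} f" for u v :: real and j :: int
    using has_integral_periodic_shift[OF per integrable_integral[OF int], where k = j and x = u and y = v] by (rule integral_unique)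
  have "integral {x..x+T} f = integral {x..m} f + integral {m..x+T} f"
    using Henstock_Kurzweil_Integration.integral_combine[OF m int] by simp
  also have "integral {m..x+T} f = integral {0..x+T-m} f"
    using sh[of 0 k "x + T - m"] by (simp add: m_def)
  also have "integral {x..m} f = integral {x+T-m..T} f"
    using sh[of x "1-k" m] by (simp add: m_def algebra_simps)
  also have "integral {x+T-m..T} f + integral {0..x+T-m} f = integral {0..T} f"
    using Henstock_Kurzweil_Integration.integral_combine[of 0 "x+T-m" T f] m int by simp
  finally show ?thesis .
qed

lemma henstock_integral_nonneg_AE:
  fixes f :: "real \<Rightarrow> real"
  assumes "f integrable_on S" and "AE t in lebesgue. t \<in> S \<longrightarrow> f t \<ge> 0"
  shows "integral S f \<ge> 0"
proof -
  obtain N where N: "negligible N" "{t. \<not> (t \<in> S \<longrightarrow> f t \<ge> 0)} \<subseteq> N"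
    using assms(2) unfolding eventually_ae_filter negligible_iff_null_sets by auto
  define f' where "f' = (\<lambda>t. if t \<in> N then 0 else f t)"
  have "integral S f = integral S f'"
    by (rule integral_spike[OF N(1)]) (auto simp: f'_def)
  also have "\<dots> \<ge> 0"
    using N(2) by (intro Henstock_Kurzweil_Integration.integral_nonneg integrable_spike[OF assms(1) N(1)])
      (auto simp: f'_def)
  finally show ?thesis .
qed

lemma exp_abs_bounds:
  fixes c \<xi> t L :: real
  assumes "\<bar>\<xi> - t\<bar> \<le> L"
  shows "exp (c * (\<xi> - t)) \<le> exp (\<bar>c\<bar> * L)" "exp (- \<bar>c\<bar> * L) \<le> exp (c * (\<xi> - t))"
proof -
  have "\<bar>c * (\<xi> - t)\<bar> \<le> \<bar>c\<bar> * L" unfolding abs_mult by (intro mult_left_mono assms) auto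
  then show "exp (c * (\<xi> - t)) \<le> exp (\<bar>c\<bar> * L)" "exp (- \<bar>c\<bar> * L) \<le> exp (c * (\<xi> - t))"
    by (auto simp: abs_le_iff)
qed

text \<open>The pair \<open>(u, u')\<close> solves \<open>u'' + c u' + H(t) = 0\<close> in integrated form, so that no derivative
  of \<open>u'\<close> is mentioned.\<close>

definition periodic_weak_solution ::
  "real \<Rightarrow> real \<Rightarrow> (real \<Rightarrow> real) \<Rightarrow> (real \<Rightarrow> real) \<Rightarrow> (real \<Rightarrow> real) \<Rightarrow> bool" where
  "periodic_weak_solution T c H u z \<longleftrightarrow>
     periodic T u \<and> (\<forall>t. (u has_real_derivative z t) (at t)) \<and>
     (\<forall>x y. x \<le> y \<longrightarrow> (H has_integral (z x + c * u x - (z y + c * u y))) {x..y})"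

context
  fixes T c :: real and H u z :: "real \<Rightarrow> real"
  assumes T: "T > 0" and sol: "periodic_weak_solution T c H u z"
begin

lemma pws_periodic: "periodic T u"
  and pws_deriv: "(u has_real_derivative z t) (at t)"
  and pws_has_integral: "x \<le> y \<Longrightarrow> (H has_integral (z x + c * u x - (z y + c * u y))) {x..y}"
  using sol by (auto simp: periodic_weak_solution_def)

lemma pws_integrable: "H integrable_on {x..y}"
  using pws_has_integral[of x y] by (cases "x \<le> y") auto

lemma pws_integral: "x \<le> y \<Longrightarrow> integral {x..y} H = z x + c * u x - (z y + c * u y)"
  using pws_has_integral integral_unique by blast

lemma pws_continuous: "continuous_on A u"
  using pws_deriv DERIV_continuous_on by (meson has_field_derivative_at_within)

lemma pws_deriv_periodic: "periodic T z"
proof -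
  have "z (t + T) = z t" for t
  proof -
    have "((\<lambda>s. u (s + T)) has_real_derivative z (t + T)) (at t)"
      using pws_deriv[of "t + T"] by (simp add: DERIV_shift)
    then have "(u has_real_derivative z (t + T)) (at t)"
      using pws_periodic by (simp add: periodic_def)
    then show ?thesis using pws_deriv DERIV_unique by blast
  qed
  then show ?thesis by (simp add: periodic_def)
qed

lemma pws_deriv_continuous: "continuous_on UNIV z"
proof -
  have "isCont z t" for t
  proof -
    have 1: "continuous_on {t-1..t+1} (\<lambda>s. z (t-1) + c * u (t-1) - integral {t-1..s} H - c * u s)"
      by (intro continuous_intros indefinite_integral_continuous_1 pws_integrable pws_continuous)
    have 2: "z (t-1) + c * u (t-1) - integral {t-1..s} H - c * u s = z s" if "s \<in> {t-1..t+1}" for s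
      using that pws_integral[of "t-1" s] by simp
    have "continuous_on {t-1..t+1} z" by (rule continuous_on_eq[OF 1 2])
    then show ?thesis by (rule continuous_on_interior) simp
  qed
  then show ?thesis by (simp add: continuous_at_imp_continuous_on)
qed

lemma pws_integral_period: "integral {x..x+T} H = 0"
  using pws_integral[of x "x+T"] T pws_periodic pws_deriv_periodic by (simp add: periodic_def)

text \<open>Mean value theorem for \<open>e\<^sup>c\<^sup>s (u(s) - u(x))\<close>.\<close>

lemma pws_increment_right:
  assumes "x < t"
  obtains \<xi> where "x < \<xi>" "\<xi> < t"
    "u t - u x = (t - x) * exp (c * (\<xi> - t)) * (z x - integral {x..\<xi>} H)"
proof -
  have "((\<lambda>s. exp (c * s) * (u s - u x)) has_real_derivative exp (c * s) * (z s + c * (u s - u x))) (at s)" for s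
    by (auto intro!: derivative_eq_intros pws_deriv simp: algebra_simps)
  then obtain \<xi> where \<xi>: "x < \<xi>" "\<xi> < t" and
    eq: "exp (c*t) * (u t - u x) - exp (c*x) * (u x - u x) = (t - x) * (exp (c*\<xi>) * (z \<xi> + c * (u \<xi> - u x)))"
    using MVT2[OF assms, of "\<lambda>s. exp (c * s) * (u s - u x)" "\<lambda>s. exp (c * s) * (z s + c * (u s - u x))"] by blast
  \<comment> \<open>The exponential weight is chosen for this: its derivative leaves exactly the
    combination of z and u whose increments the integrated equation controls.\<close>
  have "z \<xi> + c * (u \<xi> - u x) = z x - integral {x..\<xi>} H"
    using pws_integral[of x \<xi>] \<xi> by (simp add: algebra_simps)
  moreover have "exp (c*\<xi>) = exp (c*t) * exp (c * (\<xi> - t))"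
    by (simp add: exp_add[symmetric] algebra_simps)
  ultimately have "exp (c*t) * (u t - u x) = exp (c*t) * ((t - x) * exp (c * (\<xi> - t)) * (z x - integral {x..\<xi>} H))"
    using eq by simp
  then show ?thesis using that \<xi> by simp
qed

lemma pws_increment_left:
  assumes "t < x"
  obtains \<xi> where "t < \<xi>" "\<xi> < x"
    "u x - u t = (x - t) * exp (c * (\<xi> - t)) * (z x + integral {\<xi>..x} H)"
proof -
  have "((\<lambda>s. exp (c * s) * (u s - u x)) has_real_derivative exp (c * s) * (z s + c * (u s - u x))) (at s)" for s
    by (auto intro!: derivative_eq_intros pws_deriv simp: algebra_simps)
  then obtain \<xi> where \<xi>: "t < \<xi>" "\<xi> < x" and
    eq: "exp (c*x) * (u x - u x) - exp (c*t) * (u t - u x) = (x - t) * (exp (c*\<xi>) * (z \<xi> + c * (u \<xi> - u x)))"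
    using MVT2[OF assms, of "\<lambda>s. exp (c * s) * (u s - u x)" "\<lambda>s. exp (c * s) * (z s + c * (u s - u x))"] by blast
  have "z \<xi> + c * (u \<xi> - u x) = z x + integral {\<xi>..x} H"
    using pws_integral[of \<xi> x] \<xi> by (simp add: algebra_simps)
  moreover have "exp (c*\<xi>) = exp (c*t) * exp (c * (\<xi> - t))"
    by (simp add: exp_add[symmetric] algebra_simps)
  ultimately have "exp (c*t) * (u x - u t) = exp (c*t) * ((x - t) * exp (c * (\<xi> - t)) * (z x + integral {\<xi>..x} H))"
    using eq by (simp add: algebra_simps)
  then show ?thesis using that \<xi> by simp
qed

section \<open>Maximum principles and a priori estimates for the integrated equation\<close>

lemma pws_critical_max: "z t = 0" if "\<And>s. u s \<le> u t"
  using DERIV_local_max[OF pws_deriv, of 1 t] that by auto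

lemma pws_critical_min: "z t = 0" if "\<And>s. u t \<le> u s"
  using DERIV_local_min[OF pws_deriv, of 1 t] that by auto

text \<open>At a critical point only the integral of H remains in the increment formula, and
  periodicity brings every t into the period to the right of t1.\<close>

lemma pws_oscillation:
  assumes crit: "z t1 = 0" and absint: "\<And>x y. (\<lambda>t. \<bar>H t\<bar>) integrable_on {x..y}"
    and B: "\<And>x. integral {x..x+T} (\<lambda>t. \<bar>H t\<bar>) \<le> B"
  shows "\<bar>u t - u t1\<bar> \<le> T * exp (\<bar>c\<bar> * T) * B"
proof -
  obtain k where k: "t1 \<le> t + of_int k * T" "t + of_int k * T < t1 + T"
    using period_window[OF T] .
  define s where "s = t + of_int k * T"
  have us: "u s = u t" using periodic_mult[OF pws_periodic] by (simp add: s_def)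
  have B0: "0 \<le> B"
    using order_trans[OF Henstock_Kurzweil_Integration.integral_nonneg[OF absint] B, of 0] by simp
  show ?thesis
  proof (cases "s = t1")
    case True
    then show ?thesis using us B0 T by simp
  next
    case False
    then have "t1 < s" using k by (simp add: s_def)
    then obtain \<xi> where \<xi>: "t1 < \<xi>" "\<xi> < s"
      and eq: "u s - u t1 = (s - t1) * exp (c * (\<xi> - s)) * (z t1 - integral {t1..\<xi>} H)"
      by (rule pws_increment_right)
    have sT: "s \<le> t1 + T" using k by (simp add: s_def)
    have "\<bar>integral {t1..\<xi>} H\<bar> \<le> integral {t1..\<xi>} (\<lambda>t. \<bar>H t\<bar>)"
      using integral_norm_bound_integral[OF pws_integrable absint, of t1 \<xi>] by simp
    also have "\<dots> \<le> integral {t1..t1+T} (\<lambda>t. \<bar>H t\<bar>)"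
      using \<xi> sT by (intro integral_subset_le absint) auto
    also have "\<dots> \<le> B" by (rule B)
    finally have I: "\<bar>integral {t1..\<xi>} H\<bar> \<le> B" .
    have "\<bar>u t - u t1\<bar> = (s - t1) * exp (c * (\<xi> - s)) * \<bar>integral {t1..\<xi>} H\<bar>"
      using eq us crit \<open>t1 < s\<close> by (simp add: abs_mult)
    also have "\<dots> \<le> T * exp (\<bar>c\<bar> * T) * B"
      using \<xi> sT I B0 T by (intro mult_mono exp_abs_bounds(1)) auto
    finally show ?thesis .
  qed
qed

text \<open>Near a negative minimum the hypothesis bounds H below by a positive constant. As u'
  vanishes at the minimum, the increment formula makes u still smaller just to the right of
  it.\<close>

lemma pws_nonneg:
  assumes k: "k > 0" and neg: "\<And>t. u t < 0 \<Longrightarrow> H t \<ge> - k * u t"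
  shows "u t \<ge> 0"
proof (rule ccontr)
  assume "\<not> u t \<ge> 0"
  obtain t0 where t0: "\<And>s. u t0 \<le> u s"
    using periodic_attains_min[OF T pws_periodic pws_continuous] by blast
  define m where "m = - u t0"
  have m: "m > 0" using t0[of t] \<open>\<not> u t \<ge> 0\<close> by (simp add: m_def)
  have "isCont u t0" using pws_deriv DERIV_isCont by blast
  then obtain d where d: "d > 0" "\<And>s. \<bar>s - t0\<bar> < d \<Longrightarrow> \<bar>u s - u t0\<bar> < m / 2"
    using m unfolding isCont_def LIM_eq by (metis half_gt_zero real_norm_def diff_self abs_zero)
  define s where "s = t0 + d / 2"
  have "t0 < s" using d by (simp add: s_def)
  then obtain \<xi> where \<xi>: "t0 < \<xi>" "\<xi> < s"
    and eq: "u s - u t0 = (s - t0) * exp (c * (\<xi> - s)) * (z t0 - integral {t0..\<xi>} H)"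
    by (rule pws_increment_right)
  have Hge: "H r \<ge> k * (m / 2)" if "r \<in> {t0..\<xi>}" for r
  proof -
    have "\<bar>r - t0\<bar> < d" using that \<xi> d by (auto simp: s_def)
    then have "u r < - (m / 2)" using d(2)[of r] by (simp add: m_def abs_less_iff)
    then have "m / 2 \<le> - u r" by simp
    then have "u r < 0" "k * (m / 2) \<le> k * (- u r)" using m k mult_left_mono[of "m/2" "- u r" k] by auto
    then show ?thesis using neg[of r] by linarith
  qed
  have "integral {t0..\<xi>} (\<lambda>_. k * (m / 2)) \<le> integral {t0..\<xi>} H"
    using Hge by (intro integral_le pws_integrable) auto
  moreover have "integral {t0..\<xi>} (\<lambda>_. k * (m / 2)) > 0" using \<xi> k m by simp
  ultimately have "integral {t0..\<xi>} H > 0" by linarith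
  moreover have "z t0 = 0" using t0 by (rule pws_critical_min)
  ultimately have "u s - u t0 < 0"
    using eq \<open>t0 < s\<close> by (simp add: mult_pos_pos)
  then show False using t0[of s] by simp
qed

text \<open>Takes the place of uniqueness for the Cauchy problem: a zero of a nonnegative u is a
  critical point, and the bound of H by b u near zero leaves no room for growth on a short interval.
  So the zero set is open as well as closed.\<close>

lemma pws_zero_imp_trivial:
  assumes nonneg: "\<And>t. u t \<ge> 0" and \<eta>: "\<eta> > 0"
    and absint: "\<And>x y. (\<lambda>t. \<bar>H t\<bar>) integrable_on {x..y}"
    and b: "\<And>x y. b integrable_on {x..y}" "\<And>t. b t \<ge> 0"
    and small: "\<And>t. u t \<le> \<eta> \<Longrightarrow> \<bar>H t\<bar> \<le> b t * u t"
    and zero: "u t0 = 0"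
  shows "u t = 0"
proof -
  define Z where "Z = {t. u t = 0}"
  have "closed Z"
    unfolding Z_def using pws_continuous by (intro closed_Collect_eq) auto
  moreover have "open Z"
    unfolding open_dist
  proof
    fix s assume "s \<in> Z"
    then have us: "u s = 0" by (simp add: Z_def)
    then have zs: "z s = 0" using nonneg by (intro pws_critical_min) simp
    have "isCont u s" using pws_deriv DERIV_isCont by blast
    then obtain d0 where d0: "d0 > 0" "\<And>r. \<bar>r - s\<bar> < d0 \<Longrightarrow> \<bar>u r - u s\<bar> < \<eta>"
      using \<eta> unfolding isCont_def LIM_eq by (metis real_norm_def diff_self abs_zero)
    define Bb where "Bb = integral {s-1..s+1} b"
    have Bb: "Bb \<ge> 0" unfolding Bb_def using b by (intro Henstock_Kurzweil_Integration.integral_nonneg) auto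
    \<comment> \<open>On [s-d, s+d] the maximum m of u satisfies m \<le> d exp |c| Bb m, and this d
      makes the factor at most 1/2. Besides, d \<le> 1 keeps the interval inside the domain of
      \<open>Bb\<close>, d < d0 keeps u below \<eta>, and Bb + 1 avoids division by zero.\<close>
    define d where "d = min (min (d0/2) 1) (1 / (2 * exp \<bar>c\<bar> * (Bb + 1)))"
    have d: "d > 0" using d0 Bb by (simp add: d_def)
    have d1: "d \<le> 1" "d < d0" using d0 by (auto simp: d_def)
    have "d * (2 * exp \<bar>c\<bar> * (Bb + 1)) \<le> 1 / (2 * exp \<bar>c\<bar> * (Bb + 1)) * (2 * exp \<bar>c\<bar> * (Bb + 1))"
      using Bb by (intro mult_right_mono) (auto simp: d_def)
    then have "d * (2 * exp \<bar>c\<bar> * (Bb + 1)) \<le> 1" using Bb by simp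
    moreover have "d * (2 * exp \<bar>c\<bar> * (Bb + 1)) = 2 * (d * exp \<bar>c\<bar> * Bb) + 2 * (d * exp \<bar>c\<bar>)"
      by (simp add: algebra_simps)
    moreover have "0 \<le> d * exp \<bar>c\<bar>" using d by simp
    ultimately have dB: "d * exp \<bar>c\<bar> * Bb \<le> 1/2" by linarith
    have "{s-d..s+d} \<noteq> {}" using d by auto
    then obtain tm where tm: "tm \<in> {s-d..s+d}" "\<And>r. r \<in> {s-d..s+d} \<Longrightarrow> u r \<le> u tm"
      using continuous_attains_sup[of "{s-d..s+d}" u] pws_continuous by auto
    have Hb: "\<bar>integral {x..y} H\<bar> \<le> Bb * u tm" if "{x..y} \<subseteq> {s-d..s+d}" for x y
    proof -
      have "norm (integral {x..y} H) \<le> integral {x..y} (\<lambda>r. b r * u tm)"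
      proof (rule integral_norm_bound_integral[OF pws_integrable])
        fix r assume "r \<in> {x..y}"
        then have r: "r \<in> {s-d..s+d}" using that by blast
        then have "\<bar>u r - u s\<bar> < \<eta>" using d1 by (intro d0) auto
        then have "\<bar>H r\<bar> \<le> b r * u r" using us by (intro small) auto
        also have "\<dots> \<le> b r * u tm" using tm r b by (intro mult_left_mono) auto
        finally show "norm (H r) \<le> b r * u tm" by simp
      qed (use b in \<open>auto intro: integrable_on_mult_left\<close>)
      then have "\<bar>integral {x..y} H\<bar> \<le> integral {x..y} b * u tm" by simp
      also have "\<dots> \<le> Bb * u tm" unfolding Bb_def
        using that d1 b nonneg by (intro mult_right_mono integral_subset_le) auto
      finally show ?thesis .
    qed
    have "u tm \<le> d * exp \<bar>c\<bar> * (Bb * u tm)"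
    proof -
      consider "tm = s" | "s < tm" | "tm < s" by linarith
      then show ?thesis
      proof cases
        case 1 then show ?thesis using us by simp
      next
        case 2
        then obtain \<xi> where \<xi>: "s < \<xi>" "\<xi> < tm"
          and eq: "u tm - u s = (tm - s) * exp (c * (\<xi> - tm)) * (z s - integral {s..\<xi>} H)"
          by (rule pws_increment_right)
        have "u tm = (tm - s) * exp (c * (\<xi> - tm)) * (- integral {s..\<xi>} H)" using eq us zs by simp
        also have "\<dots> \<le> (tm - s) * exp (c * (\<xi> - tm)) * \<bar>integral {s..\<xi>} H\<bar>"
          using 2 by (intro mult_left_mono) auto
        also have "\<dots> \<le> d * exp (\<bar>c\<bar> * 1) * \<bar>integral {s..\<xi>} H\<bar>"
          using \<xi> tm d d1 2 by (intro mult_right_mono mult_mono exp_abs_bounds(1)) auto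
        also have "\<dots> \<le> d * exp (\<bar>c\<bar> * 1) * (Bb * u tm)"
          using \<xi> tm d by (intro mult_left_mono Hb) auto
        finally show ?thesis by simp
      next
        case 3
        then obtain \<xi> where \<xi>: "tm < \<xi>" "\<xi> < s"
          and eq: "u s - u tm = (s - tm) * exp (c * (\<xi> - tm)) * (z s + integral {\<xi>..s} H)"
          by (rule pws_increment_left)
        have "u tm = (s - tm) * exp (c * (\<xi> - tm)) * (- integral {\<xi>..s} H)" using eq us zs by simp
        also have "\<dots> \<le> (s - tm) * exp (c * (\<xi> - tm)) * \<bar>integral {\<xi>..s} H\<bar>"
          using 3 by (intro mult_left_mono) auto
        also have "\<dots> \<le> d * exp (\<bar>c\<bar> * 1) * \<bar>integral {\<xi>..s} H\<bar>"
          using \<xi> tm d d1 3 by (intro mult_right_mono mult_mono exp_abs_bounds(1)) auto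
        also have "\<dots> \<le> d * exp (\<bar>c\<bar> * 1) * (Bb * u tm)"
          using \<xi> tm d by (intro mult_left_mono Hb) auto
        finally show ?thesis by simp
      qed
    qed
    also have "\<dots> \<le> 1/2 * u tm" using mult_right_mono[OF dB, of "u tm"] nonneg by (simp add: mult.assoc)
    finally have "u tm \<le> 0" by simp
    then have "u r = 0" if "\<bar>r - s\<bar> < d" for r
      using tm(2)[of r] that nonneg[of r] by (auto simp: abs_less_iff)
    then show "\<exists>e>0. \<forall>y. dist y s < e \<longrightarrow> y \<in> Z"
      using d by (auto simp: Z_def dist_real_def)
  qed
  moreover have "t0 \<in> Z" using zero by (simp add: Z_def)
  ultimately have "Z = UNIV" using clopen by blast
  then show ?thesis by (auto simp: Z_def)
qed

text \<open>A Harnack inequality. As H \<ge> 0, a positive slope at t forces u to have gained at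
  least a multiple of d z(t) since \<sigma>, and a negative slope forces a corresponding loss until
  \<tau>; since u is nonnegative at both ends, |z| \<le> C u on the inner interval. Integrating this
  logarithmic bound compares u at any two inner points, and the integrated equation expresses the
  integral of H by boundary values of z and u.\<close>

lemma pws_harnack:
  assumes nonneg: "\<And>t. u t \<ge> 0"
    and ord: "\<sigma> < \<sigma>'" "\<sigma>' < \<tau>'" "\<tau>' < \<tau>"
    and H: "AE t in lebesgue. t \<in> {\<sigma>..\<tau>} \<longrightarrow> H t \<ge> 0"
    and ts: "ts \<in> {\<sigma>'..\<tau>'}"
    and d: "d > 0" "d \<le> \<sigma>' - \<sigma>" "d \<le> \<tau> - \<tau>'" and L: "\<tau> - \<sigma> \<le> L"
  defines "C \<equiv> exp (\<bar>c\<bar> * L) / d"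
  shows "t \<in> {\<sigma>'..\<tau>'} \<Longrightarrow> u t \<le> exp (C * L) * u ts"
    and "t \<in> {\<sigma>'..\<tau>'} \<Longrightarrow> exp (- (C * L)) * u ts \<le> u t"
    and "integral {\<sigma>'..\<tau>'} H \<le> 2 * (C + \<bar>c\<bar>) * exp (C * L) * u ts"
proof -
  have Hint: "0 \<le> integral {x..y} H" if "{x..y} \<subseteq> {\<sigma>..\<tau>}" for x y
    using H that by (intro henstock_integral_nonneg_AE pws_integrable) (auto elim: eventually_mono)
  have C: "C > 0" using d by (simp add: C_def)
  have zb: "\<bar>z t\<bar> \<le> C * u t" if t: "t \<in> {\<sigma>'..\<tau>'}" for t
  proof -
    have up: "z t \<le> C * u t" if z: "z t > 0"
    proof -
      have "\<sigma> < t" using t ord by auto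
      then obtain \<xi> where \<xi>: "\<sigma> < \<xi>" "\<xi> < t"
        and eq: "u t - u \<sigma> = (t - \<sigma>) * exp (c * (\<xi> - \<sigma>)) * (z t + integral {\<xi>..t} H)"
        by (rule pws_increment_left)
      have "d * exp (- \<bar>c\<bar> * L) * z t \<le> (t - \<sigma>) * exp (c * (\<xi> - \<sigma>)) * (z t + integral {\<xi>..t} H)"
        using d L t ord \<xi> z Hint[of \<xi> t] by (intro mult_mono exp_abs_bounds(2)) auto
      also have "\<dots> \<le> u t" using eq nonneg[of \<sigma>] by simp
      finally have "exp (\<bar>c\<bar> * L) / d * (d * exp (- \<bar>c\<bar> * L) * z t) \<le> exp (\<bar>c\<bar> * L) / d * u t"
        using d by (intro mult_left_mono) auto
      then show ?thesis using d by (simp add: C_def exp_minus field_simps)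
    qed
    have dn: "- z t \<le> C * u t" if z: "z t < 0"
    proof -
      have "t < \<tau>" using t ord by auto
      then obtain \<xi> where \<xi>: "t < \<xi>" "\<xi> < \<tau>"
        and eq: "u \<tau> - u t = (\<tau> - t) * exp (c * (\<xi> - \<tau>)) * (z t - integral {t..\<xi>} H)"
        by (rule pws_increment_right)
      have "d * exp (- \<bar>c\<bar> * L) * (- z t) \<le> (\<tau> - t) * exp (c * (\<xi> - \<tau>)) * (- z t + integral {t..\<xi>} H)"
        using d L t ord \<xi> z Hint[of t \<xi>] by (intro mult_mono exp_abs_bounds(2)) auto
      also have "\<dots> \<le> u t" using eq nonneg[of \<tau>] by (simp add: algebra_simps)
      finally have "exp (\<bar>c\<bar> * L) / d * (d * exp (- \<bar>c\<bar> * L) * (- z t)) \<le> exp (\<bar>c\<bar> * L) / d * u t"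
        using d by (intro mult_left_mono) auto
      then show ?thesis using d by (simp add: C_def exp_minus field_simps)
    qed
    have "0 \<le> C * u t" using C nonneg by simp
    then show ?thesis using up dn by (cases "z t" "0::real" rule: linorder_cases) auto
  qed
  have har: "u s \<le> exp (C * L) * u t" if s: "s \<in> {\<sigma>'..\<tau>'}" and t: "t \<in> {\<sigma>'..\<tau>'}" for s t
  proof -
    have CL: "C * \<bar>s - t\<bar> \<le> C * L" using s t ord L C by (intro mult_left_mono) auto
    have "u s \<le> exp (C * \<bar>s - t\<bar>) * u t"
    proof (cases "s \<le> t")
      case True
      have "exp (C * s) * u s \<le> exp (C*t) * u t"
      proof (rule DERIV_nonneg_imp_nondecreasing[OF True])
        fix x assume "s \<le> x" "x \<le> t"
        then have "\<bar>z x\<bar> \<le> C * u x" using s t by (intro zb) auto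
        then have "0 \<le> exp (C*x) * (C * u x + z x)" by simp
        then show "\<exists>y. ((\<lambda>a. exp (C * a) * u a) has_real_derivative y) (at x) \<and> 0 \<le> y"
          by (intro exI[of _ "exp (C*x) * (C * u x + z x)"] conjI)
            (auto intro!: derivative_eq_intros pws_deriv simp: algebra_simps)
      qed
      moreover have "exp (C * \<bar>s - t\<bar>) = exp (C*t) / exp (C * s)"
        using True by (simp add: right_diff_distrib exp_diff)
      ultimately show ?thesis by (simp add: pos_le_divide_eq mult.commute)
    next
      case False
      then have "t \<le> s" by simp
      have "exp (-(C * s)) * u s \<le> exp (-(C*t)) * u t"
      proof (rule DERIV_nonpos_imp_nonincreasing[OF \<open>t \<le> s\<close>])
        fix x assume "t \<le> x" "x \<le> s"
        then have "\<bar>z x\<bar> \<le> C * u x" using s t by (intro zb) auto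
        then have "exp (-(C*x)) * (z x - C * u x) \<le> 0" by (simp add: mult_le_0_iff)
        then show "\<exists>y. ((\<lambda>a. exp (-(C * a)) * u a) has_real_derivative y) (at x) \<and> y \<le> 0"
          by (intro exI[of _ "exp (-(C*x)) * (z x - C * u x)"] conjI)
            (auto intro!: derivative_eq_intros pws_deriv simp: algebra_simps)
      qed
      moreover have "exp (C * \<bar>s - t\<bar>) = exp (-(C*t)) / exp (-(C * s))"
        using False by (simp add: right_diff_distrib exp_diff exp_minus field_simps)
      ultimately show ?thesis by (simp add: pos_le_divide_eq mult.commute)
    qed
    also have "\<dots> \<le> exp (C * L) * u t" using CL nonneg by (intro mult_right_mono) auto
    finally show ?thesis .
  qed
  show "u t \<le> exp (C * L) * u ts" if "t \<in> {\<sigma>'..\<tau>'}" using har that ts by blast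
  show "exp (- (C * L)) * u ts \<le> u t" if "t \<in> {\<sigma>'..\<tau>'}"
  proof -
    have "exp (- (C * L)) * u ts \<le> exp (- (C * L)) * (exp (C * L) * u t)"
      using har[OF ts that] by (intro mult_left_mono) auto
    then show ?thesis by (simp add: exp_minus field_simps)
  qed
  have "integral {\<sigma>'..\<tau>'} H = z \<sigma>' + c * u \<sigma>' - (z \<tau>' + c * u \<tau>')"
    using ord by (intro pws_integral) auto
  also have "\<dots> \<le> (C + \<bar>c\<bar>) * u \<sigma>' + (C + \<bar>c\<bar>) * u \<tau>'"
  proof -
    have "\<bar>c * u x\<bar> = \<bar>c\<bar> * u x" for x using nonneg by (simp add: abs_mult)
    then have "c * u \<sigma>' \<le> \<bar>c\<bar> * u \<sigma>'" "- (c * u \<tau>') \<le> \<bar>c\<bar> * u \<tau>'"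
      by (metis abs_ge_self, metis abs_ge_minus_self)
    then show ?thesis using zb[of \<sigma>'] zb[of \<tau>'] ord by (auto simp: algebra_simps abs_le_iff)
  qed
  also have "\<dots> \<le> (C + \<bar>c\<bar>) * (exp (C * L) * u ts) + (C + \<bar>c\<bar>) * (exp (C * L) * u ts)"
    using har ts ord C by (intro add_mono mult_left_mono) auto
  finally show "integral {\<sigma>'..\<tau>'} H \<le> 2 * (C + \<bar>c\<bar>) * exp (C * L) * u ts" by (simp add: algebra_simps)
qed

end

section \<open>The linear periodic problem\<close>

lemma pws_diff:
  assumes "periodic_weak_solution T c H1 u1 z1" "periodic_weak_solution T c H2 u2 z2"
  shows "periodic_weak_solution T c (\<lambda>t. H1 t - H2 t) (\<lambda>t. u1 t - u2 t) (\<lambda>t. z1 t - z2 t)"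
  unfolding periodic_weak_solution_def
proof (intro conjI allI impI)
  show "periodic T (\<lambda>t. u1 t - u2 t)"
    using assms by (simp add: periodic_weak_solution_def periodic_def)
  show "((\<lambda>t. u1 t - u2 t) has_real_derivative z1 t - z2 t) (at t)" for t
    using assms by (auto simp: periodic_weak_solution_def intro!: derivative_intros)
  fix x y :: real assume "x \<le> y"
  then have "((\<lambda>t. H1 t - H2 t) has_integral
      (z1 x + c * u1 x - (z1 y + c * u1 y)) - (z2 x + c * u2 x - (z2 y + c * u2 y))) {x..y}"
    using assms by (intro has_integral_diff) (auto simp: periodic_weak_solution_def)
  then show "((\<lambda>t. H1 t - H2 t) has_integral
      (z1 x - z2 x + c * (u1 x - u2 x) - (z1 y - z2 y + c * (u1 y - u2 y)))) {x..y}"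
    by (simp add: algebra_simps)
qed

lemma pws_scale:
  assumes "periodic_weak_solution T c H u z"
  shows "periodic_weak_solution T c (\<lambda>t. k * H t) (\<lambda>t. k * u t) (\<lambda>t. k * z t)"
  unfolding periodic_weak_solution_def
proof (intro conjI allI impI)
  show "periodic T (\<lambda>t. k * u t)"
    using assms by (simp add: periodic_weak_solution_def periodic_def)
  show "((\<lambda>t. k * u t) has_real_derivative k * z t) (at t)" for t
    using assms by (auto simp: periodic_weak_solution_def intro!: derivative_eq_intros)
  fix x y :: real assume "x \<le> y"
  then have "((\<lambda>t. k * H t) has_integral k * (z x + c * u x - (z y + c * u y))) {x..y}"
    using assms by (intro has_integral_mult_right) (auto simp: periodic_weak_solution_def)
  then show "((\<lambda>t. k * H t) has_integral (k * z x + c * (k * u x) - (k * z y + c * (k * u y)))) {x..y}"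
    by (simp add: algebra_simps)
qed

section \<open>Periodic solutions of first order equations\<close>

lemma continuous_antiderivative:
  fixes f :: "real \<Rightarrow> real"
  assumes "continuous_on UNIV f"
  obtains G where "\<And>t. (G has_real_derivative f t) (at t)"
proof -
  have "isCont f x" for x using assms by (simp add: continuous_on_eq_continuous_at)
  then show ?thesis
    using einterval_antiderivative[of "-\<infinity>" \<infinity> f] that
    by (auto simp: has_real_derivative_iff_has_vector_derivative)
qed

lemma has_integral_real_derivative:
  assumes "a \<le> b" "\<And>t. (f has_real_derivative f' t) (at t)"
  shows "(f' has_integral (f b - f a)) {a..b}"
  using assms by (intro fundamental_theorem_of_calculus)
    (auto simp: has_real_derivative_iff_has_vector_derivative has_vector_derivative_at_within)

lemma first_order_periodic_exists:
  fixes F :: "real \<Rightarrow> real"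
  assumes r: "r \<noteq> 0" and T: "T > 0" and per: "periodic T F" and cont: "continuous_on UNIV F"
  obtains y where "periodic T y" "\<And>t. (y has_real_derivative F t - r * y t) (at t)"
proof -
  have "continuous_on UNIV (\<lambda>t. exp (r * t) * F t)" by (intro continuous_intros cont)
  then obtain G where G: "\<And>t. (G has_real_derivative exp (r * t) * F t) (at t)"
    using continuous_antiderivative[of "\<lambda>t. exp (r * t) * F t"] by blast
  have "((\<lambda>t. G (t + T) - exp (r * T) * G t) has_real_derivative 0) (at t)" for t
  proof -
    have "((\<lambda>t. G (t + T)) has_real_derivative exp (r * (t + T)) * F (t + T)) (at t)"
      using G[of "t + T"] by (simp add: DERIV_shift)
    then have "((\<lambda>t. G (t + T) - exp (r * T) * G t) has_real_derivative
        exp (r * (t + T)) * F (t + T) - exp (r * T) * (exp (r * t) * F t)) (at t)"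
      by (intro derivative_intros DERIV_cmult G)
    moreover have "F (t + T) = F t" using per by (simp add: periodic_def)
    moreover have "exp (r * (t + T)) = exp (r * T) * exp (r * t)"
      by (simp add: distrib_left exp_add mult.commute)
    ultimately show ?thesis by (simp add: mult.assoc)
  qed
  then obtain K where K: "\<And>t. G (t + T) - exp (r * T) * G t = K"
    using DERIV_isconst_all[of "\<lambda>t. G (t + T) - exp (r * T) * G t"] by blast
  have ne: "exp (r * T) \<noteq> 1" using r T by simp
  \<comment> \<open>Variation of constants: over one period G + A has to be multiplied by exp (r T),
    which determines A; this is where r \<noteq> 0 enters.\<close>
  define A where "A = K / (exp (r * T) - 1)"
  have A: "K + A = exp (r * T) * A" using ne by (simp add: A_def field_simps)
  define y where "y = (\<lambda>t. exp (- (r * t)) * (G t + A))"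
  show ?thesis
  proof
    show "periodic T y"
      unfolding periodic_def
    proof
      fix t
      have "G (t + T) + A = exp (r * T) * (G t + A)"
        using K[of t] A by (simp add: algebra_simps)
      moreover have "exp (- (r * (t + T))) = exp (- (r * t)) / exp (r * T)"
        by (simp add: distrib_left exp_diff[symmetric])
      ultimately show "y (t + T) = y t" by (simp add: y_def)
    qed
    show "(y has_real_derivative F t - r * y t) (at t)" for t
    proof -
      have "(y has_real_derivative exp (- (r * t)) * (exp (r * t) * F t) + exp (- (r * t)) * (- r) * (G t + A)) (at t)"
        unfolding y_def by (auto intro!: derivative_eq_intros G)
      moreover have 1: "exp (- (r * t)) * (exp (r * t) * F t) = F t"
        by (simp add: mult.assoc[symmetric] exp_add[symmetric])
      moreover have 2: "exp (- (r * t)) * (- r) * (G t + A) = - (r * y t)"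
        by (simp add: y_def)
      ultimately show ?thesis unfolding 1 2 by simp
    qed
  qed
qed

text \<open>At a maximum of y^2 the derivative 2 y (F - r y) vanishes, so that y = 0 or r y = F
  there; squaring treats both signs of r and of y at once.\<close>

lemma first_order_periodic_bound:
  fixes F :: "real \<Rightarrow> real"
  assumes r: "r \<noteq> 0" and T: "T > 0" and per: "periodic T y"
    and der: "\<And>t. (y has_real_derivative F t - r * y t) (at t)" and B: "\<And>t. \<bar>F t\<bar> \<le> B"
  shows "\<bar>y t\<bar> \<le> B / \<bar>r\<bar>"
proof -
  have cont: "continuous_on UNIV y"
    by (rule DERIV_continuous_on, rule has_field_derivative_at_within, rule der)
  have "periodic T (\<lambda>t. (y t)\<^sup>2)" using per by (simp add: periodic_def)
  moreover have "continuous_on UNIV (\<lambda>t. (y t)\<^sup>2)" by (intro continuous_intros cont)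
  ultimately obtain s where s: "\<And>t. (y t)\<^sup>2 \<le> (y s)\<^sup>2"
    using periodic_attains_max[OF T] by blast
  have D: "((\<lambda>t. (y t)\<^sup>2) has_real_derivative 2 * y s * (F s - r * y s)) (at s)"
    using DERIV_power[OF der[of s], of 2] by (simp add: algebra_simps)
  have "2 * y s * (F s - r * y s) = 0"
    using DERIV_local_max[OF D, of 1] s by auto
  then have "y s = 0 \<or> r * y s = F s" by auto
  then have "\<bar>r * y s\<bar> \<le> B"
  proof
    assume "y s = 0"
    then show ?thesis using B[of s] by simp
  next
    assume "r * y s = F s"
    then show ?thesis using B[of s] by simp
  qed
  then have "\<bar>y s\<bar> \<le> B / \<bar>r\<bar>" using r by (simp add: abs_mult pos_le_divide_eq mult.commute)
  moreover have "\<bar>y t\<bar> \<le> \<bar>y s\<bar>" using s[of t] abs_le_square_iff by blast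
  ultimately show ?thesis by linarith
qed

text \<open>P is a primitive of h minus its mean. Being continuous, it can be the source of first
  order equations with classical derivatives, although h is only integrable.\<close>

lemma periodic_primitive:
  fixes h :: "real \<Rightarrow> real"
  assumes T: "T > 0" and per: "periodic T h" and int: "\<And>x y. h integrable_on {x..y}"
  shows "\<exists>P. periodic T P \<and> continuous_on UNIV P \<and> P 0 = 0 \<and>
    (\<forall>x y. x \<le> y \<longrightarrow> integral {x..y} h = P y - P x + (y - x) * (integral {0..T} h / T))"
proof -
  define hb where "hb = integral {0..T} h / T"
  define Q where "Q = (\<lambda>t. if 0 \<le> t then integral {0..t} h else - integral {t..0} h)"
  have Q: "integral {x..y} h = Q y - Q x" if "x \<le> y" for x y
    using Henstock_Kurzweil_Integration.integral_combine[of 0 x y h]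
      Henstock_Kurzweil_Integration.integral_combine[of x 0 y h]
      Henstock_Kurzweil_Integration.integral_combine[of x y 0 h] that int
    by (auto simp: Q_def)
  have "isCont Q t" for t
  proof -
    have 1: "continuous_on {t-1..t+1} (\<lambda>s. Q (t-1) + integral {t-1..s} h)"
      by (intro continuous_intros indefinite_integral_continuous_1 int)
    have "continuous_on {t-1..t+1} Q"
      by (rule continuous_on_eq[OF 1]) (use Q[of "t-1"] in auto)
    then show ?thesis by (rule continuous_on_interior) simp
  qed
  then have Qc: "continuous_on UNIV Q" by (simp add: continuous_at_imp_continuous_on)
  show ?thesis
  proof (intro exI[of _ "\<lambda>t. Q t - t * hb"] conjI allI impI)
    show "continuous_on UNIV (\<lambda>t. Q t - t * hb)" by (intro continuous_intros Qc)
    show "periodic T (\<lambda>t. Q t - t * hb)"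
      unfolding periodic_def
    proof
      fix t
      have "Q (t + T) - Q t = T * hb"
        using Q[of t "t+T"] integral_periodic_window[OF T per int, of t] T by (simp add: hb_def)
      then show "Q (t + T) - (t + T) * hb = Q t - t * hb" by (simp add: algebra_simps)
    qed
    show "integral {x..y} h = Q y - y * hb - (Q x - x * hb) + (y - x) * (integral {0..T} h / T)" if "x \<le> y" for x y
      using Q[OF that] by (simp add: hb_def[symmetric] algebra_simps)
  qed (simp add: Q_def)
qed

text \<open>The operator \<open>- u'' - c u' + p q u\<close> with \<open>c = q - p\<close> factors as
  \<open>- (D - p) (D + q)\<close>, so that two first order periodic problems have to be solved.\<close>

lemma pws_linear_exists:
  fixes h :: "real \<Rightarrow> real"
  assumes T: "T > 0" and p: "p > 0" and q: "q > 0"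
    and per: "periodic T h" and int: "\<And>x y. h integrable_on {x..y}"
  obtains u z where "periodic_weak_solution T (q - p) (\<lambda>t. h t - p * q * u t) u z"
proof -
  obtain P where P: "periodic T P" "continuous_on UNIV P" "P 0 = 0"
    "\<And>x y. x \<le> y \<Longrightarrow> integral {x..y} h = P y - P x + (y - x) * (integral {0..T} h / T)"
    using periodic_primitive[OF T per int] by metis
  define hb where "hb = integral {0..T} h / T"
  have perF: "periodic T (\<lambda>t. - p * P t)" using P(1) by (simp add: periodic_def)
  have contF: "continuous_on UNIV (\<lambda>t. - p * P t)" by (intro continuous_intros P)
  obtain y where y: "periodic T y" "\<And>t. (y has_real_derivative - p * P t - (-p) * y t) (at t)"
    using first_order_periodic_exists[OF _ T perF contF, of "-p"] p by auto
  have yc: "continuous_on UNIV y"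
    by (rule DERIV_continuous_on, rule has_field_derivative_at_within, rule y(2))
  \<comment> \<open>For v = u' + q u the equation reads v' - p v = - h. Setting y = v + P - hb/p
    absorbs the merely integrable h and leaves y' = p (y - P); here this substitution is read
    backwards.\<close>
  define v where "v = (\<lambda>t. y t - P t + hb / p)"
  have vper: "periodic T v" using y(1) P(1) by (simp add: v_def periodic_def)
  have vc: "continuous_on A v" for A
    unfolding v_def by (intro continuous_intros continuous_on_subset[OF yc] continuous_on_subset[OF P(2)]) auto
  obtain u where u: "periodic T u" "\<And>t. (u has_real_derivative v t - q * u t) (at t)"
    using first_order_periodic_exists[OF _ T vper vc, of q] q by auto
  define z where "z = (\<lambda>t. v t - q * u t)"
  show ?thesis
  proof
    show "periodic_weak_solution T (q - p) (\<lambda>t. h t - p * q * u t) u z"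
      unfolding periodic_weak_solution_def
    proof (intro conjI allI impI)
      show "periodic T u" by (fact u)
      show "(u has_real_derivative z t) (at t)" for t using u(2) by (simp add: z_def)
      fix x x' :: real assume xy: "x \<le> x'"
      have zder: "(u has_real_derivative z t) (at t)" for t using u(2)[of t] by (simp add: z_def)
      have yder: "(y has_real_derivative p * y t - p * P t) (at t)" for t using y(2)[of t] by simp
      have "((\<lambda>t. p * z t - (p * y t - p * P t)) has_integral p * (u x' - u x) - (y x' - y x)) {x..x'}"
        by (rule has_integral_diff[OF has_integral_mult_right[OF has_integral_real_derivative[OF xy zder]]
              has_integral_real_derivative[OF xy yder]])
      moreover have "p * z t - (p * y t - p * P t) = hb - p * q * u t" for t
        using p by (simp add: z_def v_def right_diff_distrib distrib_left)
      ultimately have 1: "((\<lambda>t. hb - p * q * u t) has_integral p * (u x' - u x) - (y x' - y x)) {x..x'}"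
        by simp
      have "(h has_integral P x' - P x + (x' - x) * hb) {x..x'}"
        using integrable_integral[OF int, of x x'] P(4)[OF xy] by (simp add: hb_def)
      moreover have "((\<lambda>t. hb) has_integral (x' - x) * hb) {x..x'}"
        using has_integral_const_real[of hb x x'] xy by simp
      ultimately have "((\<lambda>t. h t - hb + (hb - p * q * u t)) has_integral
          (P x' - P x + (x' - x) * hb - (x' - x) * hb) + (p * (u x' - u x) - (y x' - y x))) {x..x'}"
        by (rule has_integral_add[OF has_integral_diff 1])
      then show "((\<lambda>t. h t - p * q * u t) has_integral z x + (q - p) * u x - (z x' + (q - p) * u x')) {x..x'}"
        by (simp add: z_def v_def algebra_simps)
    qed
  qed
qed

text \<open>The same substitution, applied to an arbitrary solution: |P| and |y| are at most 2 B and
  |hb/p| is at most B/(T p), whence the constant 4 + 1/(T p) for u' + q u; the second first order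
  problem then costs the factor 1/q. A bound by the L^1 norm of h serves both for continuity and for
  compactness of the solution operator.\<close>

lemma pws_linear_bound:
  fixes h :: "real \<Rightarrow> real"
  assumes T: "T > 0" and p: "p > 0" and q: "q > 0"
    and per: "periodic T h" and absint: "\<And>x y. h absolutely_integrable_on {x..y}"
    and sol: "periodic_weak_solution T (q - p) (\<lambda>t. h t - p * q * u t) u z"
    and B: "integral {0..T} (\<lambda>t. \<bar>h t\<bar>) \<le> B"
  shows "\<bar>u t\<bar> \<le> (4 + 1 / (T * p)) / q * B" "\<bar>z t\<bar> \<le> 2 * (4 + 1 / (T * p)) * B"
proof -
  note pws = pws_periodic[OF T sol] pws_deriv[OF T sol] pws_deriv_periodic[OF T sol]
    pws_deriv_continuous[OF T sol]
  have int: "h integrable_on {x..y}" for x y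
    using absint by (rule set_lebesgue_integral_eq_integral)
  have aint: "(\<lambda>t. \<bar>h t\<bar>) integrable_on {x..y}" for x y
    using absint[of x y] unfolding absolutely_integrable_on_def by simp
  obtain P where P: "periodic T P" "continuous_on UNIV P" "P 0 = 0"
    "\<And>x y. x \<le> y \<Longrightarrow> integral {x..y} h = P y - P x + (y - x) * (integral {0..T} h / T)"
    using periodic_primitive[OF T per int] by metis
  define hb where "hb = integral {0..T} h / T"
  have ib: "\<bar>integral {0..t} h\<bar> \<le> B" if "0 \<le> t" "t \<le> T" for t
  proof -
    have "\<bar>integral {0..t} h\<bar> \<le> integral {0..t} (\<lambda>t. \<bar>h t\<bar>)"
      using integral_norm_bound_integral[OF int aint, of 0 t] by simp
    also have "\<dots> \<le> integral {0..T} (\<lambda>t. \<bar>h t\<bar>)"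
      using that by (intro integral_subset_le aint) auto
    finally show ?thesis using B by simp
  qed
  have hbB: "\<bar>hb\<bar> * T \<le> B" using ib[of T] T by (simp add: hb_def)
  have PB: "\<bar>P t\<bar> \<le> 2 * B" for t
  proof -
    obtain k where k: "0 \<le> t + of_int k * T" "t + of_int k * T < 0 + T"
      using period_window[OF T] .
    define s where "s = t + of_int k * T"
    have s: "0 \<le> s" "s \<le> T" using k by (auto simp: s_def)
    have "P s = integral {0..s} h - s * hb" using P(4)[OF s(1)] P(3) by (simp add: hb_def)
    moreover have "\<bar>s * hb\<bar> \<le> T * \<bar>hb\<bar>" using s by (simp add: abs_mult mult_right_mono)
    ultimately have "\<bar>P s\<bar> \<le> 2 * B" using ib[OF s] hbB by (simp add: mult.commute)
    then show ?thesis using periodic_mult[OF P(1)] by (simp add: s_def)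
  qed
  define v where "v = (\<lambda>t. z t + q * u t)"
  have vper: "periodic T v" using pws by (simp add: v_def periodic_def)
  have uc: "continuous_on A u" for A by (rule pws_continuous[OF T sol])
  have vc: "continuous_on A v" for A
    unfolding v_def by (intro continuous_intros uc continuous_on_subset[OF pws(4)]) auto
  define y where "y = (\<lambda>t. v t + P t - hb / p)"
  have yper: "periodic T y" using vper P(1) by (simp add: y_def periodic_def)
  have yc: "continuous_on A y" for A
    unfolding y_def by (intro continuous_intros vc continuous_on_subset[OF P(2)]) auto
  have yint: "((\<lambda>t. p * (y t - P t)) has_integral (y b - y a)) {a..b}" if ab: "a \<le> b" for a b
  proof -
    have i1: "(z has_integral (u b - u a)) {a..b}"
      by (rule has_integral_real_derivative[OF ab pws(2)])
    have i2: "((\<lambda>t. h t - p * q * u t) has_integral (z a + (q-p) * u a - (z b + (q-p) * u b))) {a..b}"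
      using pws_has_integral[OF T sol ab] .
    have i3: "(h has_integral (P b - P a + (b - a) * hb)) {a..b}"
      using integrable_integral[OF int, of a b] P(4)[OF ab] by (simp add: hb_def)
    have i4: "((\<lambda>t. hb) has_integral (b - a) * hb) {a..b}"
      using has_integral_const_real[of hb a b] ab by simp
    have "((\<lambda>t. p * z t + (h t - (h t - p * q * u t)) - hb) has_integral
      (p * (u b - u a) + ((P b - P a + (b - a) * hb) - (z a + (q-p) * u a - (z b + (q-p) * u b))) - (b - a) * hb)) {a..b}"
      by (rule has_integral_diff[OF has_integral_add[OF has_integral_mult_right[OF i1] has_integral_diff[OF i3 i2]] i4])
    moreover have "p * z t + (h t - (h t - p * q * u t)) - hb = p * (y t - P t)" for t
      using p by (simp add: y_def v_def field_simps)
    ultimately show ?thesis by (simp add: y_def v_def algebra_simps)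
  qed
  \<comment> \<open>So far y is known only through an integral identity; since its integrand is
    continuous, y has a classical derivative and the first order bound becomes applicable.\<close>
  have yder: "(y has_real_derivative (- p * P t) - (- p) * y t) (at t)" for t
  proof -
    have c: "continuous_on {t-1..t+1} (\<lambda>t. p * (y t - P t))"
      by (intro continuous_intros yc continuous_on_subset[OF P(2)]) auto
    have "((\<lambda>s. integral {t-1..s} (\<lambda>t. p * (y t - P t))) has_real_derivative p * (y t - P t)) (at t within {t-1..t+1})"
      using integral_has_real_derivative[OF c, of t] by simp
    then have "((\<lambda>s. y (t-1) + integral {t-1..s} (\<lambda>t. p * (y t - P t))) has_real_derivative 0 + p * (y t - P t)) (at t within {t-1..t+1})"
      by (intro derivative_intros)
    then have "(y has_real_derivative 0 + p * (y t - P t)) (at t within {t-1..t+1})"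
      by (rule has_field_derivative_transform_within[where d = 1])
        (use integral_unique[OF yint[of "t-1"]] in auto)
    moreover have "at t within {t-1..t+1} = at t" by (rule at_within_interior) simp
    moreover have "0 + p * (y t - P t) = (- p * P t) - (- p) * y t" by (simp add: right_diff_distrib)
    ultimately show ?thesis by metis
  qed
  have "\<bar>y t\<bar> \<le> p * (2 * B) / \<bar>- p\<bar>" for t
    using p PB by (intro first_order_periodic_bound[OF _ T yper yder]) (auto simp: abs_mult)
  then have yB: "\<bar>y t\<bar> \<le> 2 * B" for t using p by simp
  have hp: "\<bar>hb / p\<bar> \<le> B / (T * p)"
    using hbB p T by (simp add: field_simps)
  have vB: "\<bar>v t\<bar> \<le> (4 + 1 / (T * p)) * B" for t
  proof -
    have "v t = y t - P t + hb / p" by (simp add: y_def)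
    then have "\<bar>v t\<bar> \<le> 2 * B + 2 * B + B / (T * p)"
      using yB[of t] PB[of t] hp by linarith
    then show ?thesis by (simp add: algebra_simps)
  qed
  have uder: "(u has_real_derivative v t - q * u t) (at t)" for t
    using pws(2) by (simp add: v_def)
  have "\<bar>u t\<bar> \<le> (4 + 1 / (T * p)) * B / \<bar>q\<bar>" for t
    using q vB by (intro first_order_periodic_bound[OF _ T pws(1) uder]) auto
  then have uB: "\<bar>u t\<bar> \<le> (4 + 1 / (T * p)) * B / q" for t using q by simp
  then show "\<bar>u t\<bar> \<le> (4 + 1 / (T * p)) / q * B" by simp
  have "\<bar>q * u t\<bar> \<le> (4 + 1 / (T * p)) * B"
    using uB[of t] q by (simp add: abs_mult pos_le_divide_eq mult.commute)
  moreover have "z t = v t - q * u t" by (simp add: v_def)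
  ultimately show "\<bar>z t\<bar> \<le> 2 * (4 + 1 / (T * p)) * B" using vB[of t] by linarith
qed

section \<open>A continuation theorem for the periodic problem\<close>

lemma periodic_bcontfunE:
  fixes u :: "real \<Rightarrow> real"
  assumes "T > 0" "periodic T u" "continuous_on UNIV u"
  obtains w :: "real \<Rightarrow>\<^sub>C real" where "apply_bcontfun w = u"
proof -
  obtain s where "\<And>t. u t \<le> u s" using periodic_attains_max[OF assms] by blast
  moreover obtain r where "\<And>t. u r \<le> u t" using periodic_attains_min[OF assms] by blast
  ultimately have "range u \<subseteq> {u r..u s}" by auto
  then have "bounded (range u)" using bounded_closed_interval bounded_subset by blast
  then have "u \<in> bcontfun" using assms(3) by (simp add: bcontfun_def)
  then show ?thesis using bcontfunE that by metis
qed

lemma abs_apply_bcontfun_le: "\<bar>apply_bcontfun (y :: real \<Rightarrow>\<^sub>C real) t\<bar> \<le> norm y"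
  using norm_bounded[of y t] by simp

lemma norm_bcontfun_le:
  fixes y :: "real \<Rightarrow>\<^sub>C real"
  assumes "\<And>t. \<bar>apply_bcontfun y t\<bar> \<le> b"
  shows "norm y \<le> b"
  using norm_bound[of y b] assms by simp

text \<open>Arzela-Ascoli on one period; periodicity extends the uniform convergence to the whole
  line. The limit supplied there is a plain function on the period, so the limit in the function
  space is obtained from completeness.\<close>

lemma compact_periodic_lipschitz:
  fixes K T :: real
  assumes T: "T > 0"
  shows "compact {w :: real \<Rightarrow>\<^sub>C real. periodic T w \<and> (\<forall>t. \<bar>w t\<bar> \<le> K) \<and> (\<forall>s t. \<bar>w s - w t\<bar> \<le> K * \<bar>s - t\<bar>)}"
    (is "compact ?S")
  unfolding compact_eq_seq_compact_metric
proof (rule seq_compactI)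
  fix f :: "nat \<Rightarrow> (real \<Rightarrow>\<^sub>C real)" assume f: "\<forall>n. f n \<in> ?S"
  then have fp: "periodic T (f n)" and fb: "\<bar>f n t\<bar> \<le> K" and fl: "\<bar>f n s - f n t\<bar> \<le> K * \<bar>s - t\<bar>" for n s t
    by auto
  have K: "K \<ge> 0" using fb[of 0 0] by linarith
  obtain g k where k: "strict_mono (k :: nat \<Rightarrow> nat)"
    and unif: "\<And>e. 0 < e \<Longrightarrow> \<exists>N. \<forall>n x. n \<ge> N \<and> x \<in> {0..T} \<longrightarrow> norm (f (k n) x - g x) < e"
  proof (rule Arzela_Ascoli[of "{0..T}" "\<lambda>n. apply_bcontfun (f n)" K])
    fix x e :: real assume "0 < e"
    show "\<exists>d>0. \<forall>n y. y \<in> {0..T} \<and> norm (x - y) < d \<longrightarrow> norm (f n x - f n y) < e"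
    proof (intro exI[of _ "e / (K + 1)"] conjI allI impI)
      show "0 < e / (K + 1)" using \<open>0 < e\<close> K by simp
      fix n y assume "y \<in> {0..T} \<and> norm (x - y) < e / (K + 1)"
      then have "\<bar>x - y\<bar> * (K + 1) < e" using K by (simp add: pos_less_divide_eq)
      moreover have "\<bar>f n x - f n y\<bar> \<le> K * \<bar>x - y\<bar>" by (rule fl)
      moreover have "K * \<bar>x - y\<bar> \<le> \<bar>x - y\<bar> * (K + 1)" by (simp add: algebra_simps)
      ultimately show "norm (f n x - f n y) < e" by simp
    qed
  qed (use fb in auto)
  have "Cauchy (\<lambda>n. f (k n))"
    unfolding Cauchy_def
  proof (intro allI impI)
    fix e :: real assume "0 < e"
    then obtain N where N: "\<And>n x. n \<ge> N \<Longrightarrow> x \<in> {0..T} \<Longrightarrow> norm (f (k n) x - g x) < e / 3"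
      using unif[of "e/3"] by auto
    have "dist (f (k m)) (f (k n)) < e" if "m \<ge> N" "n \<ge> N" for m n
    proof -
      have "dist (f (k m) x) (f (k n) x) \<le> 2 * e / 3" for x
      proof -
        obtain j where j: "0 \<le> x + of_int j * T" "x + of_int j * T < 0 + T"
          using period_window[OF T] .
        then have xT: "x + of_int j * T \<in> {0..T}" by simp
        have "\<bar>f (k m) x - g (x + of_int j * T)\<bar> < e / 3" "\<bar>f (k n) x - g (x + of_int j * T)\<bar> < e / 3"
          using N[OF that(1) xT] N[OF that(2) xT] by (simp_all only: periodic_mult[OF fp] real_norm_def)
        then show ?thesis unfolding dist_real_def by linarith
      qed
      then have "dist (f (k m)) (f (k n)) \<le> 2 * e / 3" by (rule dist_bound)
      then show ?thesis using \<open>0 < e\<close> by simp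
    qed
    then show "\<exists>M. \<forall>m\<ge>M. \<forall>n\<ge>M. dist (f (k m)) (f (k n)) < e" by blast
  qed
  then obtain l where l: "(\<lambda>n. f (k n)) \<longlonglongrightarrow> l"
    using Cauchy_convergent convergent_def by blast
  have pt: "(\<lambda>n. f (k n) x) \<longlonglongrightarrow> l x" for x
    using tendsto_uniform_limitI[OF tendsto_bcontfun_uniform_limit[OF l]] by simp
  have "l \<in> ?S"
  proof (intro CollectI conjI allI)
    show "periodic T l"
      unfolding periodic_def
    proof
      fix t
      have "(\<lambda>n. f (k n) t) \<longlonglongrightarrow> l (t + T)"
        using pt[of "t + T"] fp by (simp add: periodic_def)
      then show "l (t + T) = l t" using pt[of t] LIMSEQ_unique by blast
    qed
    show "\<bar>l t\<bar> \<le> K" for t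
      by (rule LIMSEQ_le_const2[OF tendsto_rabs[OF pt]]) (use fb in auto)
    show "\<bar>l s - l t\<bar> \<le> K * \<bar>s - t\<bar>" for s t
      by (rule LIMSEQ_le_const2[OF tendsto_rabs[OF tendsto_diff[OF pt pt]]]) (use fl in auto)
  qed
  then show "\<exists>l\<in>?S. \<exists>r. strict_mono r \<and> (f \<circ> r) \<longlonglongrightarrow> l"
    using l k by (auto simp: o_def)
qed

text \<open>Elements of the type of bounded continuous functions need not be periodic. If they enter an
  equation only through their values on one period, then its source term is periodic, and
  fixed points of the solution operator are periodic a posteriori.\<close>

definition period_rep :: "real \<Rightarrow> real \<Rightarrow> real" where
  "period_rep T t = t - T * of_int \<lfloor>t / T\<rfloor>"

lemma periodic_period_rep: "T > 0 \<Longrightarrow> periodic T (\<lambda>t. f (period_rep T t))"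
  by (auto simp: periodic_def period_rep_def add_divide_distrib algebra_simps)

lemma period_rep_periodic: "periodic T f \<Longrightarrow> f (period_rep T t) = f t"
  using periodic_mult[of T f t "- \<lfloor>t / T\<rfloor>"] by (simp add: period_rep_def mult.commute)

lemma measurable_period_rep [measurable]: "period_rep T \<in> borel_measurable borel"
  unfolding period_rep_def by measurable

text \<open>The map \<open>period_rep T\<close> jumps at the multiples of T, so the first factor may
  be discontinuous when y is not periodic; it is still bounded and Borel measurable, which
  suffices.\<close>

lemma absolutely_integrable_period_rep:
  fixes y :: "real \<Rightarrow>\<^sub>C real"
  assumes \<psi>: "continuous_on UNIV \<psi>" and f: "f absolutely_integrable_on {u..v}"
  shows "(\<lambda>t. \<psi> (y (period_rep T t)) * f t :: real) absolutely_integrable_on {u..v}"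
proof (rule absolutely_integrable_bounded_measurable_product_real[OF _ _ _ f])
  have "continuous_on UNIV (\<lambda>s. \<psi> (y s))"
    by (rule continuous_on_compose2[OF \<psi>]) auto
  then have "(\<lambda>s. \<psi> (y s)) \<in> borel_measurable borel" by (rule borel_measurable_continuous_onI)
  then have "(\<lambda>t. \<psi> (y (period_rep T t))) \<in> borel_measurable borel" by measurable
  then show "(\<lambda>t. \<psi> (y (period_rep T t))) \<in> borel_measurable (lebesgue_on {u..v})"
    by (intro measurable_restrict_space1 measurable_completion) simp
  have "compact (\<psi> ` {- norm y..norm y})"
    by (intro compact_continuous_image continuous_on_subset[OF \<psi>]) auto
  moreover have "(\<lambda>t. \<psi> (y (period_rep T t))) ` {u..v} \<subseteq> \<psi> ` {- norm y..norm y}"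
    using abs_apply_bcontfun_le[of y] by (auto simp: abs_le_iff minus_le_iff intro!: imageI)
  ultimately show "bounded ((\<lambda>t. \<psi> (y (period_rep T t))) ` {u..v})"
    using compact_imp_bounded bounded_subset by blast
qed simp

text \<open>The Leray-Schauder alternative for the map that solves the linear problem with the
  nonlinear terms at y as source. The dependence of \<gamma> on norm y is needed for the inverted
  problem; \<beta> is a nonlocal forcing, constant in t.\<close>

lemma Leray_Schauder_periodic:
  fixes T p q lam R b :: real and a :: "real \<Rightarrow> real"
    and \<gamma> :: "real \<Rightarrow> real \<Rightarrow> real" and \<beta> :: "(real \<Rightarrow>\<^sub>C real) \<Rightarrow> real"
  assumes T: "T > 0" and p: "p > 0" and q: "q > 0" and R: "R > 0"
    and a: "locally_integrable a" "periodic T a"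
    and \<gamma>: "continuous_on UNIV (\<lambda>(n, s). \<gamma> n s)"
    and \<beta>: "continuous_on UNIV \<beta>" and b: "\<And>y. norm y \<le> R \<Longrightarrow> \<bar>\<beta> y\<bar> \<le> b"
    and no_sol: "\<And>(y :: real \<Rightarrow>\<^sub>C real) z s. 0 < s \<Longrightarrow> s < 1 \<Longrightarrow> norm y = R \<Longrightarrow>
      \<not> periodic_weak_solution T (q - p)
          (\<lambda>t. s * (p * q * max 0 (apply_bcontfun y t) + lam * a t * \<gamma> (norm y) (apply_bcontfun y t) + \<beta> y) - p * q * apply_bcontfun y t) (apply_bcontfun y) z"
  shows "\<exists>(y :: real \<Rightarrow>\<^sub>C real) z. norm y \<le> R \<and> periodic_weak_solution T (q - p)
          (\<lambda>t. p * q * max 0 (apply_bcontfun y t) + lam * a t * \<gamma> (norm y) (apply_bcontfun y t) + \<beta> y - p * q * apply_bcontfun y t) (apply_bcontfun y) z"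
proof -
  define h where "h = (\<lambda>(y::real \<Rightarrow>\<^sub>C real) t. p * q * max 0 (apply_bcontfun y (period_rep T t))
    + lam * a t * \<gamma> (norm y) (apply_bcontfun y (period_rep T t)) + \<beta> y)"
  have \<gamma>s: "continuous_on UNIV (\<gamma> n)" for n
  proof -
    have "continuous_on UNIV (\<lambda>s::real. (n, s))" by (intro continuous_intros)
    from continuous_on_compose2[OF \<gamma> this] show ?thesis by simp
  qed
  have aint: "a absolutely_integrable_on {u..v}" for u v using a(1) by (rule locally_integrable_Icc)
  have hint: "h y absolutely_integrable_on {u..v}" for y u v
  proof -
    have "(\<lambda>t. p * q * max 0 (apply_bcontfun y (period_rep T t)) * 1) absolutely_integrable_on {u..v}"
      by (rule absolutely_integrable_period_rep[where \<psi> = "\<lambda>s. p * q * max 0 s"])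
        (auto intro!: continuous_intros absolutely_integrable_on_const)
    moreover have "(\<lambda>t. lam * \<gamma> (norm y) (apply_bcontfun y (period_rep T t)) * a t) absolutely_integrable_on {u..v}"
      by (rule absolutely_integrable_period_rep[where \<psi> = "\<lambda>s. lam * \<gamma> (norm y) s"])
        (auto intro!: continuous_intros \<gamma>s aint)
    moreover have "(\<lambda>t. \<beta> y) absolutely_integrable_on {u..v}"
      by (rule absolutely_integrable_on_const) simp
    ultimately have "(\<lambda>t. p * q * max 0 (apply_bcontfun y (period_rep T t)) * 1
       + lam * \<gamma> (norm y) (apply_bcontfun y (period_rep T t)) * a t + \<beta> y) absolutely_integrable_on {u..v}"
      by (intro set_integral_add)
    then show ?thesis by (simp add: h_def mult_ac)
  qed
  have hper: "periodic T (h y)" for y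
  proof -
    have "period_rep T (t + T) = period_rep T t" for t
      using periodic_period_rep[OF T, of "\<lambda>t. t"] by (simp add: periodic_def)
    then show ?thesis using a(2) by (simp add: h_def periodic_def)
  qed
  have "\<exists>w::real \<Rightarrow>\<^sub>C real. \<exists>z. periodic_weak_solution T (q - p) (\<lambda>t. h y t - p * q * apply_bcontfun w t) w z" for y
  proof -
    have "h y integrable_on {u..v}" for u v
      using hint by (rule set_lebesgue_integral_eq_integral)
    then obtain u z where uz: "periodic_weak_solution T (q - p) (\<lambda>t. h y t - p * q * u t) u z"
      using pws_linear_exists[OF T p q hper] by metis
    obtain w :: "real \<Rightarrow>\<^sub>C real" where "apply_bcontfun w = u"
      using periodic_bcontfunE[OF T pws_periodic[OF T uz] pws_continuous[OF T uz]] by blast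
    then show ?thesis using uz by blast
  qed
  then obtain \<Phi> Z where \<Phi>: "\<And>y. periodic_weak_solution T (q - p) (\<lambda>t. h y t - p * q * apply_bcontfun (\<Phi> y) t)
      (apply_bcontfun (\<Phi> y :: real \<Rightarrow>\<^sub>C real)) (Z y)" by metis
  define A where "A = integral {0..T} (\<lambda>t. \<bar>a t\<bar>)"
  have aabs: "(\<lambda>t. \<bar>a t\<bar>) integrable_on {u..v}" for u v
    using aint[of u v] unfolding absolutely_integrable_on_def by simp
  have A: "A \<ge> 0" unfolding A_def by (intro Henstock_Kurzweil_Integration.integral_nonneg aabs) auto
  define C where "C = (4 + 1 / (T * p)) / q"
  have C: "C > 0" using T p q by (simp add: C_def add_pos_pos)
  have bound_int: "integral {0..T} (\<lambda>t. \<bar>f t\<bar>) \<le> T * e0 + \<bar>lam\<bar> * A * e1"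
    if "f absolutely_integrable_on {0..T}" "\<And>t. \<bar>f t\<bar> \<le> e0 + \<bar>lam\<bar> * \<bar>a t\<bar> * e1" for f e0 e1
  proof -
    have "integral {0..T} (\<lambda>t. \<bar>f t\<bar>) \<le> integral {0..T} (\<lambda>t. e0 + \<bar>lam\<bar> * \<bar>a t\<bar> * e1)"
      using that aabs unfolding absolutely_integrable_on_def
      by (intro integral_le integrable_add integrable_on_mult_left integrable_on_mult_right) auto
    also have "\<dots> = integral {0..T} (\<lambda>t. e0) + integral {0..T} (\<lambda>t. \<bar>lam\<bar> * \<bar>a t\<bar> * e1)"
      using aabs by (intro Henstock_Kurzweil_Integration.integral_add integrable_on_mult_left integrable_on_mult_right) auto
    also have "\<dots> = T * e0 + \<bar>lam\<bar> * A * e1" using T by (simp add: A_def)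
    finally show ?thesis .
  qed
  have "continuous_on UNIV \<Phi>"
    unfolding continuous_on_iff
  proof (intro ballI allI impI)
    fix y :: "real \<Rightarrow>\<^sub>C real" and e :: real assume "0 < e"
    \<comment> \<open>(M - 1) e1 will bound the L^1 distance of the two sources, and C times it the
      distance of the two solutions; the extra 1 makes the final inequality strict.\<close>
    define M where "M = T * (p * q) + T + \<bar>lam\<bar> * A + 1"
    have M: "M > 0" unfolding M_def using T p q A by (intro add_nonneg_pos add_nonneg_nonneg mult_nonneg_nonneg) auto
    define e1 where "e1 = e / (C * M)"
    have e1: "e1 > 0" using \<open>0 < e\<close> C M by (simp add: e1_def)
    obtain d1 where d1: "d1 > 0" "\<And>y'. dist y' y < d1 \<Longrightarrow> dist (\<beta> y') (\<beta> y) < e1"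
      using \<beta> e1 unfolding continuous_on_iff by blast
    define N where "N = norm y + 1"
    \<comment> \<open>This box contains the norm and the values of every y' within distance 1 of y,
      so that the estimate for \<gamma> is uniform in t.\<close>
    have "uniformly_continuous_on ({0..N} \<times> {-N..N}) (\<lambda>(n, s). \<gamma> n s)"
      by (intro compact_uniformly_continuous continuous_on_subset[OF \<gamma>] compact_Times) auto
    then obtain d2 where d2: "d2 > 0" "\<And>x x'. x \<in> {0..N} \<times> {-N..N} \<Longrightarrow> x' \<in> {0..N} \<times> {-N..N} \<Longrightarrow>
        dist x' x < d2 \<Longrightarrow> dist (case x' of (n, s) \<Rightarrow> \<gamma> n s) (case x of (n, s) \<Rightarrow> \<gamma> n s) < e1"
      using e1 unfolding uniformly_continuous_on_def by metis
    define d where "d = min (min d1 (d2 / 2)) (min e1 1)"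
    have d: "d > 0" using d1 d2 e1 by (simp add: d_def)
    have "dist (\<Phi> y') (\<Phi> y) < e" if dy: "dist y' y < d" for y'
    proof -
      have n1: "\<bar>norm y' - norm y\<bar> < d" using dy norm_triangle_ineq3[of y' y] by (simp add: dist_norm)
      have n2: "\<bar>apply_bcontfun y' t - apply_bcontfun y t\<bar> < d" for t
        using dy dist_bounded[of y' t y] by (simp add: dist_real_def)
      have d_le: "d \<le> 1" "d \<le> e1" "d \<le> d1" "d \<le> d2 / 2" by (auto simp: d_def)
      have g: "\<bar>\<gamma> (norm y') (apply_bcontfun y' t) - \<gamma> (norm y) (apply_bcontfun y t)\<bar> \<le> e1" for t
      proof -
        have "\<bar>apply_bcontfun y' t\<bar> \<le> norm y'" "\<bar>apply_bcontfun y t\<bar> \<le> norm y" by (rule abs_apply_bcontfun_le)+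
        moreover have "norm y' \<le> N" "norm y \<le> N" using n1 d_le by (auto simp: N_def)
        ultimately have "(norm y', apply_bcontfun y' t) \<in> {0..N} \<times> {-N..N}" "(norm y, apply_bcontfun y t) \<in> {0..N} \<times> {-N..N}"
          by auto
        moreover have "dist (norm y', apply_bcontfun y' t) (norm y, apply_bcontfun y t) \<le> dist (norm y') (norm y) + dist (apply_bcontfun y' t) (apply_bcontfun y t)"
          unfolding dist_prod_def by (simp add: sqrt_sum_squares_le_sum)
        moreover have "dist (norm y') (norm y) + dist (apply_bcontfun y' t) (apply_bcontfun y t) < d2"
          using n1 n2[of t] d_le by (simp add: dist_real_def)
        ultimately show ?thesis using d2(2)[of "(norm y, apply_bcontfun y t)" "(norm y', apply_bcontfun y' t)"]
          by (simp add: dist_real_def)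
      qed
      have hd: "\<bar>h y' t - h y t\<bar> \<le> (p * q * e1 + e1) + \<bar>lam\<bar> * \<bar>a t\<bar> * e1" for t
      proof -
        define r where "r = period_rep T t"
        have "\<bar>max 0 (apply_bcontfun y' r) - max 0 (apply_bcontfun y r)\<bar> \<le> e1" using n2[of r] d_le by (auto simp: max_def)
        then have 1: "\<bar>p * q * (max 0 (apply_bcontfun y' r) - max 0 (apply_bcontfun y r))\<bar> \<le> p * q * e1"
          using p q by (simp add: abs_mult)
        have 2: "\<bar>lam * a t * (\<gamma> (norm y') (apply_bcontfun y' r) - \<gamma> (norm y) (apply_bcontfun y r))\<bar> \<le> \<bar>lam\<bar> * \<bar>a t\<bar> * e1"
          unfolding abs_mult by (intro mult_left_mono g) auto
        have 3: "\<bar>\<beta> y' - \<beta> y\<bar> \<le> e1" using d1(2)[of y'] dy d_le by (simp add: dist_real_def)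
        have "h y' t - h y t = p * q * (max 0 (apply_bcontfun y' r) - max 0 (apply_bcontfun y r))
            + lam * a t * (\<gamma> (norm y') (apply_bcontfun y' r) - \<gamma> (norm y) (apply_bcontfun y r)) + (\<beta> y' - \<beta> y)"
          by (simp add: h_def r_def algebra_simps)
        then show ?thesis using 1 2 3 by linarith
      qed
      have dint: "(\<lambda>t. h y' t - h y t) absolutely_integrable_on {u..v}" for u v
        by (intro set_integral_diff hint)
      have "integral {0..T} (\<lambda>t. \<bar>h y' t - h y t\<bar>) \<le> T * (p * q * e1 + e1) + \<bar>lam\<bar> * A * e1"
        using hd by (intro bound_int dint)
      also have "\<dots> \<le> (M - 1) * e1" by (simp add: M_def algebra_simps)
      finally have I: "integral {0..T} (\<lambda>t. \<bar>h y' t - h y t\<bar>) \<le> (M - 1) * e1" .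
      have ps: "periodic_weak_solution T (q - p) (\<lambda>t. (h y' t - h y t) - p * q * (apply_bcontfun (\<Phi> y') t - apply_bcontfun (\<Phi> y) t))
          (\<lambda>t. apply_bcontfun (\<Phi> y') t - apply_bcontfun (\<Phi> y) t) (\<lambda>t. Z y' t - Z y t)"
        using pws_diff[OF \<Phi>[of y'] \<Phi>[of y]] by (simp add: algebra_simps)
      have per: "periodic T (\<lambda>t. h y' t - h y t)" using hper by (simp add: periodic_def)
      have "\<bar>apply_bcontfun (\<Phi> y') t - apply_bcontfun (\<Phi> y) t\<bar> \<le> C * ((M - 1) * e1)" for t
        unfolding C_def by (rule pws_linear_bound(1)[OF T p q per dint ps I])
      then have "dist (\<Phi> y') (\<Phi> y) \<le> C * ((M - 1) * e1)"
        by (intro dist_bound) (simp add: dist_real_def)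
      also have "\<dots> < C * (M * e1)" using C e1 by simp
      also have "\<dots> = e" using C M by (simp add: e1_def)
      finally show ?thesis .
    qed
    then show "\<exists>d>0. \<forall>y'\<in>UNIV. dist y' y < d \<longrightarrow> dist (\<Phi> y') (\<Phi> y) < e" using d by blast
  qed
  moreover
  have "compact ((\<lambda>(n, s). \<gamma> n s) ` ({0..R} \<times> {-R..R}))"
    by (intro compact_continuous_image continuous_on_subset[OF \<gamma>] compact_Times) auto
  then have "bounded ((\<lambda>(n, s). \<gamma> n s) ` ({0..R} \<times> {-R..R}))" by (rule compact_imp_bounded)
  then obtain G where G: "\<And>x. x \<in> {0..R} \<times> {-R..R} \<Longrightarrow> norm (case x of (n, s) \<Rightarrow> \<gamma> n s) \<le> G"
    unfolding bounded_iff by auto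
  define B where "B = T * (p * q * R + b) + \<bar>lam\<bar> * A * G"
  \<comment> \<open>The larger of the bounds for u and u', so that K is both a bound and a Lipschitz
    constant for the images.\<close>
  define K where "K = max (C * B) (2 * (4 + 1 / (T * p)) * B)"
  have "\<Phi> ` cball 0 R \<subseteq> {w :: real \<Rightarrow>\<^sub>C real. periodic T w \<and> (\<forall>t. \<bar>w t\<bar> \<le> K) \<and> (\<forall>s t. \<bar>w s - w t\<bar> \<le> K * \<bar>s - t\<bar>)}"
  proof (intro image_subsetI CollectI conjI allI)
    fix y :: "real \<Rightarrow>\<^sub>C real" assume "y \<in> cball 0 R"
    then have y: "norm y \<le> R" by simp
    have "\<bar>h y t\<bar> \<le> (p * q * R + b) + \<bar>lam\<bar> * \<bar>a t\<bar> * G" for t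
    proof -
      define r where "r = period_rep T t"
      have yr: "\<bar>apply_bcontfun y r\<bar> \<le> R" using abs_apply_bcontfun_le[of y r] y by linarith
      then have 1: "\<bar>p * q * max 0 (apply_bcontfun y r)\<bar> \<le> p * q * R"
        using p q R by (simp add: abs_mult)
      have "\<bar>\<gamma> (norm y) (apply_bcontfun y r)\<bar> \<le> G" using G[of "(norm y, apply_bcontfun y r)"] y yr by (auto simp: abs_le_iff)
      then have 2: "\<bar>lam * a t * \<gamma> (norm y) (apply_bcontfun y r)\<bar> \<le> \<bar>lam\<bar> * \<bar>a t\<bar> * G"
        unfolding abs_mult by (intro mult_left_mono) auto
      show ?thesis using 1 2 b[OF y] unfolding h_def r_def by linarith
    qed
    then have I: "integral {0..T} (\<lambda>t. \<bar>h y t\<bar>) \<le> B"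
      unfolding B_def by (intro bound_int hint)
    note bd = pws_linear_bound[OF T p q hper hint \<Phi> I]
    show "periodic T (\<Phi> y)" by (rule pws_periodic[OF T \<Phi>])
    show "\<bar>apply_bcontfun (\<Phi> y) t\<bar> \<le> K" for t using bd(1)[of t] by (simp add: K_def C_def)
    have ZK: "norm (Z y t) \<le> K" for t using bd(2)[of t] by (simp add: K_def)
    have "norm (apply_bcontfun (\<Phi> y) s - apply_bcontfun (\<Phi> y) t) \<le> K * norm (s - t)" for s t
      by (rule field_differentiable_bound[of UNIV _ "Z y"])
        (use ZK pws_deriv[OF T \<Phi>] in auto)
    then show "\<bar>apply_bcontfun (\<Phi> y) s - apply_bcontfun (\<Phi> y) t\<bar> \<le> K * \<bar>s - t\<bar>" for s t by simp
  qed
  \<comment> \<open>Divided by \<mu>, the equation of an eigenvector is the homotopy equation with s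
    = 1/\<mu>. Since \<mu> x is a value of \<Phi>, x is periodic and \<open>period_rep\<close>
    disappears.\<close>
  moreover have "\<Phi> x \<noteq> \<mu> *\<^sub>R x" if "norm x = R" "\<mu> > 1" for x \<mu>
  proof
    assume eq: "\<Phi> x = \<mu> *\<^sub>R x"
    then have \<Phi>x: "apply_bcontfun (\<Phi> x) = (\<lambda>t. \<mu> * apply_bcontfun x t)" by auto
    then have "periodic T (\<lambda>t. \<mu> * apply_bcontfun x t)" using pws_periodic[OF T \<Phi>[of x]] by simp
    then have xp: "periodic T x" using that by (simp add: periodic_def)
    have "periodic_weak_solution T (q - p) (\<lambda>t. (1/\<mu>) * (h x t - p * q * (\<mu> * apply_bcontfun x t)))
        (\<lambda>t. (1/\<mu>) * (\<mu> * apply_bcontfun x t)) (\<lambda>t. (1/\<mu>) * Z x t)"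
      using pws_scale[OF \<Phi>[of x], of "1/\<mu>"] unfolding \<Phi>x by simp
    moreover have "(1/\<mu>) * (h x t - p * q * (\<mu> * apply_bcontfun x t)) =
       (1/\<mu>) * (p * q * max 0 (apply_bcontfun x t) + lam * a t * \<gamma> (norm x) (apply_bcontfun x t) + \<beta> x) - p * q * apply_bcontfun x t" for t
      using that by (simp add: h_def period_rep_periodic[OF xp] field_simps)
    moreover have "(1/\<mu>) * (\<mu> * apply_bcontfun x t) = apply_bcontfun x t" for t using that by simp
    ultimately show False using no_sol[of "1/\<mu>" x "\<lambda>t. (1/\<mu>) * Z x t"] that by simp
  qed
  ultimately obtain y where y: "norm y \<le> R" "\<Phi> y = y"
    using Leray_Schauder_ball[OF _ compact_periodic_lipschitz[OF T] _ R] by meson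
  have yp: "periodic T y" using pws_periodic[OF T \<Phi>[of y]] y by simp
  have "periodic_weak_solution T (q - p) (\<lambda>t. p * q * max 0 (apply_bcontfun y t) + lam * a t * \<gamma> (norm y) (apply_bcontfun y t) + \<beta> y - p * q * apply_bcontfun y t)
      (apply_bcontfun y) (Z y)"
    using \<Phi>[of y] y(2) by (simp add: h_def period_rep_periodic[OF yp])
  then show ?thesis using y by blast
qed

section \<open>Caratheodory solutions\<close>

text \<open>The bounded truncations of \<open>\<bar>F\<bar>\<close> approximate it in mean.\<close>

lemma abs_continuous_between_indefinite_integral:
  fixes F z :: "real \<Rightarrow> real"
  assumes F: "F absolutely_integrable_on {x..y}"
    and z: "\<And>s t. x \<le> s \<Longrightarrow> s \<le> t \<Longrightarrow> t \<le> y \<Longrightarrow> (F has_integral (z t - z s)) {s..t}"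
  shows "abs_continuous_between x y z"
  unfolding abs_continuous_between_def
proof (intro allI impI)
  fix \<epsilon> :: real assume \<epsilon>: "\<epsilon> > 0"
  have Fa: "(\<lambda>t. \<bar>F t\<bar>) integrable_on {x..y}"
    using F unfolding absolutely_integrable_on_def by simp
  have Faa: "(\<lambda>t. \<bar>F t\<bar>) absolutely_integrable_on {x..y}"
    using absolutely_integrable_norm[OF F] by (simp add: o_def)
  define \<phi> where "\<phi> = (\<lambda>(k::nat) t. min \<bar>F t\<bar> (real k))"
  have \<phi>i: "\<phi> k integrable_on {x..y}" for k
  proof -
    have c: "(\<lambda>t. real k) absolutely_integrable_on {x..y}"
      by (intro absolutely_integrable_on_const) simp
    have "(\<lambda>t. \<bar>\<bar>F t\<bar> - real k\<bar>) integrable_on {x..y}"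
      using set_integral_diff(1)[OF Faa c] unfolding absolutely_integrable_on_def by simp
    then have "(\<lambda>t. (\<bar>F t\<bar> + real k - \<bar>\<bar>F t\<bar> - real k\<bar>) / 2) integrable_on {x..y}"
      using Fa by (intro integrable_on_divide integrable_diff integrable_add) auto
    moreover have "(\<bar>F t\<bar> + real k - \<bar>\<bar>F t\<bar> - real k\<bar>) / 2 = \<phi> k t" for t
      by (simp add: \<phi>_def min_def)
    ultimately show ?thesis by simp
  qed
  have "(\<lambda>k. integral {x..y} (\<phi> k)) \<longlonglongrightarrow> integral {x..y} (\<lambda>t. \<bar>F t\<bar>)"
  proof (rule dominated_convergence(2)[OF \<phi>i Fa])
    fix t
    obtain k0 :: nat where "\<bar>F t\<bar> \<le> real k0" using real_arch_simple by blast
    then have "\<phi> k t = \<bar>F t\<bar>" if "k \<ge> k0" for k using that by (auto simp: \<phi>_def)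
    then show "(\<lambda>k. \<phi> k t) \<longlonglongrightarrow> \<bar>F t\<bar>"
      by (intro tendsto_eventually) (auto simp: eventually_sequentially)
  qed (auto simp: \<phi>_def)
  then obtain k where k: "\<bar>integral {x..y} (\<phi> k) - integral {x..y} (\<lambda>t. \<bar>F t\<bar>)\<bar> < \<epsilon> / 2"
    using \<epsilon> unfolding LIMSEQ_iff by (metis half_gt_zero order_refl real_norm_def)
  define \<psi> where "\<psi> = (\<lambda>t. \<bar>F t\<bar> - \<phi> k t)"
  have \<psi>i: "\<psi> integrable_on {x..y}" unfolding \<psi>_def by (intro integrable_diff Fa \<phi>i)
  have \<psi>0: "\<psi> t \<ge> 0" for t by (simp add: \<psi>_def \<phi>_def)
  have \<psi>\<epsilon>: "integral {x..y} \<psi> < \<epsilon> / 2"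
    using k unfolding \<psi>_def Henstock_Kurzweil_Integration.integral_diff[OF Fa \<phi>i] by linarith
  \<comment> \<open>|F| is \<psi> plus a part at most k. Over any admissible family, \<psi>
    contributes less than \<epsilon>/2 and the other part at most k \<delta> \<le> \<epsilon>/2; the
    summand 1 covers k = 0.\<close>
  define \<delta> where "\<delta> = \<epsilon> / (2 * (real k + 1))"
  show "\<exists>\<delta>>0. \<forall>\<D>. \<D> division_of \<Union>\<D> \<and> \<Union>\<D> \<subseteq> {x..y} \<and> (\<Sum>K\<in>\<D>. Sup K - Inf K) < \<delta> \<longrightarrow>
          (\<Sum>K\<in>\<D>. \<bar>z (Sup K) - z (Inf K)\<bar>) < \<epsilon>"
  proof (intro exI[of _ \<delta>] conjI allI impI)
    show "\<delta> > 0" using \<epsilon> by (simp add: \<delta>_def)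
    fix \<D> assume "\<D> division_of \<Union>\<D> \<and> \<Union>\<D> \<subseteq> {x..y} \<and> (\<Sum>K\<in>\<D>. Sup K - Inf K) < \<delta>"
    then have div: "\<D> division_of \<Union>\<D>" and sub: "\<Union>\<D> \<subseteq> {x..y}" and len: "(\<Sum>K\<in>\<D>. Sup K - Inf K) < \<delta>"
      by auto
    have K: "\<bar>z (Sup K) - z (Inf K)\<bar> \<le> integral K \<psi> + real k * (Sup K - Inf K)" if KD: "K \<in> \<D>" for K
    proof -
      obtain s t where st: "K = cbox s t" using division_ofD(4)[OF div KD] by blast
      have "K \<noteq> {}" using division_ofD(3)[OF div KD] .
      then have le: "s \<le> t" and Kst: "K = {s..t}" using st by auto
      have SI: "Sup K = t" "Inf K = s" using Kst le by auto
      have "{s..t} \<subseteq> {x..y}" using KD sub Kst by blast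
      then have xy: "x \<le> s" "t \<le> y" using le by auto
      have "\<bar>z t - z s\<bar> = \<bar>integral {s..t} F\<bar>"
        using integral_unique[OF z[OF xy(1) le xy(2)]] by simp
      also have "\<dots> \<le> integral {s..t} (\<lambda>t. \<bar>F t\<bar>)"
        using integral_norm_bound_integral[of F "{s..t}" "\<lambda>t. \<bar>F t\<bar>"] z[OF xy(1) le xy(2)]
          integrable_on_subinterval[OF Fa, of s t] xy by auto
      also have "\<dots> \<le> integral {s..t} (\<lambda>t. \<psi> t + real k)"
        using integrable_on_subinterval[OF Fa, of s t] integrable_on_subinterval[OF \<psi>i, of s t] xy
        by (intro integral_le integrable_add) (auto simp: \<psi>_def \<phi>_def)
      also have "\<dots> = integral {s..t} \<psi> + real k * (t - s)"
        using integrable_on_subinterval[OF \<psi>i, of s t] xy le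
        by (subst Henstock_Kurzweil_Integration.integral_add) auto
      finally show ?thesis using SI Kst by simp
    qed
    have "(\<Sum>K\<in>\<D>. \<bar>z (Sup K) - z (Inf K)\<bar>) \<le> (\<Sum>K\<in>\<D>. integral K \<psi> + real k * (Sup K - Inf K))"
      using K by (rule sum_mono)
    also have "\<dots> = (\<Sum>K\<in>\<D>. integral K \<psi>) + real k * (\<Sum>K\<in>\<D>. Sup K - Inf K)"
      by (simp add: sum.distrib sum_distrib_left)
    also have "(\<Sum>K\<in>\<D>. integral K \<psi>) = integral (\<Union>\<D>) \<psi>"
      by (rule integral_combine_division_topdown[symmetric, OF integrable_on_subdivision[OF div \<psi>i sub] div])
    also have "\<dots> \<le> integral {x..y} \<psi>"
      using \<psi>0 by (intro integral_subset_le sub \<psi>i integrable_on_subdivision[OF div \<psi>i sub]) auto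
    also have "real k * (\<Sum>K\<in>\<D>. Sup K - Inf K) \<le> real k * \<delta>"
      using len by (intro mult_left_mono) auto
    also have "real k * \<delta> \<le> \<epsilon> / 2" using \<epsilon> by (simp add: \<delta>_def field_simps)
    finally show "(\<Sum>K\<in>\<D>. \<bar>z (Sup K) - z (Inf K)\<bar>) < \<epsilon>" using \<psi>\<epsilon> by simp
  qed
qed

text \<open>Lebesgue differentiation for cubes with x as lower corner yields only right difference
  quotients; applied to the reflected function it yields the left ones.\<close>

lemma indefinite_integral_AE_derivative:
  fixes F z :: "real \<Rightarrow> real"
  assumes z: "\<And>s t. s \<le> t \<Longrightarrow> (F has_integral (z t - z s)) {s..t}"
  shows "AE t in lebesgue. (z has_real_derivative F t) (at t)"
proof -
  have Fi: "F integrable_on {s..t}" for s t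
    using z[of s t] by (cases "s \<le> t") auto
  have Fi': "F integrable_on cbox s t" for s t using Fi by simp
  have Gi: "(\<lambda>t. F (- t)) integrable_on cbox s t" for s t
    using Fi[of "-t" "-s"] integrable_reflect[of F "-s" "-t"] by simp
  obtain N1 where N1: "negligible N1" "\<And>x e. x \<notin> N1 \<Longrightarrow> 0 < e \<Longrightarrow>
      \<exists>d>0. \<forall>h. 0 < h \<and> h < d \<longrightarrow> norm (integral (cbox x (x + h *\<^sub>R One)) F /\<^sub>R h ^ DIM(real) - F x) < e"
    using integrable_ccontinuous_explicit[of F] Fi' by metis
  obtain N2 where N2: "negligible N2" "\<And>x e. x \<notin> N2 \<Longrightarrow> 0 < e \<Longrightarrow>
      \<exists>d>0. \<forall>h. 0 < h \<and> h < d \<longrightarrow> norm (integral (cbox x (x + h *\<^sub>R One)) (\<lambda>t. F (- t)) /\<^sub>R h ^ DIM(real) - F (- x)) < e"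
    using integrable_ccontinuous_explicit[of "\<lambda>t. F (- t)"] Gi by metis
  have "(uminus :: real \<Rightarrow> real) differentiable_on N2"
    unfolding differentiable_on_def by (intro ballI derivative_intros)
  then have "negligible (uminus ` N2)"
    by (rule negligible_differentiable_image_negligible[OF order_refl N2(1)])
  then have "N1 \<union> uminus ` N2 \<in> null_sets lebesgue"
    using N1(1) negligible_iff_null_sets negligible_Un by blast
  moreover have "(z has_real_derivative F t) (at t)" if "t \<notin> N1 \<union> uminus ` N2" for t
    unfolding DERIV_def LIM_eq
  proof (intro allI impI)
    fix e :: real assume e: "0 < e"
    have "t \<notin> N1" "- t \<notin> N2" using that by force+
    then obtain d1 d2 where d1: "d1 > 0"
      "\<And>h. 0 < h \<Longrightarrow> h < d1 \<Longrightarrow> norm (integral (cbox t (t + h *\<^sub>R One)) F /\<^sub>R h ^ DIM(real) - F t) < e"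
      and d2: "d2 > 0"
      "\<And>h. 0 < h \<Longrightarrow> h < d2 \<Longrightarrow> norm (integral (cbox (- t) (- t + h *\<^sub>R One)) (\<lambda>t. F (- t)) /\<^sub>R h ^ DIM(real) - F (- (- t))) < e"
      using N1(2)[of t e] N2(2)[of "- t" e] e by metis
    show "\<exists>s>0. \<forall>h. h \<noteq> 0 \<and> norm (h - 0) < s \<longrightarrow> norm ((z (t + h) - z t) / h - F t) < e"
    proof (intro exI[of _ "min d1 d2"] conjI allI impI)
      show "min d1 d2 > 0" using d1 d2 by simp
      fix h :: real assume h: "h \<noteq> 0 \<and> norm (h - 0) < min d1 d2"
      show "norm ((z (t + h) - z t) / h - F t) < e"
      proof (cases "h > 0")
        case True
        have "integral {t..t+h} F = z (t + h) - z t" using True by (intro integral_unique z) simp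
        then show ?thesis using d1(2)[of h] True h by (simp add: divide_inverse mult.commute)
      next
        case False
        then have hn: "h < 0" using h by simp
        have "integral {- t..- (t + h)} (\<lambda>t. F (- t)) = integral {t + h..t} F"
          by (rule Henstock_Kurzweil_Integration.integral_reflect_real)
        also have "\<dots> = z t - z (t + h)" using hn by (intro integral_unique z) simp
        finally have "integral {- t..- t - h} (\<lambda>t. F (- t)) = z t - z (t + h)" by simp
        then have "norm ((z t - z (t + h)) /\<^sub>R (- h) - F t) < e"
          using d2(2)[of "-h"] hn h by simp
        moreover have "(z t - z (t + h)) /\<^sub>R (- h) = (z (t + h) - z t) / h"
          by (simp add: divide_inverse algebra_simps)
        ultimately show ?thesis by simp
      qed
    qed
  qed
  ultimately show ?thesis by (intro AE_I'[of "N1 \<union> uminus ` N2"]) auto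
qed

lemma pws_imp_caratheodory:
  assumes T: "T > 0" and sol: "periodic_weak_solution T c (\<lambda>t. lam * a t * g (u t)) u z"
    and a: "\<And>x y. (\<lambda>t. lam * a t * g (u t)) absolutely_integrable_on {x..y}"
  shows "caratheodory_solution c lam a g u"
proof -
  have du: "(u has_real_derivative z t) (at t)" for t by (rule pws_deriv[OF T sol])
  have deriv_u: "deriv u = z" using du DERIV_imp_deriv by blast
  \<comment> \<open>The equation solved for u''. As z is an indefinite integral of F, both its
    absolute continuity and its derivative almost everywhere follow.\<close>
  define F where "F = (\<lambda>t. - (lam * a t * g (u t)) - c * z t)"
  have zF: "(F has_integral (z t - z s)) {s..t}" if "s \<le> t" for s t
  proof -
    have "(z has_integral (u t - u s)) {s..t}"
      using that du by (intro fundamental_theorem_of_calculus)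
        (auto simp: has_real_derivative_iff_has_vector_derivative has_vector_derivative_at_within)
    then have "(F has_integral (- (z s + c * u s - (z t + c * u t)) - c * (u t - u s))) {s..t}"
      unfolding F_def using pws_has_integral[OF T sol that]
      by (intro has_integral_diff has_integral_neg has_integral_mult_right)
    then show ?thesis by (simp add: algebra_simps)
  qed
  have Fa: "F absolutely_integrable_on {x..y}" for x y
  proof -
    have "(\<lambda>t. c * z t) absolutely_integrable_on {x..y}"
      by (rule absolutely_integrable_continuous_real)
        (intro continuous_intros continuous_on_subset[OF pws_deriv_continuous[OF T sol]], auto)
    moreover have "(\<lambda>t. - (lam * a t * g (u t))) absolutely_integrable_on {x..y}"
      using set_integrable_mult_right[OF a, where a = "-1"] by simp
    ultimately show ?thesis unfolding F_def by (rule set_integral_diff(1)[rotated])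
  qed
  show ?thesis
    unfolding caratheodory_solution_def
  proof (intro conjI)
    show "u C1_differentiable_on UNIV"
      unfolding C1_differentiable_on_def
      using du pws_deriv_continuous[OF T sol] by (auto simp: has_real_derivative_iff_has_vector_derivative)
    show "locally_abs_continuous (deriv u)"
      unfolding locally_abs_continuous_def deriv_u
      by (intro allI abs_continuous_between_indefinite_integral[OF Fa] zF)
    have "AE t in lebesgue. (z has_real_derivative F t) (at t)"
      by (rule indefinite_integral_AE_derivative[OF zF])
    then show "AE t in lebesgue. deriv u differentiable at t \<and>
        deriv (deriv u) t + c * deriv u t + lam * a t * g (u t) = 0"
      unfolding deriv_u
    proof (rule eventually_mono)
      fix t assume "(z has_real_derivative F t) (at t)"
      then show "z differentiable at t \<and> deriv z t + c * z t + lam * a t * g (u t) = 0"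
        using DERIV_imp_deriv[of z "F t" t] real_differentiable_def by (auto simp: F_def)
    qed
  qed
qed

section \<open>Solutions with small or large maximum\<close>

lemma absolutely_integrable_mult_continuous:
  fixes f \<phi> :: "real \<Rightarrow> real"
  assumes f: "f absolutely_integrable_on {x..y}" and \<phi>: "continuous_on UNIV \<phi>"
  shows "(\<lambda>t. f t * \<phi> t) absolutely_integrable_on {x..y}"
proof -
  have "(\<lambda>t. \<phi> t * f t) absolutely_integrable_on {x..y}"
  proof (rule absolutely_integrable_bounded_measurable_product_real[OF _ _ _ f])
    have "\<phi> \<in> borel_measurable borel" using \<phi> by (rule borel_measurable_continuous_onI)
    then show "\<phi> \<in> borel_measurable (lebesgue_on {x..y})"
      by (intro measurable_restrict_space1 measurable_completion) simp
    have "compact (\<phi> ` {x..y})"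
      by (intro compact_continuous_image continuous_on_subset[OF \<phi>]) auto
    then show "bounded (\<phi> ` {x..y})" by (rule compact_imp_bounded)
  qed simp
  then show ?thesis by (simp add: mult.commute)
qed

lemma pws_truncated_nonneg:
  assumes T: "T > 0" and \<kappa>: "\<kappa> > 0" and s: "s \<ge> 0" and \<alpha>: "\<alpha> \<ge> 0"
    and \<gamma>: "\<And>v. v \<le> 0 \<Longrightarrow> \<gamma> v = 0"
    and sol: "periodic_weak_solution T c (\<lambda>t. s * (\<kappa> * max 0 (u t) + lam * a t * \<gamma> (u t) + \<alpha>) - \<kappa> * u t) u z"
  shows "u t \<ge> 0"
proof (rule pws_nonneg[OF T sol \<kappa>])
  fix t assume "u t < 0"
  then show "- \<kappa> * u t \<le> s * (\<kappa> * max 0 (u t) + lam * a t * \<gamma> (u t) + \<alpha>) - \<kappa> * u t"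
    using \<gamma>[of "u t"] s \<alpha> by simp
qed

context
  fixes T c lam \<kappa> :: real and a g :: "real \<Rightarrow> real"
  assumes T: "T > 0" and \<kappa>: "\<kappa> > 0" and lam: "lam > 0"
    and a: "locally_integrable a" "periodic T a" and mean: "integral {0..T} a < 0"
    and g: "continuous_on UNIV g" "\<And>v. g v \<ge> 0"
begin

lemma weight_absolutely_integrable: "a absolutely_integrable_on {x..y}"
  using a(1) by (rule locally_integrable_Icc)

lemma weight_integrable: "a integrable_on {x..y}"
  using weight_absolutely_integrable by (rule set_lebesgue_integral_eq_integral)

lemma abs_weight_integrable: "(\<lambda>t. \<bar>a t\<bar>) integrable_on {x..y}"
  using weight_absolutely_integrable[of x y] unfolding absolutely_integrable_on_def by simp

lemma abs_weight_integral_nonneg: "integral {0..T} (\<lambda>t. \<bar>a t\<bar>) \<ge> 0"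
  by (intro Henstock_Kurzweil_Integration.integral_nonneg abs_weight_integrable) auto

context
  fixes s \<alpha> R \<epsilon> t1 :: real and u z :: "real \<Rightarrow> real"
  assumes sol: "periodic_weak_solution T c (\<lambda>t. s * (\<kappa> * u t + lam * a t * g (u t) + \<alpha>) - \<kappa> * u t) u z"
    and s: "0 < s" "s \<le> 1" and \<alpha>: "\<alpha> \<ge> 0"
    and u: "\<And>t. 0 \<le> u t" "\<And>t. u t \<le> R" "u t1 = R"
    and \<epsilon>: "\<And>v. 0 \<le> v \<Longrightarrow> v \<le> R \<Longrightarrow> g v \<le> \<epsilon> * R"
begin

lemma reaction_absolutely_integrable: "(\<lambda>t. a t * g (u t)) absolutely_integrable_on {x..y}"
proof (rule absolutely_integrable_mult_continuous[OF weight_absolutely_integrable])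
  show "continuous_on UNIV (\<lambda>t. g (u t))"
    by (rule continuous_on_compose2[OF g(1) pws_continuous[OF T sol]]) auto
qed

lemma reaction_integrable: "(\<lambda>t. a t * g (u t)) integrable_on {x..y}"
  "(\<lambda>t. \<bar>a t * g (u t)\<bar>) integrable_on {x..y}"
  using reaction_absolutely_integrable[of x y] unfolding absolutely_integrable_on_def by auto

lemma pws_solution_integrable: "u integrable_on {x..y}"
  by (intro integrable_continuous_real pws_continuous[OF T sol])

text \<open>The source has integral 0 over a period. Since u \<ge> 0, the left side is nonnegative,
  which fixes the sign of the reaction integral when \<alpha> = 0; read the other way, the identity
  bounds the homotopy term (1 - s) \<kappa> u in mean by reaction and forcing.\<close>

lemma mean_identity:
  "(1 - s) * \<kappa> * integral {0..T} u = s * (lam * integral {0..T} (\<lambda>t. a t * g (u t)) + \<alpha> * T)"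
proof -
  have "((\<lambda>t. s * (\<kappa> * u t + lam * (a t * g (u t)) + \<alpha>) - \<kappa> * u t) has_integral
      (s * (\<kappa> * integral {0..T} u + lam * integral {0..T} (\<lambda>t. a t * g (u t)) + \<alpha> * T)
        - \<kappa> * integral {0..T} u)) {0..T}"
    using has_integral_const_real[of \<alpha> 0 T] T
    by (intro has_integral_diff has_integral_mult_right has_integral_add integrable_integral
        pws_solution_integrable reaction_integrable) (simp add: mult.commute)
  then have "integral {0..T} (\<lambda>t. s * (\<kappa> * u t + lam * a t * g (u t) + \<alpha>) - \<kappa> * u t) =
      s * (\<kappa> * integral {0..T} u + lam * integral {0..T} (\<lambda>t. a t * g (u t)) + \<alpha> * T)
        - \<kappa> * integral {0..T} u"
    by (intro integral_unique) (simp add: mult.assoc)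
  then show ?thesis using pws_integral_period[OF T sol, of 0] by (simp add: algebra_simps)
qed

lemma reaction_integral_bound:
  "integral {0..T} (\<lambda>t. \<bar>a t * g (u t)\<bar>) \<le> integral {0..T} (\<lambda>t. \<bar>a t\<bar>) * (\<epsilon> * R)"
proof -
  have "integral {0..T} (\<lambda>t. \<bar>a t * g (u t)\<bar>) \<le> integral {0..T} (\<lambda>t. \<bar>a t\<bar> * (\<epsilon> * R))"
    using abs_weight_integrable g(2) u \<epsilon>
    by (intro integral_le reaction_integrable integrable_on_mult_left) (auto simp: abs_mult intro!: mult_left_mono)
  then show ?thesis by simp
qed

text \<open>Uniform in s and \<kappa>: the mean identity trades the term (1 - s) \<kappa> u of the
  source for reaction and forcing, which are thus counted twice. The oscillation is measured from
  the maximum point t1, a critical point.\<close>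

lemma oscillation_bound:
  "\<bar>u t - R\<bar> \<le> T * exp (\<bar>c\<bar> * T) * (2 * (lam * integral {0..T} (\<lambda>t. \<bar>a t\<bar>) * (\<epsilon> * R) + \<alpha> * T))"
proof -
  define A where "A = integral {0..T} (\<lambda>t. \<bar>a t\<bar>)"
  define H where "H = (\<lambda>t. s * (\<kappa> * u t + lam * a t * g (u t) + \<alpha>) - \<kappa> * u t)"
  have H_eq: "H t = - ((1 - s) * \<kappa>) * u t + s * lam * (a t * g (u t)) + s * \<alpha>" for t
    by (simp add: H_def algebra_simps)
  have ua: "u absolutely_integrable_on {x..y}" for x y
    by (intro absolutely_integrable_continuous_real pws_continuous[OF T sol])
  have Ha: "H absolutely_integrable_on {x..y}" for x y
  proof -
    have "(\<lambda>t. - ((1 - s) * \<kappa>) * u t + s * lam * (a t * g (u t)) + s * \<alpha>) absolutely_integrable_on {x..y}"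
      using ua reaction_absolutely_integrable
      by (intro set_integral_add(1) set_integrable_mult_right absolutely_integrable_on_const) auto
    then show ?thesis by (simp only: H_eq[abs_def])
  qed
  have Hi: "(\<lambda>t. \<bar>H t\<bar>) integrable_on {x..y}" for x y
    using Ha[of x y] unfolding absolutely_integrable_on_def by simp
  have per: "periodic T (\<lambda>t. \<bar>H t\<bar>)"
    using pws_periodic[OF T sol] a(2) by (simp add: periodic_def H_def)
  have k: "\<bar>integral {0..T} (\<lambda>t. a t * g (u t))\<bar> \<le> A * (\<epsilon> * R)"
    using order_trans[OF integral_norm_bound_integral[OF reaction_integrable, of 0 T] reaction_integral_bound]
    by (simp add: A_def)
  have U: "(1 - s) * \<kappa> * integral {0..T} u \<le> lam * A * (\<epsilon> * R) + \<alpha> * T"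
  proof -
    have "lam * integral {0..T} (\<lambda>t. a t * g (u t)) \<le> lam * (A * (\<epsilon> * R))"
      using k lam by (intro mult_left_mono) auto
    moreover have "0 \<le> A * (\<epsilon> * R)" using k by linarith
    then have "0 \<le> lam * (A * (\<epsilon> * R)) + \<alpha> * T" using lam \<alpha> T by simp
    ultimately have "s * (lam * integral {0..T} (\<lambda>t. a t * g (u t)) + \<alpha> * T) \<le> 1 * (lam * (A * (\<epsilon> * R)) + \<alpha> * T)"
      using s by (intro order_trans[OF mult_left_mono mult_right_mono]) auto
    then show ?thesis using mean_identity by (simp add: mult.assoc)
  qed
  have "integral {0..T} (\<lambda>t. \<bar>H t\<bar>) \<le> integral {0..T} (\<lambda>t. (1 - s) * \<kappa> * u t + lam * \<bar>a t * g (u t)\<bar> + \<alpha>)"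
  proof (intro integral_le Hi integrable_add integrable_on_mult_right pws_solution_integrable reaction_integrable)
    fix t
    have "\<bar>- ((1 - s) * \<kappa>) * u t\<bar> = (1 - s) * \<kappa> * u t"
      using s \<kappa> u(1)[of t] by (simp add: abs_mult)
    moreover have "\<bar>s * lam * (a t * g (u t))\<bar> \<le> lam * \<bar>a t * g (u t)\<bar>"
    proof -
      have "s * lam \<le> lam" using s lam by simp
      then have "s * lam * \<bar>a t * g (u t)\<bar> \<le> lam * \<bar>a t * g (u t)\<bar>" by (rule mult_right_mono) simp
      moreover have "\<bar>s * lam * (a t * g (u t))\<bar> = s * lam * \<bar>a t * g (u t)\<bar>"
        using s lam by (simp add: abs_mult)
      ultimately show ?thesis by simp
    qed
    moreover have "\<bar>s * \<alpha>\<bar> \<le> \<alpha>" using s \<alpha> by (simp add: abs_mult mult_left_le_one_le)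
    ultimately show "\<bar>H t\<bar> \<le> (1 - s) * \<kappa> * u t + lam * \<bar>a t * g (u t)\<bar> + \<alpha>"
      unfolding H_eq by linarith
  qed auto
  also have "\<dots> = (1 - s) * \<kappa> * integral {0..T} u + lam * integral {0..T} (\<lambda>t. \<bar>a t * g (u t)\<bar>) + \<alpha> * T"
    using has_integral_const_real[of \<alpha> 0 T] T
    by (intro integral_unique has_integral_add has_integral_mult_right integrable_integral
        pws_solution_integrable reaction_integrable) (simp add: mult.commute)
  also have "\<dots> \<le> 2 * (lam * A * (\<epsilon> * R) + \<alpha> * T)"
  proof -
    have "lam * integral {0..T} (\<lambda>t. \<bar>a t * g (u t)\<bar>) \<le> lam * A * (\<epsilon> * R)"
      using mult_left_mono[OF reaction_integral_bound, of lam] lam by (simp add: A_def mult.assoc)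
    moreover have "x + y + w \<le> 2 * (v + w)" if "x \<le> v + w" "y \<le> v" for x y v w :: real
      using add_mono[OF add_mono[OF that] order_refl[of w]] by (simp add: algebra_simps)
    ultimately show ?thesis using U by blast
  qed
  finally have B: "integral {0..T} (\<lambda>t. \<bar>H t\<bar>) \<le> 2 * (lam * A * (\<epsilon> * R) + \<alpha> * T)" .
  have "z t1 = 0" using u by (intro pws_critical_max[OF T sol]) auto
  then have "\<bar>u t - u t1\<bar> \<le> T * exp (\<bar>c\<bar> * T) * (2 * (lam * A * (\<epsilon> * R) + \<alpha> * T))"
    using Hi B integral_periodic_window[OF T per Hi]
    by (intro pws_oscillation[OF T sol]) (simp_all add: H_def)
  then show ?thesis using u(3) by (simp add: A_def)
qed

text \<open>With g(u) within \<eta> g(R) of g(R), the integral of a g(u) is at most g(R) times a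
  negative number, whereas the mean identity makes it nonnegative.\<close>

lemma mean_contradiction:
  assumes "\<alpha> = 0" and gR: "g R > 0"
    and \<eta>: "\<And>t. \<bar>g (u t) - g R\<bar> \<le> \<eta> * g R" "\<eta> * integral {0..T} (\<lambda>t. \<bar>a t\<bar>) < - integral {0..T} a"
  shows False
proof -
  have "0 \<le> (1 - s) * \<kappa> * integral {0..T} u"
    using s \<kappa> u by (intro mult_nonneg_nonneg Henstock_Kurzweil_Integration.integral_nonneg pws_solution_integrable) auto
  then have ge: "0 \<le> integral {0..T} (\<lambda>t. a t * g (u t))"
    using mean_identity \<open>\<alpha> = 0\<close> s lam by (simp add: zero_le_mult_iff)
  have "integral {0..T} (\<lambda>t. a t * g (u t)) \<le> integral {0..T} (\<lambda>t. a t * g R + \<bar>a t\<bar> * (\<eta> * g R))"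
  proof (intro integral_le reaction_integrable integrable_add integrable_on_mult_left weight_integrable abs_weight_integrable)
    fix t
    have "a t * (g (u t) - g R) \<le> \<bar>a t\<bar> * \<bar>g (u t) - g R\<bar>"
      by (metis abs_ge_self abs_mult)
    also have "\<dots> \<le> \<bar>a t\<bar> * (\<eta> * g R)" by (intro mult_left_mono \<eta>) auto
    finally show "a t * g (u t) \<le> a t * g R + \<bar>a t\<bar> * (\<eta> * g R)" by (simp add: algebra_simps)
  qed
  also have "\<dots> = integral {0..T} a * g R + integral {0..T} (\<lambda>t. \<bar>a t\<bar>) * (\<eta> * g R)"
    by (intro integral_unique has_integral_add has_integral_mult_left integrable_integral
        weight_integrable abs_weight_integrable)
  also have "\<dots> = g R * (integral {0..T} a + \<eta> * integral {0..T} (\<lambda>t. \<bar>a t\<bar>))"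
    by (simp add: algebra_simps)
  also have "\<dots> < 0" using gR \<eta>(2) by (intro mult_pos_neg) auto
  finally show False using ge by simp
qed

end

text \<open>The parameter \<open>s\<close> is the homotopy parameter of the Leray--Schauder argument. The conclusion
  \<open>\<alpha> \<noteq> 0\<close> excludes unperturbed solutions with maximum \<open>R\<close>.\<close>

definition spread_out :: "real \<Rightarrow> real \<Rightarrow> bool" where
  "spread_out R K \<longleftrightarrow> (\<forall>s \<alpha> u z.
     0 < s \<and> s \<le> 1 \<and> 0 \<le> \<alpha> \<and> \<alpha> \<le> K \<and> (\<forall>t. 0 \<le> u t \<and> u t \<le> R) \<and> (\<exists>t1. u t1 = R) \<and>
     periodic_weak_solution T c (\<lambda>t. s * (\<kappa> * u t + lam * a t * g (u t) + \<alpha>) - \<kappa> * u t) u z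
     \<longrightarrow> (\<forall>t. R / 2 \<le> u t) \<and> \<alpha> \<noteq> 0)"

text \<open>Reaction and forcing each contribute at most \<delta>/4 R to the oscillation, so |u/R -
  1| \<le> \<delta>/2 < \<delta>, and \<open>ro\<close> applies with \<omega> = u(t)/R.\<close>

lemma spread_outI:
  assumes R: "R > 0" "g R > 0" and \<delta>: "0 < \<delta>" "\<delta> \<le> 1/2"
    and K: "T * exp (\<bar>c\<bar> * T) * 2 * T * K \<le> \<delta> / 4 * R"
    and \<epsilon>: "\<And>v. 0 \<le> v \<Longrightarrow> v \<le> R \<Longrightarrow> g v \<le> \<epsilon> * R"
      "T * exp (\<bar>c\<bar> * T) * 2 * lam * integral {0..T} (\<lambda>t. \<bar>a t\<bar>) * \<epsilon> \<le> \<delta> / 4"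
    and ro: "\<And>\<omega>. \<bar>\<omega> - 1\<bar> < \<delta> \<Longrightarrow> \<bar>g (\<omega> * R) - g R\<bar> \<le> \<eta> * g R"
    and \<eta>: "\<eta> * integral {0..T} (\<lambda>t. \<bar>a t\<bar>) < - integral {0..T} a"
  shows "spread_out R K"
  unfolding spread_out_def
proof (intro allI impI)
  fix s \<alpha> u z
  assume *: "0 < s \<and> s \<le> 1 \<and> 0 \<le> \<alpha> \<and> \<alpha> \<le> K \<and> (\<forall>t. 0 \<le> u t \<and> u t \<le> R) \<and> (\<exists>t1. u t1 = R) \<and>
     periodic_weak_solution T c (\<lambda>t. s * (\<kappa> * u t + lam * a t * g (u t) + \<alpha>) - \<kappa> * u t) u z"
  then obtain t1 where t1: "u t1 = R" by blast
  from * have sol: "periodic_weak_solution T c (\<lambda>t. s * (\<kappa> * u t + lam * a t * g (u t) + \<alpha>) - \<kappa> * u t) u z"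
    and s: "0 < s" "s \<le> 1" and \<alpha>: "0 \<le> \<alpha>" "\<alpha> \<le> K" and u: "\<And>t. 0 \<le> u t" "\<And>t. u t \<le> R" by auto
  define A where "A = integral {0..T} (\<lambda>t. \<bar>a t\<bar>)"
  have osc: "\<bar>u t - R\<bar> \<le> \<delta> / 2 * R" for t
  proof -
    have "\<bar>u t - R\<bar> \<le> T * exp (\<bar>c\<bar> * T) * (2 * (lam * A * (\<epsilon> * R) + \<alpha> * T))"
      unfolding A_def by (rule oscillation_bound[OF sol s \<alpha>(1) u t1 \<epsilon>(1)])
    also have "\<dots> = (T * exp (\<bar>c\<bar> * T) * 2 * lam * A * \<epsilon>) * R + T * exp (\<bar>c\<bar> * T) * 2 * T * \<alpha>"
      by (simp add: algebra_simps)
    also have "\<dots> \<le> \<delta> / 4 * R + T * exp (\<bar>c\<bar> * T) * 2 * T * K"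
      using \<epsilon>(2) \<alpha> T R by (intro add_mono mult_right_mono mult_left_mono) (auto simp: A_def)
    also have "\<dots> \<le> \<delta> / 2 * R" using K by linarith
    finally show ?thesis .
  qed
  have "R / 2 \<le> u t" for t
  proof -
    have "\<delta> / 2 * R \<le> 1/2 * R" using \<delta> R by (intro mult_right_mono) auto
    then show ?thesis using osc[of t] by linarith
  qed
  moreover have "\<alpha> \<noteq> 0"
  proof
    assume "\<alpha> = 0"
    have "\<bar>g (u t) - g R\<bar> \<le> \<eta> * g R" for t
    proof -
      have "\<bar>u t / R - 1\<bar> = \<bar>u t - R\<bar> / R" using R by (simp add: divide_diff_eq_iff)
      also have "\<dots> \<le> \<delta> / 2" using osc[of t] R by (simp add: pos_divide_le_eq)
      also have "\<dots> < \<delta>" using \<delta> by simp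
      finally show ?thesis using ro[of "u t / R"] R by simp
    qed
    then show False
      using mean_contradiction[OF sol s \<alpha>(1) u t1 \<epsilon>(1) \<open>\<alpha> = 0\<close> R(2) _ \<eta>] by blast
  qed
  ultimately show "(\<forall>t. R / 2 \<le> u t) \<and> \<alpha> \<noteq> 0" by blast
qed

lemma eventually_spread_out:
  assumes F: "eventually (\<lambda>R. R > 0) F" and gpos: "\<And>v. v > 0 \<Longrightarrow> g v > 0"
    and ro: "\<And>\<eta>. \<eta> > 0 \<Longrightarrow> \<exists>\<delta>>0. eventually (\<lambda>R. \<forall>\<omega>. \<bar>\<omega> - 1\<bar> < \<delta> \<longrightarrow> \<bar>g (\<omega> * R) - g R\<bar> \<le> \<eta> * g R) F"
    and small: "\<And>\<epsilon>. \<epsilon> > 0 \<Longrightarrow> eventually (\<lambda>R. \<forall>v. 0 \<le> v \<and> v \<le> R \<longrightarrow> g v \<le> \<epsilon> * R) F"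
    and K: "\<And>\<epsilon>. \<epsilon> > 0 \<Longrightarrow> eventually (\<lambda>R. K \<le> \<epsilon> * R) F"
  shows "eventually (\<lambda>R. spread_out R K) F"
proof -
  define A where "A = integral {0..T} (\<lambda>t. \<bar>a t\<bar>)"
  have A: "A \<ge> 0" unfolding A_def by (rule abs_weight_integral_nonneg)
  \<comment> \<open>The summand 1 makes \<eta> A strictly smaller than minus the integral of
    a.\<close>
  define \<eta> where "\<eta> = - integral {0..T} a / (A + 1)"
  have \<eta>: "\<eta> > 0" unfolding \<eta>_def using mean A by (intro divide_pos_pos) auto
  have "\<eta> * (A + 1) = - integral {0..T} a" using A by (simp add: \<eta>_def)
  then have \<eta>A: "\<eta> * A < - integral {0..T} a" using \<eta> by (simp add: algebra_simps)
  obtain \<delta>0 where \<delta>0: "\<delta>0 > 0"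
    "eventually (\<lambda>R. \<forall>\<omega>. \<bar>\<omega> - 1\<bar> < \<delta>0 \<longrightarrow> \<bar>g (\<omega> * R) - g R\<bar> \<le> \<eta> * g R) F"
    using ro[OF \<eta>] by blast
  define \<delta> where "\<delta> = min \<delta>0 (1/2)"
  have \<delta>: "0 < \<delta>" "\<delta> \<le> 1/2" "\<delta> \<le> \<delta>0" using \<delta>0 by (auto simp: \<delta>_def)
  \<comment> \<open>X is the factor of \<epsilon> R in the oscillation bound, and Y below is the
    factor of the forcing.\<close>
  define X where "X = T * exp (\<bar>c\<bar> * T) * 2 * lam * A"
  have X: "X \<ge> 0" unfolding X_def using T lam A by (intro mult_nonneg_nonneg) auto
  define \<epsilon> where "\<epsilon> = \<delta> / 4 / (X + 1)"
  have \<epsilon>: "\<epsilon> > 0" using \<delta> X by (simp add: \<epsilon>_def)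
  have "X + 1 \<noteq> 0" using X by linarith
  then have "\<epsilon> * (X + 1) = \<delta> / 4" using nonzero_divide_eq_eq unfolding \<epsilon>_def by metis
  then have \<epsilon>X: "X * \<epsilon> \<le> \<delta> / 4" using \<epsilon> by (simp add: algebra_simps)
  define Y where "Y = T * exp (\<bar>c\<bar> * T) * 2 * T"
  have Y: "Y > 0" unfolding Y_def using T by simp
  have \<epsilon>': "\<delta> / 4 / Y > 0" using \<delta> Y by simp
  show ?thesis
    using F \<delta>0(2) small[OF \<epsilon>] K[OF \<epsilon>']
  proof eventually_elim
    case (elim R)
    have "Y * K \<le> Y * (\<delta> / 4 / Y * R)" using elim Y by (intro mult_left_mono) auto
    then have YK: "Y * K \<le> \<delta> / 4 * R" using Y by simp
    show ?case
      by (rule spread_outI[of R \<delta> K \<epsilon> \<eta>])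
        (use elim gpos \<delta> YK \<epsilon>X \<eta>A in \<open>auto simp: A_def X_def Y_def\<close>)
  qed
qed

end

section \<open>Growth of the nonlinearity and positivity of the weight\<close>

text \<open>Neighbourhoods in the product filter contain rectangles, so a single \<delta> serves for
  all s. The filter \<open>at 1\<close> omits \<omega> = 1, where the bound is trivial.\<close>

lemma regularly_oscillatingD:
  assumes ro: "regularly_oscillating F h" and F: "eventually (\<lambda>s. s > 0) F" and \<eta>: "\<eta> > 0"
  shows "\<exists>\<delta>>0. eventually (\<lambda>s. \<forall>\<omega>. \<bar>\<omega> - 1\<bar> < \<delta> \<longrightarrow> \<bar>h (\<omega> * s) - h s\<bar> \<le> \<eta> * h s) F"
proof -
  have pos: "\<And>s. s > 0 \<Longrightarrow> h s > 0" and
    lim: "((\<lambda>(s, \<omega>). h (\<omega> * s) / h s) \<longlongrightarrow> 1) (F \<times>\<^sub>F at 1)"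
    using ro by (auto simp: regularly_oscillating_def)
  have "eventually (\<lambda>x. dist (case x of (s, \<omega>) \<Rightarrow> h (\<omega> * s) / h s) 1 < \<eta>) (F \<times>\<^sub>F at 1)"
    using tendstoD[OF lim \<eta>] .
  then obtain Pf Pg where Pf: "eventually Pf F" and Pg: "eventually Pg (at (1::real))"
    and P: "\<And>s \<omega>. Pf s \<Longrightarrow> Pg \<omega> \<Longrightarrow> dist (h (\<omega> * s) / h s) 1 < \<eta>"
    unfolding eventually_prod_filter by auto
  obtain \<delta> where \<delta>: "\<delta> > 0" "\<And>\<omega>. \<omega> \<noteq> 1 \<Longrightarrow> dist \<omega> 1 < \<delta> \<Longrightarrow> Pg \<omega>"
    using Pg unfolding eventually_at by auto
  have "eventually (\<lambda>s. \<forall>\<omega>. \<bar>\<omega> - 1\<bar> < \<delta> \<longrightarrow> \<bar>h (\<omega> * s) - h s\<bar> \<le> \<eta> * h s) F"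
    using Pf F
  proof eventually_elim
    case (elim s)
    have hs: "h s > 0" using pos elim by simp
    show ?case
    proof (intro allI impI)
      fix \<omega> :: real assume \<omega>: "\<bar>\<omega> - 1\<bar> < \<delta>"
      show "\<bar>h (\<omega> * s) - h s\<bar> \<le> \<eta> * h s"
      proof (cases "\<omega> = 1")
        case True
        then show ?thesis using hs \<eta> by simp
      next
        case False
        have "Pg \<omega>" using \<delta>(2)[OF False] \<omega> by (simp add: dist_real_def)
        then have "\<bar>h (\<omega> * s) / h s - 1\<bar> \<le> \<eta>" using P elim by (simp add: dist_real_def less_imp_le)
        then have "\<bar>h (\<omega> * s) / h s - 1\<bar> * h s \<le> \<eta> * h s" using hs by (intro mult_right_mono) auto
        moreover have "\<bar>h (\<omega> * s) / h s - 1\<bar> * h s = \<bar>(h (\<omega> * s) / h s - 1) * h s\<bar>"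
          using hs by (simp add: abs_mult)
        moreover have "(h (\<omega> * s) / h s - 1) * h s = h (\<omega> * s) - h s"
          using hs by (simp add: left_diff_distrib)
        ultimately show ?thesis by simp
      qed
    qed
  qed
  then show ?thesis using \<delta>(1) by blast
qed

lemma superlinear_at_zero_bound:
  fixes g :: "real \<Rightarrow> real"
  assumes lim: "((\<lambda>s. g s / s) \<longlongrightarrow> 0) (at_right 0)" and g0: "g 0 = 0" and \<epsilon>: "\<epsilon> > 0"
  obtains \<eta> where "\<eta> > 0" "\<And>v. 0 \<le> v \<Longrightarrow> v < \<eta> \<Longrightarrow> g v \<le> \<epsilon> * v"
proof -
  have "eventually (\<lambda>s. dist (g s / s) 0 < \<epsilon>) (at_right 0)" using tendstoD[OF lim \<epsilon>] .
  then obtain b where b: "b > 0" "\<And>s. 0 < s \<Longrightarrow> s < b \<Longrightarrow> \<bar>g s / s\<bar> < \<epsilon>"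
    unfolding eventually_at_right_field by auto
  have "g v \<le> \<epsilon> * v" if "0 \<le> v" "v < b" for v
  proof (cases "v = 0")
    case False
    then have "g v / v < \<epsilon>" using b(2)[of v] that by linarith
    then show ?thesis using that False by (simp add: pos_divide_less_eq)
  qed (simp add: g0)
  then show ?thesis using b(1) that by blast
qed

lemma sublinear_at_top_bound:
  fixes g :: "real \<Rightarrow> real"
  assumes lim: "((\<lambda>s. g s / s) \<longlongrightarrow> 0) at_top" and cont: "continuous_on {0..} g" and \<epsilon>: "\<epsilon> > 0"
  obtains G where "G \<ge> 0" "\<And>v. 0 \<le> v \<Longrightarrow> g v \<le> G + \<epsilon> * v"
proof -
  have "eventually (\<lambda>s. dist (g s / s) 0 < \<epsilon>) at_top" using tendstoD[OF lim \<epsilon>] .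
  then obtain N where N: "\<And>s. s \<ge> N \<Longrightarrow> \<bar>g s / s\<bar> < \<epsilon>"
    unfolding eventually_at_top_linorder by auto
  define N' where "N' = max N 1"
  have "compact (g ` {0..N'})"
    by (intro compact_continuous_image continuous_on_subset[OF cont]) auto
  then have "bounded (g ` {0..N'})" by (rule compact_imp_bounded)
  then obtain G where G: "\<And>v. v \<in> {0..N'} \<Longrightarrow> \<bar>g v\<bar> \<le> G"
    unfolding bounded_iff by fastforce
  have "0 \<in> {0..N'}" by (simp add: N'_def)
  then have "G \<ge> 0" using G[of 0] by linarith
  moreover have "g v \<le> G + \<epsilon> * v" if "0 \<le> v" for v
  proof (cases "v \<le> N'")
    case True
    then have "g v \<le> G" using G[of v] that by simp
    then show ?thesis using \<epsilon> that by (simp add: add_increasing2)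
  next
    case False
    then have "v > 0" "v \<ge> N" by (auto simp: N'_def)
    then have "g v / v < \<epsilon>" using N[of v] by linarith
    then show ?thesis using \<open>v > 0\<close> \<open>G \<ge> 0\<close> by (simp add: pos_divide_less_eq)
  qed
  ultimately show ?thesis using that by blast
qed

text \<open>The nonlinearity seen by \<open>y = x / \<parallel>x\<parallel>\<^sup>2\<close> when \<open>x\<close> solves the equation; the
  sublinearity of \<open>g\<close> at infinity gives continuity at \<open>n = 0\<close>, where the junk value
  \<open>v / 0 = 0\<close> is harmless because of the factor \<open>n\<^sup>2\<close>.\<close>

lemma continuous_inverted_nonlinearity:
  fixes g :: "real \<Rightarrow> real"
  assumes lim: "((\<lambda>s. g s / s) \<longlongrightarrow> 0) at_top" and cont: "continuous_on {0..} g"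
    and nonneg: "\<And>s. s \<ge> 0 \<Longrightarrow> g s \<ge> 0"
  shows "continuous_on UNIV (\<lambda>(n, v). n\<^sup>2 * g (max 0 v / n\<^sup>2))"
proof -
  have gc: "continuous_on UNIV (\<lambda>v. g (max 0 v))"
    by (rule continuous_on_compose2[OF cont]) (auto intro!: continuous_intros)
  let ?f = "\<lambda>x::real\<times>real. (fst x)\<^sup>2 * g (max 0 (snd x) / (fst x)\<^sup>2)"
  have "isCont ?f x" for x
  proof (cases "fst x = 0")
    case False
    have "open {x::real\<times>real. fst x \<noteq> 0}"
      by (intro open_Collect_neq continuous_intros)
    moreover have "continuous_on {x::real\<times>real. fst x \<noteq> 0} ?f"
      by (intro continuous_intros continuous_on_compose2[OF cont]) (auto intro!: continuous_intros)
    ultimately show ?thesis using False continuous_on_eq_continuous_at by blast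
  next
    case True
    have "\<exists>d>0. \<forall>x'. dist x' x < d \<longrightarrow> dist (?f x') (?f x) < e" if e: "e > 0" for e
    proof -
      define V where "V = \<bar>snd x\<bar> + 1"
      have V: "V > 0" by (simp add: V_def)
      \<comment> \<open>Near the given point the second variable stays below V, so after
        multiplication by n^2 the linear part is at most e/2 for every n; the constant part n^2 G is
        made small by the choice of d.\<close>
      obtain G where G: "G \<ge> 0" "\<And>v. 0 \<le> v \<Longrightarrow> g v \<le> G + e / (2 * V) * v"
        using sublinear_at_top_bound[OF lim cont, of "e / (2 * V)"] e V by auto
      define d where "d = min 1 (e / (2 * (G + 1)))"
      have d: "d > 0" using e G by (simp add: d_def)
      have "dist (?f x') (?f x) < e" if "dist x' x < d" for x'
      proof -
        obtain n v where x': "x' = (n, v)" by (cases x')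
        have "\<bar>n\<bar> \<le> dist x' x" using dist_fst_le[of x' x] True x' by (simp add: dist_real_def)
        then have n: "\<bar>n\<bar> < d" using that by simp
        have "\<bar>v - snd x\<bar> \<le> dist x' x" using dist_snd_le[of x' x] x' by (simp add: dist_real_def)
        then have "\<bar>v - snd x\<bar> < 1" using that by (simp add: d_def)
        then have v: "max 0 v \<le> V" by (simp add: V_def)
        show ?thesis
        proof (cases "n = 0")
          case True
          then show ?thesis using \<open>fst x = 0\<close> x' e by simp
        next
          case False
          then have n2: "n\<^sup>2 > 0" by simp
          have "n\<^sup>2 * g (max 0 v / n\<^sup>2) \<le> n\<^sup>2 * (G + e / (2 * V) * (max 0 v / n\<^sup>2))"
            using n2 by (intro mult_left_mono G(2)) auto
          also have "\<dots> = n\<^sup>2 * G + e / (2 * V) * max 0 v"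
            using n2 by (simp add: distrib_left)
          also have "e / (2 * V) * max 0 v \<le> e / (2 * V) * V"
            using v e V by (intro mult_left_mono) auto
          also have "e / (2 * V) * V = e / 2" using V by simp
          also have "n\<^sup>2 * G < e / 2"
          proof -
            have "\<bar>n\<bar> * \<bar>n\<bar> \<le> \<bar>n\<bar> * 1" using n by (intro mult_left_mono) (auto simp: d_def)
            then have "n\<^sup>2 \<le> \<bar>n\<bar>" by (simp add: power2_eq_square abs_mult[symmetric])
            then have "n\<^sup>2 * (G + 1) \<le> \<bar>n\<bar> * (G + 1)" using G by (intro mult_right_mono) auto
            also have "\<dots> < e / (2 * (G + 1)) * (G + 1)"
              using n G by (intro mult_strict_right_mono) (auto simp: d_def)
            also have "\<dots> = e / 2 / (G + 1) * (G + 1)" by (simp only: divide_divide_eq_left)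
            also have "\<dots> = e / 2" using G(1) by (intro iffD1[OF nonzero_eq_divide_eq]) auto
            finally show ?thesis using n2 unfolding distrib_left by linarith
          qed
          finally have "n\<^sup>2 * g (max 0 v / n\<^sup>2) < e" by simp
          moreover have "n\<^sup>2 * g (max 0 v / n\<^sup>2) \<ge> 0" using nonneg by simp
          ultimately show ?thesis using \<open>fst x = 0\<close> x' by (simp add: dist_real_def)
        qed
      qed
      then show ?thesis using d by blast
    qed
    then show ?thesis unfolding continuous_at_eps_delta by (metis)
  qed
  then have "continuous_on UNIV ?f" by (simp add: continuous_at_imp_continuous_on)
  then show ?thesis by (simp add: case_prod_unfold)
qed

text \<open>Creates the margins that the Harnack estimate needs on both sides of the inner interval.
  By continuity of the indefinite integral, each cut costs less than a quarter of the total.\<close>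

lemma integral_pos_shrink:
  fixes a :: "real \<Rightarrow> real"
  assumes int: "a integrable_on {\<sigma>..\<tau>}" and pos: "integral {\<sigma>..\<tau>} a > 0"
  obtains \<sigma>' \<tau>' where "\<sigma> < \<sigma>'" "\<sigma>' < \<tau>'" "\<tau>' < \<tau>" "integral {\<sigma>'..\<tau>'} a > 0"
proof -
  define I where "I = integral {\<sigma>..\<tau>} a"
  have lt: "\<sigma> < \<tau>"
  proof (rule ccontr)
    assume "\<not> \<sigma> < \<tau>"
    then have "{\<sigma>..\<tau>} = {} \<or> {\<sigma>..\<tau>} = {\<sigma>}" by auto
    then show False using pos by auto
  qed
  have c: "continuous_on {\<sigma>..\<tau>} (\<lambda>t. integral {\<sigma>..t} a)"
    by (rule indefinite_integral_continuous_1[OF int])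
  have I: "I / 4 > 0" using pos by (simp add: I_def)
  obtain d1 where d1: "d1 > 0" "\<And>t. t \<in> {\<sigma>..\<tau>} \<Longrightarrow> dist t \<sigma> < d1 \<Longrightarrow> dist (integral {\<sigma>..t} a) (integral {\<sigma>..\<sigma>} a) < I / 4"
    using c I lt unfolding continuous_on_iff by (metis atLeastAtMost_iff less_imp_le order_refl)
  obtain d2 where d2: "d2 > 0" "\<And>t. t \<in> {\<sigma>..\<tau>} \<Longrightarrow> dist t \<tau> < d2 \<Longrightarrow> dist (integral {\<sigma>..t} a) (integral {\<sigma>..\<tau>} a) < I / 4"
    using c I lt unfolding continuous_on_iff by (metis atLeastAtMost_iff less_imp_le order_refl)
  define d where "d = min (min d1 d2) (\<tau> - \<sigma>) / 3"
  have d: "d > 0" "d < d1" "d < d2" "3 * d \<le> \<tau> - \<sigma>" using d1 d2 lt by (auto simp: d_def)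
  show ?thesis
  proof
    show "\<sigma> < \<sigma> + d" "\<sigma> + d < \<tau> - d" "\<tau> - d < \<tau>" using d by auto
    have 1: "\<bar>integral {\<sigma>..\<sigma>+d} a\<bar> < I / 4" using d1(2)[of "\<sigma>+d"] d by (simp add: dist_real_def)
    have 2: "\<bar>integral {\<sigma>..\<tau>-d} a - I\<bar> < I / 4"
      using d2(2)[of "\<tau>-d"] d by (simp add: dist_real_def I_def)
    have "integral {\<sigma>..\<sigma>+d} a + integral {\<sigma>+d..\<tau>-d} a = integral {\<sigma>..\<tau>-d} a"
      using d integrable_on_subinterval[OF int, of \<sigma> "\<tau>-d"]
      by (intro Henstock_Kurzweil_Integration.integral_combine) auto
    then show "integral {\<sigma>+d..\<tau>-d} a > 0" using 1 2 I by linarith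
  qed
qed

text \<open>An interval of any kind and the compact interval between its bounds differ at most by
  the two end points, a null set.\<close>

lemma set_integral_interval_closure:
  fixes a :: "real \<Rightarrow> real"
  assumes I: "is_interval I" "I \<subseteq> {0..T}" and a: "locally_integrable a"
    and ae: "AE t in lebesgue. t \<in> I \<longrightarrow> a t \<ge> 0" and pos: "(LINT t:I|lebesgue. a t) > 0"
  obtains \<sigma> \<tau> where "{\<sigma>..\<tau>} \<subseteq> {0..T}" "AE t in lebesgue. t \<in> {\<sigma>..\<tau>} \<longrightarrow> a t \<ge> 0"
    "integral {\<sigma>..\<tau>} a > 0"
proof -
  have "I \<noteq> {}" using pos by (auto simp: set_lebesgue_integral_def)
  have bdd: "bdd_below I" "bdd_above I" using I(2) by (auto intro: bdd_below_mono bdd_above_mono)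
  define \<sigma> \<tau> where "\<sigma> = Inf I" and "\<tau> = Sup I"
  have sub: "I \<subseteq> {\<sigma>..\<tau>}" using bdd by (auto simp: \<sigma>_def \<tau>_def intro: cInf_lower cSup_upper)
  have sup: "{\<sigma><..<\<tau>} \<subseteq> I"
  proof
    fix t assume t: "t \<in> {\<sigma><..<\<tau>}"
    obtain x where "x \<in> I" "x < t" using t cInf_lessD[OF \<open>I \<noteq> {}\<close>] by (auto simp: \<sigma>_def)
    moreover obtain y where "y \<in> I" "t < y" using t less_cSupD[OF \<open>I \<noteq> {}\<close>] by (auto simp: \<tau>_def)
    ultimately show "t \<in> I" using I(1) unfolding is_interval_1 by (meson less_imp_le)
  qed
  have N: "negligible {\<sigma>, \<tau>}" by simp
  have diff: "{\<sigma>..\<tau>} - {\<sigma>, \<tau>} \<subseteq> I" using sup by force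
  have "I = {\<sigma><..<\<tau>} \<union> (I \<inter> {\<sigma>, \<tau>})" using sub sup by force
  moreover have "{\<sigma><..<\<tau>} \<union> (I \<inter> {\<sigma>, \<tau>}) \<in> sets borel"
    by (intro sets.Un borel_open borel_closed finite_imp_closed) auto
  ultimately have Imeas: "I \<in> sets lebesgue" by (metis sets_completionI_sets sets_lborel)
  have "a absolutely_integrable_on {\<sigma>..\<tau>}" using a by (rule locally_integrable_Icc)
  then have aI: "a absolutely_integrable_on I" using sub Imeas set_integrable_subset by blast
  have "integral {\<sigma>..\<tau>} a = integral I a"
    by (rule integral_spike_set; rule negligible_subset[OF N]) (use sub diff in auto)
  also have "\<dots> = (LINT t:I|lebesgue. a t)"
    using set_lebesgue_integral_eq_integral(2)[OF aI] by simp
  finally have "integral {\<sigma>..\<tau>} a > 0" using pos by simp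
  moreover have "AE t in lebesgue. t \<notin> {\<sigma>, \<tau>}"
    using N by (intro AE_not_in) (simp add: negligible_iff_null_sets)
  then have "AE t in lebesgue. t \<in> {\<sigma>..\<tau>} \<longrightarrow> a t \<ge> 0"
    using ae by eventually_elim (use diff in auto)
  moreover have "0 \<le> \<sigma>" "\<tau> \<le> T"
    using I(2) \<open>I \<noteq> {}\<close> unfolding \<sigma>_def \<tau>_def by (auto intro!: cInf_greatest cSup_least)
  ultimately show ?thesis using that[of \<sigma> \<tau>] by auto
qed

section \<open>Estimates on the interval of positivity\<close>

lemma continuous_on_apply_bcontfun_eval:
  "continuous_on A (\<lambda>y :: 'a::topological_space \<Rightarrow>\<^sub>C 'b::metric_space. apply_bcontfun y x)"
  unfolding continuous_on_iff by (meson dist_fun_lt_imp_dist_val_lt)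

lemma periodic_norm_attained:
  fixes y :: "real \<Rightarrow>\<^sub>C real"
  assumes T: "T > 0" and per: "periodic T y" and nonneg: "\<And>t. 0 \<le> apply_bcontfun y t"
  shows "\<exists>t. apply_bcontfun y t = norm y" "apply_bcontfun y t \<le> norm y"
proof -
  obtain t where t: "\<And>s. apply_bcontfun y s \<le> apply_bcontfun y t"
    using periodic_attains_max[OF T per] by auto
  have "norm y \<le> apply_bcontfun y t" by (rule norm_bcontfun_le) (use t nonneg in auto)
  then show "\<exists>t. apply_bcontfun y t = norm y" using abs_apply_bcontfun_le[of y t] by (intro exI[of _ t]) auto
  show "apply_bcontfun y t \<le> norm y" for t using abs_apply_bcontfun_le[of y t] by auto
qed

text \<open>Here \<sigma>' is the point t0 of the overview. By Harnack, the source integrated over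
  the inner window is at most a constant times u(\<sigma>'). Dropping the reaction bounds \<alpha>.
  Dropping \<alpha> instead bounds lam: when 1 \<le> u(\<sigma>') \<le> 2, u is confined to a fixed
  compact range where g \<ge> m. The second bound does not involve \<alpha>.\<close>

lemma pws_window_estimate:
  fixes T c lam \<alpha> \<sigma> \<sigma>' \<tau>' \<tau> d :: real and a g u z :: "real \<Rightarrow> real"
  assumes T: "T > 0" and lam: "lam > 0" and a: "locally_integrable a"
    and ae: "AE t in lebesgue. t \<in> {\<sigma>..\<tau>} \<longrightarrow> a t \<ge> 0"
    and ord: "\<sigma> < \<sigma>'" "\<sigma>' < \<tau>'" "\<tau>' < \<tau>" and len: "\<tau> - \<sigma> \<le> T"
    and d: "d > 0" "d \<le> \<sigma>' - \<sigma>" "d \<le> \<tau> - \<tau>'"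
    and g: "continuous_on UNIV g" "\<And>v. g v \<ge> 0" and \<alpha>: "\<alpha> \<ge> 0" and u: "\<And>t. u t \<ge> 0"
    and sol: "periodic_weak_solution T c (\<lambda>t. lam * a t * g (u t) + \<alpha>) u z"
  defines "C \<equiv> exp (\<bar>c\<bar> * T) / d"
  shows "\<alpha> * (\<tau>' - \<sigma>') \<le> 2 * (C + \<bar>c\<bar>) * exp (C * T) * u \<sigma>'"
    and "\<lbrakk>\<And>v. \<lbrakk>exp (- (C * T)) \<le> v; v \<le> 2 * exp (C * T)\<rbrakk> \<Longrightarrow> m \<le> g v; 1 \<le> u \<sigma>'; u \<sigma>' \<le> 2\<rbrakk>
      \<Longrightarrow> lam * (m * integral {\<sigma>'..\<tau>'} a) \<le> 2 * (2 * (C + \<bar>c\<bar>) * exp (C * T))"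
proof -
  have aint: "a absolutely_integrable_on {x..y}" for x y using a by (rule locally_integrable_Icc)
  have ai: "a integrable_on {x..y}" for x y
    using aint by (rule set_lebesgue_integral_eq_integral)
  have "continuous_on UNIV (\<lambda>t. g (u t))"
    by (rule continuous_on_compose2[OF g(1) pws_continuous[OF T sol]]) auto
  from absolutely_integrable_mult_continuous[OF aint this]
  have aui: "(\<lambda>t. a t * g (u t)) integrable_on {x..y}" for x y
    by (rule set_lebesgue_integral_eq_integral)
  have Hae: "AE t in lebesgue. t \<in> {\<sigma>..\<tau>} \<longrightarrow> lam * a t * g (u t) + \<alpha> \<ge> 0"
    using ae by (rule eventually_mono) (use lam g \<alpha> in auto)
  have ts: "\<sigma>' \<in> {\<sigma>'..\<tau>'}" using ord by simp
  note har = pws_harnack[OF T sol u ord Hae ts d len]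
  have "((\<lambda>t. lam * (a t * g (u t)) + \<alpha>) has_integral
      (lam * integral {\<sigma>'..\<tau>'} (\<lambda>t. a t * g (u t)) + \<alpha> * (\<tau>' - \<sigma>'))) {\<sigma>'..\<tau>'}"
    using has_integral_const_real[of \<alpha> \<sigma>' \<tau>'] ord
    by (intro has_integral_add has_integral_mult_right integrable_integral aui) (simp add: mult.commute)
  then have "integral {\<sigma>'..\<tau>'} (\<lambda>t. lam * a t * g (u t) + \<alpha>) =
      lam * integral {\<sigma>'..\<tau>'} (\<lambda>t. a t * g (u t)) + \<alpha> * (\<tau>' - \<sigma>')"
    by (intro integral_unique) (simp add: mult.assoc)
  then have bound: "lam * integral {\<sigma>'..\<tau>'} (\<lambda>t. a t * g (u t)) + \<alpha> * (\<tau>' - \<sigma>')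
      \<le> 2 * (C + \<bar>c\<bar>) * exp (C * T) * u \<sigma>'"
    using har(3) by (simp add: C_def)
  have "integral {\<sigma>'..\<tau>'} (\<lambda>t. a t * g (u t)) \<ge> 0"
    by (rule henstock_integral_nonneg_AE[OF aui], rule eventually_mono[OF ae]) (use ord g in auto)
  then have "lam * integral {\<sigma>'..\<tau>'} (\<lambda>t. a t * g (u t)) \<ge> 0" using lam by simp
  then show "\<alpha> * (\<tau>' - \<sigma>') \<le> 2 * (C + \<bar>c\<bar>) * exp (C * T) * u \<sigma>'" using bound by linarith
  show "lam * (m * integral {\<sigma>'..\<tau>'} a) \<le> 2 * (2 * (C + \<bar>c\<bar>) * exp (C * T))"
    if m: "\<And>v. \<lbrakk>exp (- (C * T)) \<le> v; v \<le> 2 * exp (C * T)\<rbrakk> \<Longrightarrow> m \<le> g v" and u12: "1 \<le> u \<sigma>'" "u \<sigma>' \<le> 2"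
  proof -
    have mg: "m \<le> g (u t)" if t: "t \<in> {\<sigma>'..\<tau>'}" for t
    proof (rule m)
      have "exp (- (C * T)) * 1 \<le> exp (- (C * T)) * u \<sigma>'" using u12 by (intro mult_left_mono) auto
      then show "exp (- (C * T)) \<le> u t" using har(2)[OF t] unfolding C_def by linarith
      have "exp (C * T) * u \<sigma>' \<le> exp (C * T) * 2" using u12 by (intro mult_left_mono) auto
      then show "u t \<le> 2 * exp (C * T)" using har(1)[OF t] unfolding C_def by linarith
    qed
    have "(\<lambda>t. a t * g (u t) - m * a t) integrable_on {\<sigma>'..\<tau>'}"
      by (intro integrable_diff aui integrable_on_mult_right ai)
    moreover have "AE t in lebesgue. t \<in> {\<sigma>'..\<tau>'} \<longrightarrow> a t * g (u t) - m * a t \<ge> 0"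
    proof (rule eventually_mono[OF ae], intro impI)
      fix t assume *: "t \<in> {\<sigma>..\<tau>} \<longrightarrow> a t \<ge> 0" and t: "t \<in> {\<sigma>'..\<tau>'}"
      then have "a t \<ge> 0" using ord by auto
      then have "a t * m \<le> a t * g (u t)" by (intro mult_left_mono mg t)
      then show "a t * g (u t) - m * a t \<ge> 0" by (simp add: mult.commute)
    qed
    ultimately have "integral {\<sigma>'..\<tau>'} (\<lambda>t. a t * g (u t) - m * a t) \<ge> 0"
      by (rule henstock_integral_nonneg_AE)
    also have "integral {\<sigma>'..\<tau>'} (\<lambda>t. a t * g (u t) - m * a t)
        = integral {\<sigma>'..\<tau>'} (\<lambda>t. a t * g (u t)) - m * integral {\<sigma>'..\<tau>'} a"
      by (intro integral_unique has_integral_diff has_integral_mult_right integrable_integral aui ai)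
    finally have "m * integral {\<sigma>'..\<tau>'} a \<le> integral {\<sigma>'..\<tau>'} (\<lambda>t. a t * g (u t))" by simp
    then have "lam * (m * integral {\<sigma>'..\<tau>'} a) \<le> lam * integral {\<sigma>'..\<tau>'} (\<lambda>t. a t * g (u t))"
      using lam by (intro mult_left_mono) auto
    also have "\<dots> \<le> 2 * (C + \<bar>c\<bar>) * exp (C * T) * u \<sigma>'"
    proof -
      have "0 \<le> \<alpha> * (\<tau>' - \<sigma>')" using \<alpha> ord by simp
      then show ?thesis using bound by linarith
    qed
    also have "\<dots> \<le> 2 * (C + \<bar>c\<bar>) * exp (C * T) * 2"
      using u12 d by (intro mult_left_mono) (auto simp: C_def)
    finally show ?thesis by simp
  qed
qed

text \<open>Since g(v) \<le> v for small v, the source is bounded by lam |a| u where u is small, and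
  a zero of u would spread to the whole line.\<close>

lemma pws_positive_solution:
  fixes g :: "real \<Rightarrow> real"
  assumes T: "T > 0" and lam: "lam > 0" and a: "locally_integrable a"
    and g: "continuous_on {0..} g" "\<And>s. s \<ge> 0 \<Longrightarrow> g s \<ge> 0" "g 0 = 0"
    and lim: "((\<lambda>s. g s / s) \<longlongrightarrow> 0) (at_right 0)"
    and sol: "periodic_weak_solution T c (\<lambda>t. lam * a t * g (max 0 (u t))) u z"
    and u: "\<And>t. u t \<ge> 0" "u t0 > 0"
  shows "positive_periodic_solution T c lam a g u"
proof -
  have aint: "a absolutely_integrable_on {x..y}" for x y using a by (rule locally_integrable_Icc)
  have "continuous_on UNIV (\<lambda>t. max 0 (u t))"
    by (intro continuous_intros pws_continuous[OF T sol])
  then have "continuous_on UNIV (\<lambda>t. g (max 0 (u t)))"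
    by (rule continuous_on_compose2[OF g(1)]) auto
  from set_integrable_mult_right[OF absolutely_integrable_mult_continuous[OF aint this], where a = lam]
  have Ha: "(\<lambda>t. lam * a t * g (max 0 (u t))) absolutely_integrable_on {x..y}" for x y
    by (simp add: mult.assoc)
  have Hi: "(\<lambda>t. \<bar>lam * a t * g (max 0 (u t))\<bar>) integrable_on {x..y}" for x y
    using Ha[of x y] unfolding absolutely_integrable_on_def by simp
  obtain \<eta> where \<eta>: "\<eta> > 0" "\<And>v. 0 \<le> v \<Longrightarrow> v < \<eta> \<Longrightarrow> g v \<le> 1 * v"
    using superlinear_at_zero_bound[OF lim g(3), of 1] by auto
  have b: "(\<lambda>t. lam * \<bar>a t\<bar>) integrable_on {x..y}" for x y
    using aint[of x y] unfolding absolutely_integrable_on_def by (auto intro: integrable_on_mult_right)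
  have small: "\<bar>lam * a t * g (max 0 (u t))\<bar> \<le> lam * \<bar>a t\<bar> * u t" if "u t \<le> \<eta> / 2" for t
  proof -
    have "g (u t) \<le> u t" using \<eta> that u(1)[of t] by (auto dest: \<eta>(2)[of "u t"])
    then have "lam * \<bar>a t\<bar> * g (u t) \<le> lam * \<bar>a t\<bar> * u t" using lam by (intro mult_left_mono) auto
    then show ?thesis using u(1)[of t] g(2)[of "u t"] lam by (simp add: abs_mult max_absorb2)
  qed
  have pos: "u t > 0" for t
  proof (rule ccontr)
    assume "\<not> u t > 0"
    then have "u t = 0" using u(1)[of t] by simp
    have "u t0 = 0"
      by (rule pws_zero_imp_trivial[where \<eta> = "\<eta> / 2", OF T sol u(1) _ Hi b _ small \<open>u t = 0\<close>])
        (use \<eta> lam in auto)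
    then show False using u(2) by simp
  qed
  have max: "max 0 (u t) = u t" for t by (rule max_absorb2) (rule u(1))
  have "caratheodory_solution c lam a g u"
    using pws_imp_caratheodory[OF T, of c lam a g u z] sol Ha by (simp add: max)
  then show ?thesis
    using pws_periodic[OF T sol] pos by (simp add: positive_periodic_solution_def)
qed

section \<open>Two solutions\<close>

theorem theorem1p1:
  fixes T c :: real and g a :: "real \<Rightarrow> real"
  assumes "T > 0"
    and "continuous_on {0..} g"
    and "\<And>s. s \<ge> 0 \<Longrightarrow> g s \<ge> 0"
    and "g 0 = 0"
    and "\<And>s. s > 0 \<Longrightarrow> g s > 0"
    and "regularly_oscillating (at_right 0) g"
    and "regularly_oscillating at_top g"
    and "((\<lambda>s. g s / s) \<longlongrightarrow> 0) (at_right 0)"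
    and "((\<lambda>s. g s / s) \<longlongrightarrow> 0) at_top"
    and "locally_integrable a"
    and "periodic T a"
    and "(LINT t:{0..T}|lebesgue. a t) < 0"
    and "\<exists>I. is_interval I \<and> I \<subseteq> {0..T} \<and>
           (AE t in lebesgue. t \<in> I \<longrightarrow> a t \<ge> 0) \<and> (LINT t:I|lebesgue. a t) > 0"
  shows "\<exists>lam0>0. \<forall>lam>lam0. \<exists>u v.
           positive_periodic_solution T c lam a g u \<and>
           positive_periodic_solution T c lam a g v \<and> u \<noteq> v"
proof -
  note T = assms(1) and g = assms(2-5) and a = assms(10,11)
  have aint: "a absolutely_integrable_on {x..y}" for x y using a(1) by (rule locally_integrable_Icc)
  have ai: "a integrable_on {x..y}" for x y
    using aint by (rule set_lebesgue_integral_eq_integral)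
  have mean: "integral {0..T} a < 0"
    using assms(12) set_lebesgue_integral_eq_integral(2)[OF aint[of 0 T]] by simp
  \<comment> \<open>g is continuous only on the closed half line; h extends it by 0 to all
    reals.\<close>
  define h where "h = (\<lambda>v. g (max 0 v))"
  have hc: "continuous_on UNIV h"
    unfolding h_def by (rule continuous_on_compose2[OF g(1)]) (auto intro!: continuous_intros)
  have h0: "h v \<ge> 0" for v unfolding h_def by (intro g(2)) simp
  have hpos: "h v > 0" if "v > 0" for v using g(4)[OF that] that by (simp add: h_def)
  have hneg: "h v = 0" if "v \<le> 0" for v using that g(3) by (simp add: h_def max_absorb1)
  obtain I where I: "is_interval I" "I \<subseteq> {0..T}"
    "AE t in lebesgue. t \<in> I \<longrightarrow> a t \<ge> 0" "(LINT t:I|lebesgue. a t) > 0"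
    using assms(13) by blast
  obtain \<sigma> \<tau> where \<sigma>\<tau>: "{\<sigma>..\<tau>} \<subseteq> {0..T}" and ae: "AE t in lebesgue. t \<in> {\<sigma>..\<tau>} \<longrightarrow> a t \<ge> 0"
    and pos: "integral {\<sigma>..\<tau>} a > 0"
    using set_integral_interval_closure[OF I(1,2) a(1) I(3,4)] by blast
  obtain \<sigma>' \<tau>' where ord: "\<sigma> < \<sigma>'" "\<sigma>' < \<tau>'" "\<tau>' < \<tau>" and Jpos: "integral {\<sigma>'..\<tau>'} a > 0"
    using integral_pos_shrink[OF ai pos] by blast
  have len: "\<tau> - \<sigma> \<le> T" using \<sigma>\<tau> ord by auto
  define d where "d = min (\<sigma>' - \<sigma>) (\<tau> - \<tau>')"
  have d: "d > 0" "d \<le> \<sigma>' - \<sigma>" "d \<le> \<tau> - \<tau>'" using ord by (auto simp: d_def)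
  define C where "C = exp (\<bar>c\<bar> * T) / d"
  define C2 where "C2 = 2 * (C + \<bar>c\<bar>) * exp (C * T)"
  have C: "C > 0" using d by (simp add: C_def)
  have C2: "C2 > 0" unfolding C2_def using C by (intro mult_pos_pos add_pos_nonneg) auto
  define C3 where "C3 = C2 / (\<tau>' - \<sigma>')"
  have C3: "C3 > 0" using C2 ord by (simp add: C3_def)
  have "exp (- (C * T)) \<le> 1" using C T by simp
  moreover have "1 \<le> exp (C * T)" using C T by simp
  ultimately have "exp (- (C * T)) \<in> {exp (- (C * T))..2 * exp (C * T)}"
    unfolding atLeastAtMost_iff by linarith
  \<comment> \<open>The minimum of h over the range to which Harnack confines u on the inner window
    when 1 \<le> u(\<sigma>') \<le> 2.\<close>
  then obtain v0 where v0: "v0 \<in> {exp (- (C * T))..2 * exp (C * T)}"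
      "\<And>v. v \<in> {exp (- (C * T))..2 * exp (C * T)} \<Longrightarrow> h v0 \<le> h v"
    using continuous_attains_inf[of "{exp (- (C * T))..2 * exp (C * T)}" h]
      continuous_on_subset[OF hc] by auto
  define m where "m = h v0"
  have "v0 > 0" using v0(1) exp_gt_zero[of "- (C * T)"] unfolding atLeastAtMost_iff by linarith
  then have m: "m > 0" unfolding m_def by (rule hpos)
  \<comment> \<open>The value at which the second window estimate, with bound 2 C2, starts to
    fail.\<close>
  define lam0 where "lam0 = 2 * C2 / (m * integral {\<sigma>'..\<tau>'} a)"
  have lam0: "lam0 > 0" using C2 m Jpos by (simp add: lam0_def)
  \<comment> \<open>The choice p = 1 + |c| makes both p and q = p + c at least 1.\<close>
  define p q \<kappa> where "p = 1 + \<bar>c\<bar>" and "q = p + c" and "\<kappa> = p * q"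
  have p: "p > 0" and q: "q > 0" by (auto simp: p_def q_def)
  then have \<kappa>: "\<kappa> > 0" by (simp add: \<kappa>_def)
  have qp: "q - p = c" by (simp add: q_def)
  have ro: "\<exists>\<delta>>0. eventually (\<lambda>R. \<forall>\<omega>. \<bar>\<omega> - 1\<bar> < \<delta> \<longrightarrow> \<bar>h (\<omega> * R) - h R\<bar> \<le> \<eta> * h R) F"
    if F: "regularly_oscillating F g" "eventually (\<lambda>R. R > 0) F" and \<eta>: "\<eta> > 0" for F \<eta>
  proof -
    obtain \<delta> where \<delta>: "\<delta> > 0"
      and ev: "eventually (\<lambda>R. \<forall>\<omega>. \<bar>\<omega> - 1\<bar> < \<delta> \<longrightarrow> \<bar>g (\<omega> * R) - g R\<bar> \<le> \<eta> * g R) F"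
      using regularly_oscillatingD[OF F \<eta>] by blast
    \<comment> \<open>The bound 1 on the distance from 1 keeps \<omega> R positive, where h agrees
      with g.\<close>
    have "eventually (\<lambda>R. \<forall>\<omega>. \<bar>\<omega> - 1\<bar> < min \<delta> 1 \<longrightarrow> \<bar>h (\<omega> * R) - h R\<bar> \<le> \<eta> * h R) F"
      using ev F(2)
    proof eventually_elim
      case (elim R)
      show ?case
      proof (intro allI impI)
        fix \<omega> :: real assume \<omega>: "\<bar>\<omega> - 1\<bar> < min \<delta> 1"
        then have "\<omega> * R > 0" using elim by (intro mult_pos_pos) auto
        then have "h (\<omega> * R) = g (\<omega> * R)" "h R = g R"
          using elim unfolding h_def by (simp_all only: max_absorb2 less_imp_le)
        then show "\<bar>h (\<omega> * R) - h R\<bar> \<le> \<eta> * h R" using elim \<omega> by simp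
      qed
    qed
    then show ?thesis using \<delta> by (intro exI[of _ "min \<delta> 1"]) auto
  qed
  have "\<exists>u v. positive_periodic_solution T c lam a g u \<and>
           positive_periodic_solution T c lam a g v \<and> u \<noteq> v" if lam_gt: "lam > lam0" for lam
  proof -
    have lam: "lam > 0" using lam_gt lam0 by simp
    let ?S = "spread_out T c lam \<kappa> a h"
    have at_top_pos: "eventually (\<lambda>R::real. R > 0) at_top" by (rule eventually_gt_at_top)
    have at_zero_pos: "eventually (\<lambda>R::real. R > 0) (at_right 0)"
      by (rule eventually_at_right_less)
    have S_top: "eventually (\<lambda>R. ?S R K) at_top" for K
    proof (rule eventually_spread_out[OF T \<kappa> lam a mean hc h0 at_top_pos hpos])
      show "\<exists>\<delta>>0. eventually (\<lambda>R. \<forall>\<omega>. \<bar>\<omega> - 1\<bar> < \<delta> \<longrightarrow> \<bar>h (\<omega> * R) - h R\<bar> \<le> \<eta> * h R) at_top"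
        if "\<eta> > 0" for \<eta> by (rule ro[OF assms(7) at_top_pos that])
      show "eventually (\<lambda>R. \<forall>v. 0 \<le> v \<and> v \<le> R \<longrightarrow> h v \<le> \<epsilon> * R) at_top" if \<epsilon>: "\<epsilon> > 0" for \<epsilon>
      proof -
        obtain G where G: "G \<ge> 0" "\<And>v. 0 \<le> v \<Longrightarrow> g v \<le> G + \<epsilon> / 2 * v"
          using sublinear_at_top_bound[OF assms(9) g(1), of "\<epsilon> / 2"] \<epsilon> by auto
        show ?thesis
          using eventually_ge_at_top[of "2 * G / \<epsilon>"]
        proof eventually_elim
          case (elim R)
          then have "G \<le> \<epsilon> / 2 * R" using \<epsilon> by (simp add: pos_divide_le_eq mult.commute)
          show ?case
          proof (intro allI impI)
            fix v assume v: "0 \<le> v \<and> v \<le> R"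
            then have "\<epsilon> / 2 * v \<le> \<epsilon> / 2 * R" using \<epsilon> by (intro mult_left_mono) auto
            then have "g v \<le> \<epsilon> * R" using G(2)[of v] v \<open>G \<le> \<epsilon> / 2 * R\<close> by linarith
            then show "h v \<le> \<epsilon> * R" using v by (simp add: h_def max_absorb2)
          qed
        qed
      qed
      show "eventually (\<lambda>R. K \<le> \<epsilon> * R) at_top" if "\<epsilon> > 0" for \<epsilon>
        by (rule eventually_mono[OF eventually_ge_at_top[of "K / \<epsilon>"]])
          (use that in \<open>simp add: pos_divide_le_eq mult.commute\<close>)
    qed
    have S_zero: "eventually (\<lambda>R. ?S R 0) (at_right 0)"
    proof (rule eventually_spread_out[OF T \<kappa> lam a mean hc h0 at_zero_pos hpos])
      show "\<exists>\<delta>>0. eventually (\<lambda>R. \<forall>\<omega>. \<bar>\<omega> - 1\<bar> < \<delta> \<longrightarrow> \<bar>h (\<omega> * R) - h R\<bar> \<le> \<eta> * h R) (at_right 0)"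
        if "\<eta> > 0" for \<eta> by (rule ro[OF assms(6) at_zero_pos that])
      show "eventually (\<lambda>R. \<forall>v. 0 \<le> v \<and> v \<le> R \<longrightarrow> h v \<le> \<epsilon> * R) (at_right 0)" if \<epsilon>: "\<epsilon> > 0" for \<epsilon>
      proof -
        obtain b where b: "b > 0" "\<And>v. 0 \<le> v \<Longrightarrow> v < b \<Longrightarrow> g v \<le> \<epsilon> * v"
          using superlinear_at_zero_bound[OF assms(8) g(3) \<epsilon>] by blast
        have "eventually (\<lambda>R. R < b) (at_right 0)"
          using b(1) eventually_at_right_field by blast
        then show ?thesis
        proof eventually_elim
          case (elim R)
          show ?case
          proof (intro allI impI)
            fix v assume v: "0 \<le> v \<and> v \<le> R"
            then have "\<epsilon> * v \<le> \<epsilon> * R" using \<epsilon> by (intro mult_left_mono) auto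
            then have "g v \<le> \<epsilon> * R" using b(2)[of v] v elim by linarith
            then show "h v \<le> \<epsilon> * R" using v by (simp add: h_def max_absorb2)
          qed
        qed
      qed
      show "eventually (\<lambda>R::real. 0 \<le> \<epsilon> * R) (at_right 0)" if "\<epsilon> > 0" for \<epsilon>
        by (rule eventually_mono[OF at_zero_pos]) (use that in simp)
    qed
    have S_D: "(\<forall>t. R / 2 \<le> u t) \<and> \<alpha> \<noteq> 0"
      if "?S R K" "0 < s" "s \<le> 1" "0 \<le> \<alpha>" "\<alpha> \<le> K" "\<And>t. 0 \<le> u t" "\<And>t. u t \<le> R" "\<exists>t. u t = R"
        "periodic_weak_solution T c (\<lambda>t. s * (\<kappa> * u t + lam * a t * h (u t) + \<alpha>) - \<kappa> * u t) u z"
      for R K s \<alpha> u z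
      using that unfolding spread_out_def[OF T \<kappa> lam a mean hc h0] by blast
    \<comment> \<open>The regions u(\<sigma>') < 1 and u(\<sigma>') > 2 are separated for every
      constant forcing \<alpha> \<ge> 0 at once, so the value of \<alpha> need not be known in
      advance.\<close>
    have window: "\<alpha> \<le> C3 * u \<sigma>' \<and> \<not> (1 \<le> u \<sigma>' \<and> u \<sigma>' \<le> 2)"
      if "\<alpha> \<ge> 0" "\<And>t. u t \<ge> 0" "periodic_weak_solution T c (\<lambda>t. lam * a t * h (u t) + \<alpha>) u z" for \<alpha> u z
    proof -
      note W = pws_window_estimate[OF T lam a(1) ae ord len d hc h0 that, folded C_def, folded C2_def]
      have "\<alpha> \<le> C3 * u \<sigma>'"
        using W(1) ord by (simp add: C3_def pos_le_divide_eq)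
      moreover have "\<not> (1 \<le> u \<sigma>' \<and> u \<sigma>' \<le> 2)"
      proof
        assume "1 \<le> u \<sigma>' \<and> u \<sigma>' \<le> 2"
        then have "lam * (m * integral {\<sigma>'..\<tau>'} a) \<le> 2 * C2"
          using v0(2) by (intro W(2)) (auto simp: m_def)
        then have "lam \<le> lam0" using m Jpos by (simp add: lam0_def pos_le_divide_eq)
        then show False using lam_gt by simp
      qed
      ultimately show ?thesis by blast
    qed
    have positive: "positive_periodic_solution T c lam a g u"
      if "periodic_weak_solution T c (\<lambda>t. lam * a t * h (u t)) u z" "\<And>t. u t \<ge> 0" "u t0 > 0" for u z t0
      by (rule pws_positive_solution[OF T lam a(1) g(1-3) assms(8) that[unfolded h_def]])

    have "\<exists>u. positive_periodic_solution T c lam a g u \<and> u \<sigma>' > 2"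
    proof -
      \<comment> \<open>M exceeds C3: u(\<sigma>') < 1 would give \<alpha> = M (2 - u(\<sigma>'))
        \<ge> M, against \<alpha> \<le> C3 u(\<sigma>') \<le> C3.\<close>
      define M where "M = C3 + 1"
      have M: "M > 0" using C3 by (simp add: M_def)
      \<comment> \<open>2 M bounds the forcing at nonnegative functions. A homotopy solution with
        maximum R > 4 would satisfy u(\<sigma>') \<ge> R/2 > 2 and thus have zero forcing, which
        \<open>spread_out\<close> denies.\<close>
      have "eventually (\<lambda>R. ?S R (2 * M) \<and> R > 4) at_top"
        by (intro eventually_conj S_top eventually_gt_at_top)
      from eventually_happens'[OF trivial_limit_at_top_linorder this]
      obtain R where R: "?S R (2 * M)" "R > 4" by blast
      define \<beta> where "\<beta> = (\<lambda>y::real \<Rightarrow>\<^sub>C real. M * max 0 (2 - apply_bcontfun y \<sigma>'))"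
      have \<beta>c: "continuous_on UNIV \<beta>"
        unfolding \<beta>_def by (intro continuous_intros continuous_on_apply_bcontfun_eval)
      have \<beta>0: "\<beta> y \<ge> 0" for y using M by (simp add: \<beta>_def)
      have \<beta>2: "\<beta> y \<le> 2 * M" if "apply_bcontfun y \<sigma>' \<ge> 0" for y
        using M that by (simp add: \<beta>_def max_def)
      have \<beta>R: "\<bar>\<beta> y\<bar> \<le> M * (2 + R)" if "norm y \<le> R" for y
      proof -
        have "max 0 (2 - apply_bcontfun y \<sigma>') \<le> 2 + R"
          using abs_apply_bcontfun_le[of y \<sigma>'] that R(2) by (simp add: abs_le_iff)
        then have "\<beta> y \<le> M * (2 + R)" unfolding \<beta>_def using M by (intro mult_left_mono) auto
        then show ?thesis using \<beta>0[of y] by simp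
      qed
      have R0: "R > 0" using R(2) by simp
      have hcc: "continuous_on UNIV (\<lambda>(n::real, v). h v)"
        unfolding case_prod_unfold by (rule continuous_on_compose2[OF hc]) (auto intro: continuous_intros)
      have "\<exists>(y :: real \<Rightarrow>\<^sub>C real) z. norm y \<le> R \<and> periodic_weak_solution T (q - p)
          (\<lambda>t. p * q * max 0 (apply_bcontfun y t) + lam * a t * h (apply_bcontfun y t) + \<beta> y - p * q * apply_bcontfun y t) (apply_bcontfun y) z"
      proof (rule Leray_Schauder_periodic[where \<gamma> = "\<lambda>n v. h v", OF T p q R0 a hcc \<beta>c \<beta>R])
        fix y :: "real \<Rightarrow>\<^sub>C real" and z s
        assume s: "0 < s" "s < (1::real)" and yR: "norm y = R"
        show "\<not> periodic_weak_solution T (q - p) (\<lambda>t. s * (p * q * max 0 (apply_bcontfun y t)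
            + lam * a t * h (apply_bcontfun y t) + \<beta> y) - p * q * apply_bcontfun y t) (apply_bcontfun y) z"
        proof
          assume sol: "periodic_weak_solution T (q - p) (\<lambda>t. s * (p * q * max 0 (apply_bcontfun y t)
            + lam * a t * h (apply_bcontfun y t) + \<beta> y) - p * q * apply_bcontfun y t) (apply_bcontfun y) z"
          then have sol': "periodic_weak_solution T c (\<lambda>t. s * (\<kappa> * max 0 (apply_bcontfun y t)
            + lam * a t * h (apply_bcontfun y t) + \<beta> y) - \<kappa> * apply_bcontfun y t) (apply_bcontfun y) z"
            unfolding qp \<kappa>_def .
          have y0: "apply_bcontfun y t \<ge> 0" for t
            by (rule pws_truncated_nonneg[OF T \<kappa> _ \<beta>0 hneg sol']) (use s in auto)
          note att = periodic_norm_attained[OF T pws_periodic[OF T sol'] y0]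
          have sol'': "periodic_weak_solution T c (\<lambda>t. s * (\<kappa> * apply_bcontfun y t
            + lam * a t * h (apply_bcontfun y t) + \<beta> y) - \<kappa> * apply_bcontfun y t) (apply_bcontfun y) z"
            using sol' y0 by (simp add: max_absorb2)
          have "(\<forall>t. R / 2 \<le> apply_bcontfun y t) \<and> \<beta> y \<noteq> 0"
            by (rule S_D[OF R(1) _ _ \<beta>0 \<beta>2[OF y0] y0 _ _ sol'']) (use s att yR in auto)
          then have "apply_bcontfun y \<sigma>' \<ge> R / 2" "\<beta> y \<noteq> 0" by auto
          then show False using R(2) by (simp add: \<beta>_def)
        qed
      qed
      then obtain y z where "periodic_weak_solution T (q - p)
          (\<lambda>t. p * q * max 0 (apply_bcontfun y t) + lam * a t * h (apply_bcontfun y t) + \<beta> y - p * q * apply_bcontfun y t) (apply_bcontfun y) z"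
        by blast
      then have sol: "periodic_weak_solution T c
          (\<lambda>t. 1 * (\<kappa> * max 0 (apply_bcontfun y t) + lam * a t * h (apply_bcontfun y t) + \<beta> y) - \<kappa> * apply_bcontfun y t) (apply_bcontfun y) z"
        unfolding qp \<kappa>_def by simp
      have y0: "apply_bcontfun y t \<ge> 0" for t
        by (rule pws_truncated_nonneg[OF T \<kappa> _ \<beta>0 hneg sol]) auto
      have sol2: "periodic_weak_solution T c (\<lambda>t. lam * a t * h (apply_bcontfun y t) + \<beta> y) (apply_bcontfun y) z"
        using sol y0 by (simp add: max_absorb2)
      note W = window[OF \<beta>0 y0 sol2]
      have big: "apply_bcontfun y \<sigma>' > 2"
      proof (rule ccontr)
        assume "\<not> apply_bcontfun y \<sigma>' > 2"
        then have lt: "apply_bcontfun y \<sigma>' < 1" using W by linarith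
        then have "M * 1 \<le> \<beta> y" unfolding \<beta>_def using M by (intro mult_left_mono) auto
        moreover have "C3 * apply_bcontfun y \<sigma>' \<le> C3 * 1" using lt C3 by (intro mult_left_mono) auto
        ultimately show False using W by (simp add: M_def)
      qed
      then have "\<beta> y = 0" by (simp add: \<beta>_def)
      then have "periodic_weak_solution T c (\<lambda>t. lam * a t * h (apply_bcontfun y t)) (apply_bcontfun y) z"
        using sol2 by simp
      then have "positive_periodic_solution T c lam a g (apply_bcontfun y)"
        by (rule positive[OF _ y0, of _ _ \<sigma>']) (use big in simp)
      then show ?thesis using big by blast
    qed
    moreover
    have "\<exists>u. positive_periodic_solution T c lam a g u \<and> u \<sigma>' < 1"
    proof -
      \<comment> \<open>Here M > 2 C3: if x(\<sigma>') > 2, then x(\<sigma>') - 1 > x(\<sigma>')/2,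
        so the forcing would be at least M/2 x(\<sigma>'), more than the C3 x(\<sigma>') that the
        window estimate allows.\<close>
      define M where "M = 2 * C3 + 1"
      have M: "M > 0" using C3 by (simp add: M_def)
      obtain D0 where D0: "\<And>R. R \<ge> D0 \<Longrightarrow> ?S R C3"
        using S_top[of C3] unfolding eventually_at_top_linorder by blast
      \<comment> \<open>The lower bound 2 serves the a priori estimate: if the maximum 1/n of x is
        at least D, \<open>spread_out\<close> yields x \<ge> (1/n)/2 \<ge> 1 everywhere, against
        x(\<sigma>') < 1.\<close>
      define D where "D = max D0 2"
      have D: "D \<ge> 2" "\<And>R. R \<ge> D \<Longrightarrow> ?S R C3" using D0 by (auto simp: D_def)
      have "eventually (\<lambda>R::real. R < 1) (at_right 0)"
        using eventually_at_right_field[of "\<lambda>R::real. R < 1" 0] zero_less_one by blast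
      then have "eventually (\<lambda>R. ?S R 0 \<and> 0 < R \<and> R < 1) (at_right 0)"
        by (intro eventually_conj S_zero at_zero_pos)
      from eventually_happens'[OF trivial_limit_at_right_real this]
      obtain r where r: "?S r 0" "0 < r" "r < 1" by blast
      have r0: "1 / r > 0" using r(2) by simp
      define \<gamma> where "\<gamma> = (\<lambda>n v. n\<^sup>2 * g (max 0 v / n\<^sup>2))"
      have \<gamma>c: "continuous_on UNIV (\<lambda>(n, v). \<gamma> n v)"
        unfolding \<gamma>_def by (rule continuous_inverted_nonlinearity[OF assms(9) g(1,2)])
      have \<gamma>neg: "\<gamma> n v = 0" if "v \<le> 0" for n v using that g(3) by (simp add: \<gamma>_def max_absorb1)
      have \<gamma>h: "\<gamma> n v = n\<^sup>2 * h (v / n\<^sup>2)" if "v \<ge> 0" for n v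
        using that by (simp add: \<gamma>_def h_def max_absorb2)
      \<comment> \<open>For x = y / (norm y)^2 one has norm x = 1 / norm y, so \<beta> y / (norm
        y)^2 is M times the positive part of x(\<sigma>') - 1, plus the squared positive part of
        norm x - D.\<close>
      define \<beta> where "\<beta> = (\<lambda>y::real \<Rightarrow>\<^sub>C real. M * max 0 (apply_bcontfun y \<sigma>' - (norm y)\<^sup>2)
        + (max 0 (1 - D * norm y))\<^sup>2)"
      have \<beta>c: "continuous_on UNIV \<beta>"
        unfolding \<beta>_def by (intro continuous_intros continuous_on_apply_bcontfun_eval)
      have \<beta>0: "\<beta> y \<ge> 0" for y using M by (simp add: \<beta>_def)
      have \<beta>R: "\<bar>\<beta> y\<bar> \<le> M * (1 / r) + 1" if "norm y \<le> 1 / r" for y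
      proof -
        have "apply_bcontfun y \<sigma>' - (norm y)\<^sup>2 \<le> 1 / r"
          using abs_apply_bcontfun_le[of y \<sigma>'] that zero_le_power2[of "norm y"] by linarith
        then have "max 0 (apply_bcontfun y \<sigma>' - (norm y)\<^sup>2) \<le> 1 / r" using r(2) by simp
        then have "M * max 0 (apply_bcontfun y \<sigma>' - (norm y)\<^sup>2) \<le> M * (1 / r)"
          using M by (intro mult_left_mono) auto
        moreover have "max 0 (1 - D * norm y) \<le> 1" using D(1) by simp
        then have "(max 0 (1 - D * norm y))\<^sup>2 \<le> 1" by (intro power_le_one) auto
        ultimately have "\<beta> y \<le> M * (1 / r) + 1" by (simp add: \<beta>_def)
        then show ?thesis using \<beta>0[of y] by simp
      qed
      \<comment> \<open>Division by n^2 turns \<gamma> n (y t) into h (y t / n^2), so the inverted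
        function solves the original equation with forcing b / n^2.\<close>
      have rescale: "periodic_weak_solution T c (\<lambda>t. s * (\<kappa> * (y t / n\<^sup>2) + lam * a t * h (y t / n\<^sup>2) + b / n\<^sup>2) - \<kappa> * (y t / n\<^sup>2))
          (\<lambda>t. y t / n\<^sup>2) (\<lambda>t. z t / n\<^sup>2)"
        if sol: "periodic_weak_solution T c (\<lambda>t. s * (\<kappa> * max 0 (y t) + lam * a t * \<gamma> n (y t) + b) - \<kappa> * y t) y z"
          and y0: "\<And>t. y t \<ge> 0" and n: "n \<noteq> 0" for s n b :: real and y z
      proof -
        have "(1 / n\<^sup>2) * (s * (\<kappa> * max 0 (y t) + lam * a t * \<gamma> n (y t) + b) - \<kappa> * y t)
          = s * (\<kappa> * (y t / n\<^sup>2) + lam * a t * h (y t / n\<^sup>2) + b / n\<^sup>2) - \<kappa> * (y t / n\<^sup>2)" for t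
        proof -
          have "(1 / N) * (s * (\<kappa> * Y + L * (N * W) + b) - \<kappa> * Y) = s * (\<kappa> * (Y / N) + L * W + b / N) - \<kappa> * (Y / N)"
            if "N \<noteq> 0" for N Y L W :: real
            using that by (simp add: field_simps)
          from this[of "n\<^sup>2" "y t" "lam * a t" "h (y t / n\<^sup>2)"] n
          show ?thesis by (simp only: \<gamma>h[OF y0] max_absorb2[OF y0]) simp
        qed
        then show ?thesis using pws_scale[OF sol, of "1 / n\<^sup>2"] by simp
      qed
      have "\<exists>(y :: real \<Rightarrow>\<^sub>C real) z. norm y \<le> 1 / r \<and> periodic_weak_solution T (q - p)
          (\<lambda>t. p * q * max 0 (apply_bcontfun y t) + lam * a t * \<gamma> (norm y) (apply_bcontfun y t) + \<beta> y - p * q * apply_bcontfun y t) (apply_bcontfun y) z"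
      proof (rule Leray_Schauder_periodic[OF T p q r0 a \<gamma>c \<beta>c \<beta>R])
        fix y :: "real \<Rightarrow>\<^sub>C real" and z s
        assume s: "0 < s" "s < (1::real)" and yR: "norm y = 1 / r"
        show "\<not> periodic_weak_solution T (q - p) (\<lambda>t. s * (p * q * max 0 (apply_bcontfun y t)
            + lam * a t * \<gamma> (norm y) (apply_bcontfun y t) + \<beta> y) - p * q * apply_bcontfun y t) (apply_bcontfun y) z"
        proof
          assume "periodic_weak_solution T (q - p) (\<lambda>t. s * (p * q * max 0 (apply_bcontfun y t)
            + lam * a t * \<gamma> (norm y) (apply_bcontfun y t) + \<beta> y) - p * q * apply_bcontfun y t) (apply_bcontfun y) z"
          then have sol: "periodic_weak_solution T c (\<lambda>t. s * (\<kappa> * max 0 (apply_bcontfun y t)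
            + lam * a t * \<gamma> (norm y) (apply_bcontfun y t) + \<beta> y) - \<kappa> * apply_bcontfun y t) (apply_bcontfun y) z"
            unfolding qp \<kappa>_def .
          have y0: "apply_bcontfun y t \<ge> 0" for t
            by (rule pws_truncated_nonneg[OF T \<kappa> _ \<beta>0 \<gamma>neg sol]) (use s in auto)
          note att = periodic_norm_attained[OF T pws_periodic[OF T sol] y0]
          \<comment> \<open>On the sphere norm y = 1/r both parts of the forcing vanish, since r < 1
            and D \<ge> 2. Then x has maximum r and no forcing, which \<open>spread_out\<close> at r
            excludes.\<close>
          have "1 / r * 1 \<le> 1 / r * (1 / r)" using r by (intro mult_left_mono) auto
          then have "apply_bcontfun y \<sigma>' \<le> (norm y)\<^sup>2"
            using att(2)[of \<sigma>'] yR by (simp add: power2_eq_square)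
          moreover have "1 \<le> D * norm y"
          proof -
            have "1 * 1 \<le> D * (1 / r)" using D(1) r by (intro mult_mono) auto
            then show ?thesis using yR by simp
          qed
          ultimately have "\<beta> y = 0" by (simp add: \<beta>_def)
          note x = rescale[OF sol y0, unfolded \<open>\<beta> y = 0\<close>]
          have inv: "apply_bcontfun y t / (norm y)\<^sup>2 \<le> r" for t
          proof -
            have "apply_bcontfun y t / (norm y)\<^sup>2 \<le> norm y / (norm y)\<^sup>2"
              using att(2)[of t] by (intro divide_right_mono) auto
            also have "\<dots> = r" using yR r by (simp add: power2_eq_square)
            finally show ?thesis .
          qed
          have att': "\<exists>t. apply_bcontfun y t / (norm y)\<^sup>2 = r"
          proof -
            obtain t where "apply_bcontfun y t = norm y" using att(1) by blast
            then have "apply_bcontfun y t / (norm y)\<^sup>2 = r" using yR r by (simp add: power2_eq_square)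
            then show ?thesis by blast
          qed
          have "(\<forall>t. r / 2 \<le> apply_bcontfun y t / (norm y)\<^sup>2) \<and> 0 / (norm y)\<^sup>2 \<noteq> 0"
            by (rule S_D[OF r(1) s(1) _ _ _ _ inv att' x]) (use s y0 yR r in auto)
          then show False by simp
        qed
      qed
      then obtain y z where "periodic_weak_solution T (q - p)
          (\<lambda>t. p * q * max 0 (apply_bcontfun y t) + lam * a t * \<gamma> (norm y) (apply_bcontfun y t) + \<beta> y - p * q * apply_bcontfun y t) (apply_bcontfun y) z"
        by blast
      then have sol: "periodic_weak_solution T c
          (\<lambda>t. 1 * (\<kappa> * max 0 (apply_bcontfun y t) + lam * a t * \<gamma> (norm y) (apply_bcontfun y t) + \<beta> y) - \<kappa> * apply_bcontfun y t) (apply_bcontfun y) z"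
        unfolding qp \<kappa>_def by simp
      have y0: "apply_bcontfun y t \<ge> 0" for t
        by (rule pws_truncated_nonneg[OF T \<kappa> _ \<beta>0 \<gamma>neg sol]) auto
      note att = periodic_norm_attained[OF T pws_periodic[OF T sol] y0]
      define n where "n = norm y"
      \<comment> \<open>y = 0 does not come from any x. There \<gamma> vanishes and \<beta> = 1, so
        the source would be the constant 1, with integral T over a period.\<close>
      have n: "n > 0"
      proof (rule ccontr)
        assume "\<not> n > 0"
        then have "y = 0" by (simp add: n_def)
        then have "periodic_weak_solution T c (\<lambda>t. 1) (apply_bcontfun y) z"
          using sol by (simp add: \<beta>_def \<gamma>_def)
        from pws_integral_period[OF T this, of 0] show False using T by simp
      qed
      define x where "x = (\<lambda>t. apply_bcontfun y t / n\<^sup>2)"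
      define \<alpha> where "\<alpha> = \<beta> y / n\<^sup>2"
      have x0: "x t \<ge> 0" for t using y0 by (simp add: x_def)
      have xn: "x t \<le> 1 / n" for t
      proof -
        have "x t \<le> n / n\<^sup>2" unfolding x_def using att(2)[of t] by (intro divide_right_mono) (auto simp: n_def)
        then show ?thesis using n by (simp add: power2_eq_square)
      qed
      obtain t0 where "apply_bcontfun y t0 = n" using att(1) unfolding n_def by blast
      then have xt0: "x t0 = 1 / n" using n by (simp add: x_def power2_eq_square)
      have \<alpha>0: "\<alpha> \<ge> 0" using \<beta>0 by (simp add: \<alpha>_def)
      have solx: "periodic_weak_solution T c (\<lambda>t. 1 * (\<kappa> * x t + lam * a t * h (x t) + \<alpha>) - \<kappa> * x t) x (\<lambda>t. z t / n\<^sup>2)"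
        using rescale[OF sol y0] n unfolding x_def \<alpha>_def n_def by simp
      then have solx': "periodic_weak_solution T c (\<lambda>t. lam * a t * h (x t) + \<alpha>) x (\<lambda>t. z t / n\<^sup>2)"
        by simp
      note W = window[OF \<alpha>0 x0 solx']
      have \<alpha>_eq: "\<alpha> = M * max 0 (x \<sigma>' - 1) + (max 0 (1 - D * n))\<^sup>2 / n\<^sup>2"
      proof -
        have "max 0 (x \<sigma>' - 1) = max 0 (apply_bcontfun y \<sigma>' - n\<^sup>2) / n\<^sup>2"
          using n by (auto simp: x_def max_def field_simps)
        then show ?thesis by (simp add: \<alpha>_def \<beta>_def n_def add_divide_distrib)
      qed
      have lt1: "x \<sigma>' < 1"
      proof (rule ccontr)
        assume "\<not> x \<sigma>' < 1"
        then have gt: "x \<sigma>' > 2" using W by linarith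
        have "M * (x \<sigma>' / 2) \<le> M * max 0 (x \<sigma>' - 1)" using gt M by (intro mult_left_mono) auto
        also have "\<dots> \<le> \<alpha>" unfolding \<alpha>_eq by simp
        also have "\<dots> \<le> C3 * x \<sigma>'" using W by simp
        finally have "M / 2 * x \<sigma>' \<le> C3 * x \<sigma>'" by simp
        then have "M / 2 \<le> C3" using gt by simp
        then show False by (simp add: M_def)
      qed
      have "C3 * x \<sigma>' \<le> C3 * 1" using lt1 C3 by (intro mult_left_mono) auto
      then have \<alpha>3: "\<alpha> \<le> C3" using W by linarith
      have "D * n \<ge> 1"
      proof (rule ccontr)
        assume "\<not> D * n \<ge> 1"
        then have Dn: "D \<le> 1 / n" using n by (simp add: pos_le_divide_eq)
        have "(\<forall>t. 1 / n / 2 \<le> x t) \<and> \<alpha> \<noteq> 0"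
          by (rule S_D[OF D(2)[OF Dn] _ _ \<alpha>0 \<alpha>3 x0 xn _ solx]) (use xt0 in auto)
        then have "1 / n / 2 < 1" using lt1 by (meson le_less_trans)
        then have "1 / n < 1 * 2" by (rule iffD1[OF pos_divide_less_eq, rotated]) simp
        then show False using Dn D(1) by linarith
      qed
      then have "\<alpha> = 0" using lt1 by (simp add: \<alpha>_eq)
      then have "periodic_weak_solution T c (\<lambda>t. lam * a t * h (x t)) x (\<lambda>t. z t / n\<^sup>2)"
        using solx' by simp
      then have "positive_periodic_solution T c lam a g x"
        by (rule positive[OF _ x0, of _ _ t0]) (use xt0 n in simp)
      then show ?thesis using lt1 by blast
    qed
    ultimately obtain u v where "positive_periodic_solution T c lam a g u" "u \<sigma>' > 2"
      "positive_periodic_solution T c lam a g v" "v \<sigma>' < 1" by blast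
    then show ?thesis by (intro exI[of _ u] exI[of _ v]) auto
  qed
  then show ?thesis using lam0 by blast
qed

end
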